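(* There is a deterministic algorithm which, given a word $w$ in the letters $a^{\pm1}, b^{\pm1}, t^{\pm1}$, decides whether $w$ represents the identity element of the group $$G_{(1,2)} = \langle a,b \mid b^{-1}a^{-1}b\,a\,b^{-1}ab = a^2\rangle = \langle a,t,b \mid t^{-1}at=a^2,\ b^{-1}ab=t\rangle,$$ and which runs in time $O(|w|^7)$. In other words, the Word problem for $G_{(1,2)}$ is decidable in time $O(|w|^7)$.
   Context: $|w|$ denotes the length of the word $w$. In $G_{(1,2)}$ the letter $t$ denotes the element $b^{-1}ab$. The Word problem for $G_{(1,2)}$ is the problem of deciding, given a word in the generators and their inverses, whether it represents the identity element of the group. Time is measured by the number of elementary operations performed by the algorithm. *)

theory Defs
  imports "HOL-Algebra.Group" "HOL-Library.Landau_Symbols"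
begin

text \<open>
  The pair \<open>(x, True)\<close> is the letter \<open>x\<close> and \<open>(x, False)\<close> is its inverse.
  A presentation on the generators of type \<open>'g\<close> is a set of pairs \<open>(u, v)\<close>,
  read as defining relations \<open>u = v\<close>.
\<close>

type_synonym 'g letter = "'g \<times> bool"
type_synonym 'g word = "'g letter list"

inductive pres_eq :: "('g word \<times> 'g word) set \<Rightarrow> 'g word \<Rightarrow> 'g word \<Rightarrow> bool"
  for R where
  refl: "pres_eq R w w"
| sym: "pres_eq R u v \<Longrightarrow> pres_eq R v u"
| trans: "pres_eq R u v \<Longrightarrow> pres_eq R v w \<Longrightarrow> pres_eq R u w"
| cancel: "pres_eq R (u @ [(x, e), (x, \<not> e)] @ v) (u @ v)"
| relation: "(l, r) \<in> R \<Longrightarrow> pres_eq R (u @ l @ v) (u @ r @ v)"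

definition pres_class :: "('g word \<times> 'g word) set \<Rightarrow> 'g word \<Rightarrow> 'g word set" where
  "pres_class R w = {v. pres_eq R w v}"

definition presented_group :: "('g word \<times> 'g word) set \<Rightarrow> 'g word set monoid" where
  "presented_group R =
     \<lparr> carrier = range (pres_class R),
       monoid.mult = (\<lambda>X Y. {w. \<exists>x\<in>X. \<exists>y\<in>Y. pres_eq R (x @ y) w}),
       one = pres_class R [] \<rparr>"

definition generator :: "('g word \<times> 'g word) set \<Rightarrow> 'g \<Rightarrow> 'g word set" where
  "generator R x = pres_class R [(x, True)]"

lemma pres_eq_context:
  assumes "pres_eq R u v"
  shows "pres_eq R (p @ u @ q) (p @ v @ q)"
  using assms
proof (induction rule: pres_eq.induct)
  case (cancel u x e v)
  show ?case using pres_eq.cancel[of R "p @ u" x e "v @ q"] by simp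
next
  case (relation l r u v)
  then show ?case using pres_eq.relation[of l r R "p @ u" "v @ q"] by simp
next
  case refl
  show ?case by (rule pres_eq.refl)
next
  case sym
  from sym.IH show ?case by (rule pres_eq.sym)
next
  case trans
  from trans.IH show ?case by (rule pres_eq.trans)
qed

lemma pres_eq_append:
  assumes "pres_eq R u u'" "pres_eq R v v'"
  shows "pres_eq R (u @ v) (u' @ v')"
  using pres_eq_context[OF assms(1), of "[]" v] pres_eq_context[OF assms(2), of u' "[]"]
  by (simp, metis pres_eq.trans)

lemma pres_class_eq_iff: "pres_class R u = pres_class R v \<longleftrightarrow> pres_eq R u v"
  unfolding pres_class_def using pres_eq.refl pres_eq.sym pres_eq.trans by (metis Collect_cong mem_Collect_eq)

lemma pres_class_mult:
  "pres_class R u \<otimes>\<^bsub>presented_group R\<^esub> pres_class R v = pres_class R (u @ v)"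
proof -
  have "pres_eq R (u @ v) w" if "pres_eq R u x" "pres_eq R v y" "pres_eq R (x @ y) w" for x y w
    using pres_eq_append[OF that(1,2)] that(3) by (rule pres_eq.trans)
  then show ?thesis
    unfolding presented_group_def pres_class_def by (auto, blast intro: pres_eq.refl)
qed

lemma carrier_presented_group: "carrier (presented_group R) = range (pres_class R)"
  by (simp add: presented_group_def)

lemma one_presented_group: "\<one>\<^bsub>presented_group R\<^esub> = pres_class R []"
  by (simp add: presented_group_def)

definition inv_word :: "'g word \<Rightarrow> 'g word" where
  "inv_word w = rev (map (\<lambda>(x, e). (x, \<not> e)) w)"

lemma pres_eq_inv_word: "pres_eq R (inv_word w @ w) []"
proof (induction w)
  case Nil
  show ?case by (simp add: inv_word_def pres_eq.refl)
next
  case (Cons l w)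
  obtain x e where "l = (x, e)" by fastforce
  then show ?case
    using pres_eq.trans[OF pres_eq.cancel[of R "inv_word w" x "\<not> e" w] Cons.IH]
    by (simp add: inv_word_def)
qed

lemma group_presented_group: "group (presented_group R)"
proof (rule groupI)
  fix X assume "X \<in> carrier (presented_group R)"
  then obtain w where "X = pres_class R w" by (auto simp: carrier_presented_group)
  then have "pres_class R (inv_word w) \<otimes>\<^bsub>presented_group R\<^esub> X = \<one>\<^bsub>presented_group R\<^esub>"
    by (simp add: pres_class_mult one_presented_group pres_class_eq_iff pres_eq_inv_word)
  then show "\<exists>Y\<in>carrier (presented_group R). Y \<otimes>\<^bsub>presented_group R\<^esub> X = \<one>\<^bsub>presented_group R\<^esub>"
    by (auto simp: carrier_presented_group)
qed (auto simp: carrier_presented_group pres_class_mult one_presented_group)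

fun word_value :: "('h, 'm) monoid_scheme \<Rightarrow> ('g \<Rightarrow> 'h) \<Rightarrow> 'g word \<Rightarrow> 'h" where
  "word_value G f [] = \<one>\<^bsub>G\<^esub>"
| "word_value G f ((x, e) # w) = (if e then f x else inv\<^bsub>G\<^esub> f x) \<otimes>\<^bsub>G\<^esub> word_value G f w"

datatype gen_ab = a2 | b2
datatype gen_atb = a3 | t3 | b3

definition rel_ab :: "(gen_ab word \<times> gen_ab word) set" where
  "rel_ab =
     {([(b2, False), (a2, False), (b2, True), (a2, True), (b2, False), (a2, True), (b2, True)],
       [(a2, True), (a2, True)])}"

definition rel_atb :: "(gen_atb word \<times> gen_atb word) set" where
  "rel_atb =
     {([(t3, False), (a3, True), (t3, True)], [(a3, True), (a3, True)]),
      ([(b3, False), (a3, True), (b3, True)], [(t3, True)])}"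

definition G12 :: "gen_ab word set monoid" where
  "G12 = presented_group rel_ab"

definition G12_atb :: "gen_atb word set monoid" where
  "G12_atb = presented_group rel_atb"

fun letter_G12 :: "gen_atb \<Rightarrow> gen_ab word set" where
  "letter_G12 a3 = generator rel_ab a2"
| "letter_G12 b3 = generator rel_ab b2"
| "letter_G12 t3 =
     inv\<^bsub>G12\<^esub> (generator rel_ab b2) \<otimes>\<^bsub>G12\<^esub> generator rel_ab a2 \<otimes>\<^bsub>G12\<^esub> generator rel_ab b2"

definition word_problem_G12 :: "gen_atb word set" where
  "word_problem_G12 = {w. word_value G12 letter_G12 w = \<one>\<^bsub>G12\<^esub>}"

text \<open>
  The machine is the unit-cost RAM with words of logarithmic length. A program has finitely many
  named registers (it is a finite term) and a memory that is addressed indirectly through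
  registers. Each assignment and each test of a condition costs one unit. The word bound \<open>W\<close> is a
  limit on every number that is computed: an assignment of a larger value has no execution. It
  keeps unit-cost arithmetic from working on numbers with more than logarithmically many bits.
  Subtraction is truncated at 0, and a test asks whether a register is nonzero.
\<close>

type_synonym reg = nat

datatype ram_state = State (reg_of: "reg \<Rightarrow> nat") (mem_of: "nat \<Rightarrow> nat")

datatype prog =
    Skip
  | Set reg nat
  | Copy reg reg
  | Add reg reg reg
  | Sub reg reg reg
  | Load reg reg
  | Store reg reg
  | Seq prog prog
  | If reg prog prog
  | While reg prog

inductive exec :: "nat \<Rightarrow> prog \<Rightarrow> ram_state \<Rightarrow> nat \<Rightarrow> ram_state \<Rightarrow> bool" for W where
  Skip: "exec W Skip s 1 s"
| Set: "k \<le> W \<Longrightarrow> exec W (Set i k) (State r m) 1 (State (r(i := k)) m)"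
| Copy: "r j \<le> W \<Longrightarrow> exec W (Copy i j) (State r m) 1 (State (r(i := r j)) m)"
| Add: "r j + r k \<le> W \<Longrightarrow> exec W (Add i j k) (State r m) 1 (State (r(i := r j + r k)) m)"
| Sub: "r j - r k \<le> W \<Longrightarrow> exec W (Sub i j k) (State r m) 1 (State (r(i := r j - r k)) m)"
| Load: "m (r j) \<le> W \<Longrightarrow> exec W (Load i j) (State r m) 1 (State (r(i := m (r j))) m)"
| Store: "r j \<le> W \<Longrightarrow> exec W (Store i j) (State r m) 1 (State r (m(r i := r j)))"
| Seq: "exec W p s c s' \<Longrightarrow> exec W q s' d s'' \<Longrightarrow> exec W (Seq p q) s (c + d) s''"
| IfTrue: "reg_of s i \<noteq> 0 \<Longrightarrow> exec W p s c s' \<Longrightarrow> exec W (If i p q) s (1 + c) s'"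
| IfFalse: "reg_of s i = 0 \<Longrightarrow> exec W q s c s' \<Longrightarrow> exec W (If i p q) s (1 + c) s'"
| WhileFalse: "reg_of s i = 0 \<Longrightarrow> exec W (While i p) s 1 s"
| WhileTrue: "reg_of s i \<noteq> 0 \<Longrightarrow> exec W p s c s' \<Longrightarrow> exec W (While i p) s' d s'' \<Longrightarrow>
    exec W (While i p) s (1 + c + d) s''"

inductive_cases exec_elims:
  "exec W Skip s c s'" "exec W (Set i k) s c s'" "exec W (Copy i j) s c s'"
  "exec W (Add i j k) s c s'" "exec W (Sub i j k) s c s'" "exec W (Load i j) s c s'"
  "exec W (Store i j) s c s'" "exec W (Seq p q) s c s'" "exec W (If i p q) s c s'"
  "exec W (While i p) s c s'"

lemma exec_deterministic:
  assumes "exec W p s c s'" "exec W p s d s''"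
  shows "c = d \<and> s' = s''"
  using assms
proof (induction arbitrary: d s'' rule: exec.induct)
  case (Seq p s c s' q d' t)
  from Seq.prems obtain c1 s1 d1 where
    "d = c1 + d1" "exec W p s c1 s1" "exec W q s1 d1 s''" by (rule exec_elims)
  with Seq.IH show ?case by metis
next
  case (WhileTrue s i p c s' d' t)
  from WhileTrue.prems obtain c1 s1 d1 where
    "d = 1 + c1 + d1" "exec W p s c1 s1" "exec W (While i p) s1 d1 s''"
    by (rule exec_elims(10)) (use WhileTrue.hyps in auto)
  with WhileTrue.IH show ?case by metis
next
  case (IfTrue s i p c s' q)
  from IfTrue.prems obtain c1 where "d = 1 + c1" "exec W p s c1 s''"
    by (rule exec_elims(9)) (use IfTrue.hyps in auto)
  with IfTrue.IH show ?case by metis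
next
  case (IfFalse s i q c s' p)
  from IfFalse.prems obtain c1 where "d = 1 + c1" "exec W q s c1 s''"
    by (rule exec_elims(9)) (use IfFalse.hyps in auto)
  with IfFalse.IH show ?case by metis
next
  case (WhileFalse s i p)
  from WhileFalse.prems show ?case by (rule exec_elims(10)) (use WhileFalse.hyps in auto)
qed (erule exec_elims; simp)+

text \<open>
  Register 0 initially holds the length of the input, whose encoded letters are in the memory
  cells from 0 on. Register 0 also holds the answer (1 for yes, 0 for no) at the end.
\<close>

definition initial_state :: "('l \<Rightarrow> nat) \<Rightarrow> 'l list \<Rightarrow> ram_state" where
  "initial_state code w =
     State ((\<lambda>_. 0)(0 := length w)) (\<lambda>i. if i < length w then code (w ! i) else 0)"

definition decides ::
  "prog \<Rightarrow> ('l \<Rightarrow> nat) \<Rightarrow> 'l list set \<Rightarrow> (nat \<Rightarrow> nat) \<Rightarrow> (nat \<Rightarrow> nat) \<Rightarrow> bool" where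
  "decides p code L W T \<longleftrightarrow>
     (\<forall>w. \<exists>c s. exec (W (length w)) p (initial_state code w) c s \<and> c \<le> T (length w) \<and>
        reg_of s 0 = (if w \<in> L then 1 else 0))"

text \<open>
  The word bound has polynomial growth, so words have \<open>O(log n)\<close> bits for an input of length \<open>n\<close>.
\<close>

definition decidable_in_time :: "('l \<Rightarrow> nat) \<Rightarrow> 'l list set \<Rightarrow> (nat \<Rightarrow> real) \<Rightarrow> bool" where
  "decidable_in_time code L f \<longleftrightarrow>
     (\<exists>p W T d. decides p code L W T \<and>
        (\<lambda>n. real (W n)) \<in> O(\<lambda>n. real n ^ d) \<and> (\<lambda>n. real (T n)) \<in> O(f))"

fun letter_code :: "gen_atb letter \<Rightarrow> nat" where
  "letter_code (a3, e) = (if e then 1 else 2)"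
| "letter_code (t3, e) = (if e then 3 else 4)"
| "letter_code (b3, e) = (if e then 5 else 6)"

end

theory Submission
  imports Defs
begin

text \<open>
  The group is an HNN extension of \<open>\<langle>a, t\<rangle>\<close>, which is \<open>\<int>[1/2] \<rtimes> \<int>\<close>, with stable letter \<open>b\<close>
  conjugating \<open>a\<close> to \<open>t\<close>. Reading the word from left to right, one keeps it Britton-reduced on a
  stack of pairs \<open>(r, k)\<close> and pops when a letter \<open>b\<^sup>\<plusminus>\<^sup>1\<close> completes a pinch; the van der Waerden
  action on normal forms shows that the word is trivial iff the stack ends up as the single pair
  \<open>(0, 0)\<close>. The numbers on the stack grow like towers of exponentials, but each is a sum of at most
  \<open>n\<close> signed powers of 2, since adding appends lists and a pinch only moves a list or shifts its
  exponents. At most \<open>n\<^sup>2 + 1\<close> powers are ever introduced, and the exponent of each is a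
  combination of earlier powers, with coefficients of polynomial size. Keeping the powers sorted,
  with their exponent differences cut off at \<open>n + O(1)\<close>, a sum is compared with small integers by
  one pass over the powers that saturates from above, and tested for integrality by one that
  carries exactly from below. A pass takes \<open>O(n\<^sup>3)\<close> steps, so a new power is inserted in \<open>O(n\<^sup>5)\<close>,
  and each letter causes at most \<open>n\<close> insertions.
\<close>

section \<open>The two presentations\<close>

text \<open>The numbers \<open>r\<close> and \<open>k\<close> cannot be written down:
  \<open>a\<close> read after \<open>t^k\<close> adds \<open>2^-k\<close>, and a pinch may turn the
  result into the next \<open>k\<close>. Every decision must come from the formal sums. Hence the
  algorithm works on Britton-reduced words rather than on the normal forms on which the group acts:
  normal forms need floors and fractional parts, while a pinch only asks whether a sum is zero or an
  integer. \<open>same_element\<close> links the two processes. No exponent is computed either. A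
  pass knows the powers by their order and cut-off gaps, and the gaps of a new power are found by
  the same passes, as its exponent is a combination of powers already present. The cut-off is
  harmless because \<open>2^G\<close> exceeds the size of all coefficient sums: a nonzero partial
  sum from above, shifted by \<open>G\<close>, lies beyond the saturation bound, and a nonzero carry
  from below, shifted by \<open>G\<close>, leaves a fraction. The degree 7 is 1 for the letters, 1
  for the insertions per letter, 2 for the comparisons with about \<open>n^2\<close> powers, 2 for
  the powers met in a pass and 1 for the gap between them.\<close>

declare pres_eq.trans [trans]

lemma inv_word_simps [simp]:
  "inv_word [] = []" "inv_word ((x, e) # w) = inv_word w @ [(x, \<not> e)]"
  "inv_word (u @ v) = inv_word v @ inv_word u"
  by (simp_all add: inv_word_def)

lemma inv_word_inv_word [simp]: "inv_word (inv_word w) = w"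
  by (induction w) auto

lemma pres_eq_word_inv: "pres_eq R (w @ inv_word w) []"
  using pres_eq_inv_word[of R "inv_word w"] by simp

lemma pres_eq_inv_word_cong:
  assumes "pres_eq R u v"
  shows "pres_eq R (inv_word u) (inv_word v)"
proof -
  have "pres_eq R (inv_word u) (inv_word u @ v @ inv_word v)"
    using pres_eq_append[OF pres_eq.refl pres_eq.sym[OF pres_eq_word_inv[of R v]], of "inv_word u"]
    by simp
  also have "pres_eq R (inv_word u @ v @ inv_word v) (inv_word u @ u @ inv_word v)"
    by (rule pres_eq_context[OF pres_eq.sym[OF assms]])
  also have "pres_eq R (inv_word u @ u @ inv_word v) (inv_word v)"
    using pres_eq_append[OF pres_eq_inv_word[of R u] pres_eq.refl, of "inv_word v"] by simp
  finally   show ?thesis .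
qed

section \<open>Substitution of words for generators\<close>

definition subst_word :: "('g \<Rightarrow> 'h word) \<Rightarrow> 'g word \<Rightarrow> 'h word" where
  "subst_word f w = concat (map (\<lambda>(x, e). if e then f x else inv_word (f x)) w)"

lemma subst_word_simps [simp]:
  "subst_word f [] = []"
  "subst_word f ((x, e) # w) = (if e then f x else inv_word (f x)) @ subst_word f w"
  "subst_word f (u @ v) = subst_word f u @ subst_word f v"
  by (simp_all add: subst_word_def)

lemma subst_word_inv_word: "subst_word f (inv_word w) = inv_word (subst_word f w)"
  by (induction w) auto

lemma subst_word_subst_word:
  "subst_word g (subst_word f w) = subst_word (\<lambda>x. subst_word g (f x)) w"
  by (induction w) (auto simp: subst_word_inv_word)

text \<open>Von Dyck's theorem on words: \<open>cancel\<close> and \<open>relation\<close> are the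
  rules with content, and a substitution turns a cancelling pair of letters into a word next to its
  formal inverse.\<close>

lemma pres_eq_subst_word:
  assumes "pres_eq R u v"
    and rel: "\<And>l r. (l, r) \<in> R \<Longrightarrow> pres_eq R' (subst_word f l) (subst_word f r)"
  shows "pres_eq R' (subst_word f u) (subst_word f v)"
  using assms(1)
proof (induction rule: pres_eq.induct)
  case (cancel u x e v)
  have "pres_eq R' (subst_word f [(x, e), (x, \<not> e)]) []"
    using pres_eq_word_inv[of R' "f x"] pres_eq_inv_word[of R' "f x"] by simp
  from pres_eq_context[OF this] show ?case by simp
next
  case (relation l r u v)
  from pres_eq_context[OF rel[OF this]] show ?case by simp
qed (blast intro: pres_eq.refl pres_eq.sym pres_eq.trans)+

lemma pres_eq_subst_word_id:
  assumes "\<And>x. pres_eq R (s x) [(x, True)]"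
  shows "pres_eq R (subst_word s w) w"
proof (induction w)
  case Nil
  show ?case by (simp add: pres_eq.refl)
next
  case (Cons l w)
  obtain x e where l: "l = (x, e)" by fastforce
  have "pres_eq R (if e then s x else inv_word (s x)) [(x, e)]"
    using assms[of x] pres_eq_inv_word_cong[OF assms[of x]] by auto
  from pres_eq_append[OF this Cons.IH] show ?case by (simp add: l)
qed

lemma inv_pres_class:
  "inv\<^bsub>presented_group R\<^esub> pres_class R u = pres_class R (inv_word u)"
  by (rule group.inv_equality[OF group_presented_group])
    (auto simp: pres_class_mult one_presented_group pres_class_eq_iff pres_eq_inv_word
      carrier_presented_group)

text \<open>Products and inverses of classes are classes of concatenations and inverse words, so
  evaluation becomes a substitution. This turns \<open>word_problem_G12\<close> into a statement
  about \<open>pres_eq\<close>.\<close>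

lemma word_value_pres_class:
  assumes "\<And>x. h x = pres_class R (f x)"
  shows "word_value (presented_group R) h w = pres_class R (subst_word f w)"
  using assms by (induction w) (auto simp: one_presented_group pres_class_mult inv_pres_class)

section \<open>Elimination of \<open>t\<close> and the isomorphism of the two groups\<close>

fun ab_to_atb :: "gen_ab \<Rightarrow> gen_atb word" where
  "ab_to_atb a2 = [(a3, True)]"
| "ab_to_atb b2 = [(b3, True)]"

fun atb_to_ab :: "gen_atb \<Rightarrow> gen_ab word" where
  "atb_to_ab a3 = [(a2, True)]"
| "atb_to_ab b3 = [(b2, True)]"
| "atb_to_ab t3 = [(b2, False), (a2, True), (b2, True)]"

lemma rel_atb_t: "pres_eq rel_atb [(b3, False), (a3, True), (b3, True)] [(t3, True)]"
  using pres_eq.relation[of "[(b3, False), (a3, True), (b3, True)]" "[(t3, True)]" rel_atb "[]" "[]"]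
  by (simp add: rel_atb_def)

lemma ab_atb_ab: "subst_word atb_to_ab (subst_word ab_to_atb w) = w"
proof -
  have "subst_word atb_to_ab (ab_to_atb x) = [(x, True)]" for x by (cases x) auto
  then have "subst_word atb_to_ab (subst_word ab_to_atb w) = subst_word (\<lambda>x. [(x, True)]) w"
    by (simp add: subst_word_subst_word)
  also have "\<dots> = w" by (induction w) auto
  finally show ?thesis .
qed

lemma atb_ab_atb: "pres_eq rel_atb (subst_word ab_to_atb (subst_word atb_to_ab w)) w"
proof -
  have "pres_eq rel_atb (subst_word ab_to_atb (atb_to_ab x)) [(x, True)]" for x
    using rel_atb_t by (cases x) (auto intro: pres_eq.refl)
  then show ?thesis by (simp add: subst_word_subst_word pres_eq_subst_word_id)
qed

lemma pres_eq_ab_to_atb: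
  assumes "pres_eq rel_ab u v"
  shows "pres_eq rel_atb (subst_word ab_to_atb u) (subst_word ab_to_atb v)"
proof (rule pres_eq_subst_word[OF assms])
  fix l r assume "(l, r) \<in> rel_ab"
  \<comment> \<open>The long side of the relation is \<open>(b^-1 a b)^-1 a (b^-1 a b)\<close>;
    replacing both conjugates by \<open>t\<close> leaves \<open>t^-1 a t\<close>, which the other
    relation rewrites to \<open>a a\<close>.\<close>
  then have l: "subst_word ab_to_atb l =
      inv_word [(b3, False), (a3, True), (b3, True)] @ [(a3, True)] @ [(b3, False), (a3, True), (b3, True)]"
    and r: "subst_word ab_to_atb r = [(a3, True), (a3, True)]"
    by (auto simp: rel_ab_def)
  have "pres_eq rel_atb (subst_word ab_to_atb l) (inv_word [(t3, True)] @ [(a3, True)] @ [(t3, True)])"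
    unfolding l by (intro pres_eq_append pres_eq_inv_word_cong rel_atb_t pres_eq.refl)
  also have "pres_eq rel_atb (inv_word [(t3, True)] @ [(a3, True)] @ [(t3, True)]) (subst_word ab_to_atb r)"
    unfolding r using pres_eq.relation[of "[(t3, False), (a3, True), (t3, True)]" "[(a3, True), (a3, True)]" rel_atb "[]" "[]"]
    by (simp add: rel_atb_def)
  finally  
  show "pres_eq rel_atb (subst_word ab_to_atb l) (subst_word ab_to_atb r)" .
qed

lemma pres_eq_atb_to_ab:
  assumes "pres_eq rel_atb u v"
  shows "pres_eq rel_ab (subst_word atb_to_ab u) (subst_word atb_to_ab v)"
proof (rule pres_eq_subst_word[OF assms])
  fix l r assume "(l, r) \<in> rel_atb"
  then show "pres_eq rel_ab (subst_word atb_to_ab l) (subst_word atb_to_ab r)"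
    using pres_eq.relation[of _ _ rel_ab "[]" "[]"]
    by (auto simp: rel_atb_def rel_ab_def intro: pres_eq.refl)
qed

text \<open>An element is a set of words, so a representative has to be chosen;
  \<open>pres_eq_ab_to_atb\<close> makes the choice irrelevant.\<close>

definition iso_map :: "gen_ab word set \<Rightarrow> gen_atb word set" where
  "iso_map X = pres_class rel_atb (subst_word ab_to_atb (SOME w. X = pres_class rel_ab w))"

lemma iso_map_pres_class:
  "iso_map (pres_class rel_ab w) = pres_class rel_atb (subst_word ab_to_atb w)"
proof -
  have "pres_class rel_ab w = pres_class rel_ab (SOME v. pres_class rel_ab w = pres_class rel_ab v)"
    by (rule someI) simp
  then show ?thesis
    unfolding iso_map_def by (simp only: pres_class_eq_iff) (metis pres_eq.sym pres_eq_ab_to_atb)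
qed

text \<open>Injectivity comes from \<open>ab_atb_ab\<close>, where one composite of the translations
  is the identity on words, surjectivity from \<open>atb_ab_atb\<close>, where the other is the
  identity up to the relations.\<close>

lemma iso_map_iso: "iso_map \<in> iso G12 G12_atb"
proof (rule isoI)
  show "iso_map \<in> hom G12 G12_atb"
    by (rule homI) (auto simp: G12_def G12_atb_def carrier_presented_group iso_map_pres_class pres_class_mult)
  have "inj_on iso_map (carrier G12)"
  proof (rule inj_onI)
    fix X Y assume "X \<in> carrier G12" "Y \<in> carrier G12" and eq: "iso_map X = iso_map Y"
    then obtain u v where uv: "X = pres_class rel_ab u" "Y = pres_class rel_ab v"
      by (auto simp: G12_def carrier_presented_group)
    with eq have "pres_eq rel_atb (subst_word ab_to_atb u) (subst_word ab_to_atb v)"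
      by (simp add: iso_map_pres_class pres_class_eq_iff)
    from pres_eq_atb_to_ab[OF this] show "X = Y" by (simp add: uv ab_atb_ab pres_class_eq_iff)
  qed
  moreover have "iso_map ` carrier G12 = carrier G12_atb"
  proof -
    have "pres_class rel_atb w \<in> range (\<lambda>u. iso_map (pres_class rel_ab u))" for w
    proof -
      have "pres_class rel_atb w = iso_map (pres_class rel_ab (subst_word atb_to_ab w))"
        by (simp add: iso_map_pres_class pres_class_eq_iff pres_eq.sym[OF atb_ab_atb])
      then show ?thesis by blast
    qed
    then show ?thesis
      by (auto simp: G12_def G12_atb_def carrier_presented_group iso_map_pres_class image_iff)
  qed
  ultimately show "bij_betw iso_map (carrier G12) (carrier G12_atb)" by (simp add: bij_betw_def)
qed

lemma letter_G12_eq: "letter_G12 x = pres_class rel_ab (atb_to_ab x)"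
  by (cases x) (simp_all add: generator_def G12_def inv_pres_class pres_class_mult)

lemma iso_map_letters:
  "iso_map (generator rel_ab a2) = generator rel_atb a3"
  "iso_map (generator rel_ab b2) = generator rel_atb b3"
  "iso_map (letter_G12 t3) = generator rel_atb t3"
  unfolding letter_G12_eq
  by (simp_all add: generator_def iso_map_pres_class pres_class_eq_iff rel_atb_t)

text \<open>Carries triviality over to the presentation with \<open>t\<close>, in which
  \<open>a\<close> and \<open>t\<close> generate the base group of the HNN extension.\<close>

lemma word_problem_pres_eq:
  assumes "w \<in> word_problem_G12"
  shows "pres_eq rel_atb w []"
proof -
  from assms have "pres_eq rel_ab (subst_word atb_to_ab w) []"
    by (simp add: word_problem_G12_def word_value_pres_class[OF letter_G12_eq] G12_def
        one_presented_group pres_class_eq_iff)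
  from pres_eq_ab_to_atb[OF this] show ?thesis
    using pres_eq.trans[OF pres_eq.sym[OF atb_ab_atb[of w]]] by simp
qed

section \<open>Britton reduction\<close>

text \<open>
  A configuration \<open>(r, k, [(e\<^sub>1, r\<^sub>1, k\<^sub>1), (e\<^sub>2, r\<^sub>2, k\<^sub>2), \<dots>])\<close> stands for the product
  \<open>\<dots> (a\<^bsup>r\<^sub>2\<^esup> t\<^bsup>k\<^sub>2\<^esup>) b\<^bsup>e\<^sub>2\<^esup> (a\<^bsup>r\<^sub>1\<^esup> t\<^bsup>k\<^sub>1\<^esup>) b\<^bsup>e\<^sub>1\<^esup> (a\<^bsup>r\<^esup> t\<^bsup>k\<^esup>)\<close>, where \<open>a\<^bsup>r\<^esup>\<close> for a dyadic \<open>r\<close>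
  makes sense because \<open>t a t\<^sup>-\<^sup>1\<close> is a square root of \<open>a\<close>; an exponent \<open>e\<^sub>i\<close> is \<open>True\<close> for 1.
\<close>

type_synonym config = "real \<times> int \<times> (bool \<times> real \<times> int) list"

text \<open>Since \<open>t^k a = a^(2^-k) t^k\<close>, a letter \<open>a\<close> changes
  \<open>r\<close> by \<open>2^-k\<close>. The popping clauses are the pinches
  \<open>b^-1 a^r b = t^r\<close> (for \<open>k = 0\<close> and integral \<open>r\<close>) and
  \<open>b t^k b^-1 = a^k\<close> (for \<open>r = 0\<close>); in the latter case \<open>a^k\<close>
  also moves left past \<open>t^k'\<close>.\<close>

fun britton_step :: "gen_atb letter \<Rightarrow> config \<Rightarrow> config" where
  "britton_step (a3, e) (r, k, l) = (r + (if e then 1 else -1) * 2 powi (- k), k, l)"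
| "britton_step (t3, e) (r, k, l) = (r, k + (if e then 1 else -1), l)"
| "britton_step (b3, e) (r, k, []) = (0, 0, [(e, r, k)])"
| "britton_step (b3, True) (r, k, (e', r', k') # l) =
    (if \<not> e' \<and> k = 0 \<and> r \<in> \<int> then (r', k' + \<lfloor>r\<rfloor>, l) else (0, 0, (True, r, k) # (e', r', k') # l))"
| "britton_step (b3, False) (r, k, (e', r', k') # l) =
    (if e' \<and> r = 0 then (r' + 2 powi (- k') * k, k', l)
     else (0, 0, (False, r, k) # (e', r', k') # l))"

text \<open>
  The same moves on configurations in Britton normal form, where every stacked pair is the
  representative of its left coset of \<open>\<langle>a\<rangle>\<close> or of \<open>\<langle>t\<rangle>\<close>. On these the group acts.
\<close>

fun normal_step :: "gen_atb letter \<Rightarrow> config \<Rightarrow> config" where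
  "normal_step (a3, e) (r, k, l) = (r + (if e then 1 else -1) * 2 powi (- k), k, l)"
| "normal_step (t3, e) (r, k, l) = (r, k + (if e then 1 else -1), l)"
| "normal_step (b3, True) (r, k, l) =
    (if k = 0 \<and> r \<in> \<int> \<and> l \<noteq> [] \<and> \<not> fst (hd l)
     then (fst (snd (hd l)), snd (snd (hd l)) + \<lfloor>r\<rfloor>, tl l)
     else (0, \<lfloor>2 powi k * r\<rfloor>, (True, 2 powi (- k) * frac (2 powi k * r), k) # l))"
| "normal_step (b3, False) (r, k, l) =
    (if r = 0 \<and> l \<noteq> [] \<and> fst (hd l)
     then (fst (snd (hd l)) + 2 powi (- snd (snd (hd l))) * k, snd (snd (hd l)), tl l)
     else (k, 0, (False, r, 0) # l))"

text \<open>As \<open>a^r t^k a^y = a^(r + 2^-k y) t^k\<close>, each left coset of the powers of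
  \<open>a\<close> has one member with \<open>2^k r\<close> in \<open>[0, 1)\<close>, and each left
  coset of the powers of \<open>t\<close> one with \<open>k = 0\<close>. The remaining clause
  excludes a trivial pair between opposite letters \<open>b\<close>.\<close>

fun normal_stack :: "(bool \<times> real \<times> int) list \<Rightarrow> bool" where
  "normal_stack [] = True"
| "normal_stack ((e, r, k) # l) \<longleftrightarrow>
    (if e then 0 \<le> 2 powi k * r \<and> 2 powi k * r < 1 else k = 0) \<and>
    \<not> (r = 0 \<and> k = 0 \<and> l \<noteq> [] \<and> fst (hd l) \<noteq> e) \<and> normal_stack l"

definition normal :: "config \<Rightarrow> bool" where
  "normal s \<longleftrightarrow> normal_stack (snd (snd s))"

section \<open>The action of the group on normal forms\<close>

lemma powi_2_cancel [simp]:
  "2 powi (- k) * (2 powi k * x) = (x :: real)" "2 powi k * (2 powi (- k) * x) = (x :: real)"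
  by (simp_all add: power_int_minus flip: mult.assoc)

lemma powi_2_inverse [simp]:
  "2 powi k * 2 powi (- k) = (1 :: real)" "2 powi (- k) * 2 powi k = (1 :: real)"
  by (simp_all add: power_int_minus)

lemma frac_eq_self: "0 \<le> x \<Longrightarrow> x < 1 \<Longrightarrow> frac x = (x :: real)"
  by (simp add: frac_eq)

lemma normal_step_normal:
  assumes "normal s"
  shows "normal (normal_step x s)"
proof -
  obtain r k l where s: "s = (r, k, l)" by (cases s) auto
  obtain c e where x: "x = (c, e)" by fastforce
  have "normal_stack l \<Longrightarrow> normal_stack (tl l)" for l by (cases l rule: normal_stack.cases) auto
  then show ?thesis
    using assms unfolding s x
    by (cases "(c, e)" rule: letter_code.cases; cases e)
      (auto simp: normal_def frac_lt_1 frac_eq_0_iff)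
qed

text \<open>After a push the inverse letter pops at once. After a pop it must push the same pair
  back: uniqueness of coset representatives gives the pair, and the absence of pinches in the stack
  prevents a further pop.\<close>

lemma normal_step_cancel:
  assumes "normal s"
  shows "normal_step (x, \<not> e) (normal_step (x, e) s) = s"
proof -
  obtain r k l where s: "s = (r, k, l)" by (cases s) auto
  show ?thesis
  proof (cases x)
    case b3
    show ?thesis
    proof (cases e)
      case True
      show ?thesis
      proof (cases "k = 0 \<and> r \<in> \<int> \<and> l \<noteq> [] \<and> \<not> fst (hd l)")
        case pop: True
        then obtain r' k' l' where l: "l = (False, r', k') # l'" by (cases l) auto
        with assms pop show ?thesis by (auto simp: s b3 True normal_def elim!: Ints_cases)
      next
        case False
        then have "normal_step (b3, True) s =
            (0, \<lfloor>2 powi k * r\<rfloor>, (True, 2 powi (- k) * frac (2 powi k * r), k) # l)"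
          by (auto simp: s)
        moreover have "2 powi (- k) * frac (2 powi k * r) + 2 powi (- k) * of_int \<lfloor>2 powi k * r\<rfloor> = r"
          by (simp add: frac_def algebra_simps)
        ultimately show ?thesis by (simp add: s b3 True)
      qed
    next
      case False
      show ?thesis
      proof (cases "r = 0 \<and> l \<noteq> [] \<and> fst (hd l)")
        case pop: True
        then obtain r' k' l' where l: "l = (True, r', k') # l'" by (cases l) auto
        have fl: "2 powi k' * r' + of_int k = of_int k + 2 powi k' * r'" by simp
        from assms have n: "0 \<le> 2 powi k' * r'" "2 powi k' * r' < 1"
          and np: "\<not> (r' = 0 \<and> k' = 0 \<and> l' \<noteq> [] \<and> \<not> fst (hd l'))"
          by (auto simp: s l normal_def)
        have e: "2 powi k' * (r' + 2 powi (- k') * of_int k) = 2 powi k' * r' + of_int k"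
          by (simp add: algebra_simps)
        have f: "\<lfloor>2 powi k' * r' + of_int k\<rfloor> = k" using n by linarith
        have g: "frac (2 powi k' * r' + of_int k) = 2 powi k' * r'"
          using n f unfolding frac_def by simp
        \<comment> \<open>A further pop by \<open>b\<close> would need \<open>k' = 0\<close> and an
          integral first component; its fractional part is then \<open>r'\<close>, so the pair would
          be trivial between opposite letters, against \<open>np\<close>.\<close>
        have "\<not> (k' = 0 \<and> r' + 2 powi (- k') * of_int k \<in> \<int> \<and> l' \<noteq> [] \<and> \<not> fst (hd l'))"
        proof
          assume *: "k' = 0 \<and> r' + 2 powi (- k') * of_int k \<in> \<int> \<and> l' \<noteq> [] \<and> \<not> fst (hd l')"
          then have "frac (r' + of_int k) = 0" by (auto simp: frac_eq_0_iff)
          with * g have "r' = 0" by simp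
          with * np show False by simp
        qed
        with pop show ?thesis by (auto simp: s b3 False l e f g frac_eq_self[OF n])
      next
        case push: False
        then show ?thesis by (auto simp: s b3 False)
      qed
    qed
  qed (auto simp: s)
qed

lemma normal_step_relations:
  assumes "(u, v) \<in> rel_atb" "normal s"
  shows "fold normal_step u s = fold normal_step v s"
proof -
  obtain r k l where s: "s = (r, k, l)" by (cases s) auto
  have t: "fold normal_step [(t3, False), (a3, True), (t3, True)] s =
      fold normal_step [(a3, True), (a3, True)] s"
    by (simp add: s power_int_diff power_int_minus divide_inverse)
  have n: "normal (normal_step (b3, False) s)" using assms(2) by (rule normal_step_normal)
  \<comment> \<open>The relation \<open>b^-1 a b = t\<close>. If \<open>b^-1\<close> pops,
    \<open>a\<close> raises only the integral part, so \<open>b\<close> pushes the same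
    representative back with \<open>k + 1\<close> on top. Otherwise \<open>b^-1\<close> turns
    \<open>t^k\<close> into \<open>a^k\<close>, and \<open>b\<close> turns \<open>a^(k + 1)\<close>
    back into \<open>t^(k + 1)\<close>.\<close>
  have *: "normal_step (b3, True) (normal_step (a3, True) (normal_step (b3, False) s)) =
      normal_step (t3, True) s"
  proof (cases "r = 0 \<and> l \<noteq> [] \<and> fst (hd l)")
    case pop: True
    then obtain r' k' l' where l: "l = (True, r', k') # l'" by (cases l) auto
    from assms have n: "0 \<le> 2 powi k' * r'" "2 powi k' * r' < 1"
      and np: "\<not> (r' = 0 \<and> k' = 0 \<and> l' \<noteq> [] \<and> \<not> fst (hd l'))"
      by (auto simp: s l normal_def)
    have q: "r' + 2 powi (- k') * of_int k + 2 powi (- k') = r' + 2 powi (- k') * of_int (k + 1)"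
      by (simp add: algebra_simps)
    have e: "2 powi k' * (r' + 2 powi (- k') * of_int (k + 1)) = 2 powi k' * r' + of_int (k + 1)"
      by (simp add: algebra_simps)
    have f: "\<lfloor>2 powi k' * r' + of_int (k + 1)\<rfloor> = k + 1" using n by linarith
    have g: "frac (2 powi k' * r' + of_int (k + 1)) = 2 powi k' * r'"
      using n f unfolding frac_def by simp
    have "\<not> (k' = 0 \<and> r' + 2 powi (- k') * of_int (k + 1) \<in> \<int> \<and> l' \<noteq> [] \<and> \<not> fst (hd l'))"
    proof
      assume *: "k' = 0 \<and> r' + 2 powi (- k') * of_int (k + 1) \<in> \<int> \<and> l' \<noteq> [] \<and> \<not> fst (hd l')"
      then have "frac (r' + of_int (k + 1)) = 0" by (auto simp: frac_eq_0_iff)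
      with * g have "r' = 0" by simp
      with * np show False by simp
    qed
    with pop show ?thesis by (auto simp: s l q e f g frac_eq_self[OF n] simp del: of_int_add)
  next
    case False
    then have "normal_step (b3, False) s = (of_int k, 0, (False, r, 0) # l)" by (auto simp: s)
    then show ?thesis by (simp add: s)
  qed
  then have "fold normal_step [(b3, False), (a3, True), (b3, True)] s = fold normal_step [(t3, True)] s"
    by simp
  with t assms(1) show ?thesis unfolding rel_atb_def by blast
qed

lemma fold_normal_step_normal: "normal s \<Longrightarrow> normal (fold normal_step w s)"
  by (induction w arbitrary: s) (auto simp: normal_step_normal)

lemma pres_eq_fold_normal_step:
  assumes "pres_eq rel_atb u v" "normal s"
  shows "fold normal_step u s = fold normal_step v s"
  using assms
  by (induction arbitrary: s rule: pres_eq.induct)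
    (auto simp: normal_step_cancel normal_step_relations fold_normal_step_normal
      simp del: normal_step.simps)

text \<open>
  The two processes agree up to pushing elements of \<open>\<langle>a\<rangle>\<close> and \<open>\<langle>t\<rangle>\<close> through the letters \<open>b\<^sup>\<plusminus>\<^sup>1\<close>.
\<close>

fun same_element :: "real \<Rightarrow> int \<Rightarrow> (bool \<times> real \<times> int) list \<Rightarrow>
    real \<Rightarrow> int \<Rightarrow> (bool \<times> real \<times> int) list \<Rightarrow> bool" where
  "same_element r k [] r' k' [] \<longleftrightarrow> r = r' \<and> k = k'"
| "same_element r k ((e, r1, k1) # l) r' k' ((e', r1', k1') # l') \<longleftrightarrow> e = e' \<and>
    (\<exists>x :: int. if e
      then same_element r1 k1 l (r1' + 2 powi (- k1') * x) k1' l' \<and> r' = 2 powi (- x) * r \<and> k' = x + k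
      else same_element r1 k1 l r1' (k1' + x) l' \<and> r' = of_int x + r \<and> k' = k)"
| "same_element _ _ _ _ _ _ \<longleftrightarrow> False"

lemma same_element_mult_a:
  "same_element r k l r' k' l' \<Longrightarrow>
    same_element (r + 2 powi (- k) * y) k l (r' + 2 powi (- k') * y) k' l'"
proof (induction r k l r' k' l' rule: same_element.induct)
  case (2 r k e r1 k1 l r' k' e' r1' k1' l')
  then show ?case
    by (auto simp: algebra_simps power_int_add power_int_diff power_int_minus divide_simps)
qed auto

lemma same_element_mult_t:
  "same_element r k l r' k' l' \<Longrightarrow> same_element r (k + y) l r' (k' + y) l'"
proof (induction r k l r' k' l' rule: same_element.induct)
  case (2 r k e r1 k1 l r' k' e' r1' k1' l')
  then show ?case by (auto simp: algebra_simps)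
qed auto

text \<open>Both processes pop at the same moments: right of \<open>b^-1\<close> their top pairs
  differ by an integer in \<open>r\<close> and agree in \<open>k\<close>, right of \<open>b\<close>
  the first component is scaled by a power of 2. So \<open>k = 0\<close> with integral
  \<open>r\<close>, and \<open>r = 0\<close>, are seen alike by both.\<close>

lemma same_element_step:
  assumes "same_element r k l r' k' l'"
    and "britton_step x (r, k, l) = (r1, k1, l1)" "normal_step x (r', k', l') = (r1', k1', l1')"
  shows "same_element r1 k1 l1 r1' k1' l1'"
proof -
  have push_T: "same_element 0 0 ((True, r, k) # l) 0 \<lfloor>2 powi k' * r'\<rfloor>
      ((True, 2 powi (- k') * frac (2 powi k' * r'), k') # l')"
  proof -
    have "2 powi (- k') * frac (2 powi k' * r') + 2 powi (- k') * of_int \<lfloor>2 powi k' * r'\<rfloor> = r'"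
      by (simp add: frac_def algebra_simps)
    with assms(1) show ?thesis by (auto intro!: exI[of _ "\<lfloor>2 powi k' * r'\<rfloor>"])
  qed
  have push_F: "same_element 0 0 ((False, r, k) # l) k' 0 ((False, r', 0) # l')"
    using assms(1) by (auto intro!: exI[of _ k'])
  consider (a) e where "x = (a3, e)" | (t) e where "x = (t3, e)" | (T) "x = (b3, True)"
    | (F) "x = (b3, False)" by (cases x rule: letter_code.cases; cases "snd x") auto
  then show ?thesis
  proof cases
    case a
    then show ?thesis
      using assms same_element_mult_a[OF assms(1), of 1] same_element_mult_a[OF assms(1), of "-1"]
      by (auto split: if_splits)
  next
    case t
    then show ?thesis using assms same_element_mult_t[OF assms(1)] by auto
  next
    case T
    show ?thesis
    proof (cases l)
      case Nil
      with assms(1) have "l' = []" by (cases l') auto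
      with Nil T assms push_T show ?thesis by auto
    next
      case (Cons p m)
      obtain e r2 k2 where p: "p = (e, r2, k2)" by (cases p) auto
      with assms(1) Cons obtain r2' k2' m' where l': "l' = (e, r2', k2') # m'" by (cases l') auto
      show ?thesis
      proof (cases "e \<or> k \<noteq> 0 \<or> r \<notin> \<int>")
        case True
        moreover have "e \<or> k' \<noteq> 0 \<or> r' \<notin> \<int>"
          using True assms(1) Cons p l' by (auto simp: add_in_Ints_iff_left)
        ultimately have "r1 = 0 \<and> k1 = 0 \<and> l1 = (True, r, k) # l"
            "r1' = 0 \<and> k1' = \<lfloor>2 powi k' * r'\<rfloor> \<and>
              l1' = (True, 2 powi (- k') * frac (2 powi k' * r'), k') # l'"
          using assms(2,3) T Cons p l' by auto
        with push_T show ?thesis by (simp only:)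
      next
        case False
        with assms(1) Cons p l' obtain x :: int where
          x: "same_element r2 k2 m r2' (k2' + x) m'" "r' = x + r" "k' = 0" by auto
        from same_element_mult_t[OF x(1), of "\<lfloor>r\<rfloor>"] show ?thesis
          using False assms(2,3) T Cons p l' x(2,3) by (auto simp: add.assoc)
      qed
    qed
  next
    case F
    show ?thesis
    proof (cases l)
      case Nil
      with assms(1) have "l' = []" by (cases l') auto
      with Nil F assms push_F show ?thesis by auto
    next
      case (Cons p m)
      obtain e r2 k2 where p: "p = (e, r2, k2)" by (cases p) auto
      with assms(1) Cons obtain r2' k2' m' where l': "l' = (e, r2', k2') # m'" by (cases l') auto
      show ?thesis
      proof (cases "\<not> e \<or> r \<noteq> 0")
        case True
        moreover have "\<not> e \<or> r' \<noteq> 0" using True assms(1) Cons p l' by auto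
        ultimately have "r1 = 0 \<and> k1 = 0 \<and> l1 = (False, r, k) # l"
            "r1' = k' \<and> k1' = 0 \<and> l1' = (False, r', 0) # l'"
          using assms(2,3) F Cons p l' by auto
        with push_F show ?thesis by (simp only:)
      next
        case False
        with assms(1) Cons p l' obtain x :: int where
          x: "same_element r2 k2 m (r2' + 2 powi (- k2') * x) k2' m'" "r' = 0" "k' = x + k" by auto
        from same_element_mult_a[OF x(1), of k] show ?thesis
          using False assms(2,3) F Cons p l' x(2,3) by (auto simp: algebra_simps)
      qed
    qed
  qed
qed

text \<open>The normal form process returns to its start because a trivial word acts as the
  identity, and \<open>same_element\<close> with an empty stack is equality.\<close>

lemma britton_complete:
  assumes "pres_eq rel_atb w []"
  shows "fold britton_step w (0, 0, []) = (0, 0, [])"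
proof -
  have "same_element r k l r' k' l' \<Longrightarrow>
      fold britton_step w (r, k, l) = (r1, k1, l1) \<Longrightarrow> fold normal_step w (r', k', l') = (r1', k1', l1') \<Longrightarrow>
      same_element r1 k1 l1 r1' k1' l1'" for w r k l r' k' l' r1 k1 l1 r1' k1' l1'
  proof (induction w arbitrary: r k l r' k' l')
    case (Cons x w)
    obtain r2 k2 l2 where 2: "britton_step x (r, k, l) = (r2, k2, l2)" by (metis prod.exhaust)
    obtain r3 k3 l3 where 3: "normal_step x (r', k', l') = (r3, k3, l3)" by (metis prod.exhaust)
    from Cons.IH[OF same_element_step[OF Cons.prems(1) 2 3]] Cons.prems(2,3) show ?case
      by (simp add: 2 3)
  qed simp
  moreover have "fold normal_step w (0, 0, []) = (0, 0, [])"
    using pres_eq_fold_normal_step[OF assms, of "(0, 0, [])"] by (simp add: normal_def)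
  moreover obtain r k l where "fold britton_step w (0, 0, []) = (r, k, l)" by (metis prod.exhaust)
  ultimately have "same_element r k l 0 0 []" by (metis same_element.simps(1))
  then have "r = 0 \<and> k = 0 \<and> l = []" by (cases l) auto
  with \<open>fold britton_step w (0, 0, []) = (r, k, l)\<close> show ?thesis by simp
qed

section \<open>Soundness of Britton reduction\<close>

lemma (in group) inv_cancel_left:
  assumes "x \<in> carrier G" "y \<in> carrier G"
  shows "x \<otimes> (inv x \<otimes> y) = y" "inv x \<otimes> (x \<otimes> y) = y"
  using assms by (simp_all flip: m_assoc)

lemma (in group) int_pow_conj:
  assumes "x \<in> carrier G" "y \<in> carrier G"
  shows "inv x \<otimes> y [^] (n :: int) \<otimes> x = (inv x \<otimes> y \<otimes> x) [^] n"
proof -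
  have "(\<lambda>y. inv x \<otimes> y \<otimes> x) \<in> hom G G"
    using assms(1) by (auto intro!: homI simp: m_assoc inv_cancel_left)
  then interpret group_hom G G "\<lambda>y. inv x \<otimes> y \<otimes> x" by unfold_locales
  show ?thesis using assms hom_int_pow by simp
qed

text \<open>Soundness uses the defining relations alone, so it is proved for any three elements of a
  group that satisfy them and instantiated with \<open>G12\<close>.\<close>

locale baumslag_gersten = group G for G (structure) +
  fixes a t b
  assumes gens [simp]: "a \<in> carrier G" "t \<in> carrier G" "b \<in> carrier G"
    and rel_t: "inv t \<otimes> a \<otimes> t = a \<otimes> a"
    and rel_b: "inv b \<otimes> a \<otimes> b = t"
begin

lemma conj_b: "inv b \<otimes> a [^] (n :: int) \<otimes> b = t [^] n"
  by (simp add: int_pow_conj rel_b)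

lemma conj_b': "b \<otimes> t [^] (n :: int) \<otimes> inv b = a [^] n"
  by (simp add: conj_b[symmetric] m_assoc inv_cancel_left)

lemma conj_t: "inv t \<otimes> a [^] (n :: int) \<otimes> t = a [^] (2 * n)"
proof -
  have "inv t \<otimes> a [^] n \<otimes> t = (a [^] (2 :: int)) [^] n"
    by (simp add: int_pow_conj rel_t) (metis gens(1) int_pow_1 int_pow_mult one_add_one)
  then show ?thesis by (simp add: int_pow_pow)
qed

lemma a_t: "a [^] (n :: int) \<otimes> t = t \<otimes> a [^] (2 * n)"
  by (simp add: conj_t[symmetric] m_assoc inv_cancel_left)

lemma t_a: "t [^] (- int l) \<otimes> a [^] (n :: int) = a [^] (2 ^ l * n) \<otimes> t [^] (- int l)"
proof (induction l arbitrary: n)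
  case (Suc l)
  have t: "t [^] (- int (Suc l)) = t [^] (- int l) \<otimes> inv t"
    using int_pow_mult[of t "- int l" "-1"] by (simp add: int_pow_neg algebra_simps)
  have "inv t \<otimes> a [^] n = a [^] (2 * n) \<otimes> inv t"
    by (simp add: conj_t[symmetric] m_assoc)
  then have "t [^] (- int l) \<otimes> inv t \<otimes> a [^] n = t [^] (- int l) \<otimes> a [^] (2 * n) \<otimes> inv t"
    by (simp add: m_assoc)
  also have "\<dots> = a [^] (2 ^ Suc l * n) \<otimes> (t [^] (- int l) \<otimes> inv t)"
    by (simp add: Suc.IH m_assoc mult.assoc mult.left_commute)
  finally show ?case unfolding t .
qed simp

text \<open>For \<open>r = n / 2^j\<close> the element \<open>a^r\<close> is
  \<open>t^j a^n t^-j\<close>, hence \<open>a^r t^k\<close> is \<open>t^j a^n t^-l\<close> with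
  \<open>l = j - k\<close>. The denominator is left open, so it can be enlarged when needed.\<close>

definition represents :: "'a \<Rightarrow> real \<Rightarrow> int \<Rightarrow> bool" where
  "represents g r k \<longleftrightarrow> (\<exists>j l :: nat. \<exists>n :: int.
     g = t [^] int j \<otimes> a [^] n \<otimes> t [^] (- int l) \<and> r = of_int n / 2 ^ j \<and> k = int j - int l)"

lemma represents_one: "represents \<one> 0 0"
  unfolding represents_def by (rule exI[of _ 0], rule exI[of _ 0], rule exI[of _ 0]) simp

lemma represents_mult_a:
  assumes "represents g r k"
  shows "represents (g \<otimes> a [^] (y :: int)) (r + 2 powi (- k) * y) k"
proof -
  from assms obtain j l :: nat and n :: int where
    g: "g = t [^] int j \<otimes> a [^] n \<otimes> t [^] (- int l)" and r: "r = of_int n / 2 ^ j" and k: "k = int j - int l"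
    unfolding represents_def by blast
  have "g \<otimes> a [^] y = t [^] int j \<otimes> a [^] (n + 2 ^ l * y) \<otimes> t [^] (- int l)"
    by (simp add: g m_assoc t_a int_pow_mult)
  moreover have "r + 2 powi (- k) * y = of_int (n + 2 ^ l * y) / 2 ^ j"
    by (simp add: r k power_int_diff field_simps)
  ultimately show ?thesis using k unfolding represents_def by blast
qed

lemma represents_mult_t1:
  assumes "represents g r k"
  shows "represents (g \<otimes> t) r (k + 1)"
proof -
  from assms obtain j l :: nat and n :: int where
    g: "g = t [^] int j \<otimes> a [^] n \<otimes> t [^] (- int l)" and r: "r = of_int n / 2 ^ j" and k: "k = int j - int l"
    unfolding represents_def by blast
  show ?thesis
  proof (cases l)
    case 0
    \<comment> \<open>No \<open>t^-1\<close> is left on the right to cancel, so \<open>t\<close>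
      crosses \<open>a^n\<close> by \<open>a_t\<close> and the fraction is expanded to
      \<open>2n / 2^(j+1)\<close>.\<close>
    have "t [^] (int (Suc j)) = t [^] int j \<otimes> t" using int_pow_mult[of t "int j" 1] by (simp add: add.commute)
    then have "g \<otimes> t = t [^] int (Suc j) \<otimes> a [^] (2 * n) \<otimes> t [^] (- int 0)"
      using a_t[of n] by (simp add: g 0 m_assoc)
    moreover have "r = of_int (2 * n) / 2 ^ Suc j" "k + 1 = int (Suc j) - int 0" using r k 0 by auto
    ultimately show ?thesis unfolding represents_def by blast
  next
    case (Suc m)
    have "t [^] (- int m) = t [^] (- int l) \<otimes> t" using int_pow_mult[of t "- int l" 1] Suc by simp
    then have "g \<otimes> t = t [^] int j \<otimes> a [^] n \<otimes> t [^] (- int m)" by (simp add: g m_assoc)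
    moreover have "k + 1 = int j - int m" using k Suc by simp
    ultimately show ?thesis using r unfolding represents_def by blast
  qed
qed

lemma represents_mult_t:
  assumes "represents g r k"
  shows "represents (g \<otimes> t [^] (y :: int)) r (k + y)"
proof (cases "y \<ge> 0")
  case True
  then obtain m :: nat where y: "y = int m" using nonneg_int_cases by blast
  have "represents (g \<otimes> t [^] int m) r (k + int m)"
  proof (induction m)
    case 0
    from assms have "g \<in> carrier G" by (auto simp: represents_def)
    with assms show ?case by simp
  next
    case (Suc m)
    from assms have "g \<in> carrier G" by (auto simp: represents_def)
    then have "g \<otimes> t [^] int (Suc m) = g \<otimes> t [^] int m \<otimes> t"
      using int_pow_mult[of t "int m" 1] by (simp add: m_assoc add.commute)
    with represents_mult_t1[OF Suc.IH] show ?case by (simp add: algebra_simps)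
  qed
  with y show ?thesis by simp
next
  case False
  from assms obtain j l :: nat and n :: int where
    g: "g = t [^] int j \<otimes> a [^] n \<otimes> t [^] (- int l)" and r: "r = of_int n / 2 ^ j" and k: "k = int j - int l"
    unfolding represents_def by blast
  from False have y: "- int (l + nat (- y)) = - int l + y" by simp
  have "g \<otimes> t [^] y = t [^] int j \<otimes> a [^] n \<otimes> t [^] (- int (l + nat (- y)))"
    unfolding y int_pow_mult[OF gens(2)] by (simp add: g m_assoc)
  moreover have "k + y = int j - int (l + nat (- y))" using False k by simp
  ultimately show ?thesis using r unfolding represents_def by blast
qed

lemma represents_0_left: "represents g 0 k \<Longrightarrow> g = t [^] k"
  by (auto simp: represents_def int_pow_diff int_pow_neg)

lemma represents_0_right:
  assumes "represents g r 0" "r \<in> \<int>"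
  shows "g = a [^] \<lfloor>r\<rfloor>"
proof -
  from assms(1) obtain j l :: nat and n :: int where
    g: "g = t [^] int j \<otimes> a [^] n \<otimes> t [^] (- int l)" and r: "r = of_int n / 2 ^ j" and "0 = int j - int l"
    unfolding represents_def by blast
  then have l: "l = j" by simp
  \<comment> \<open>An integral \<open>r\<close> means \<open>n = 2^j r\<close>, and
    \<open>t_a\<close> carries \<open>a^r\<close> out of the conjugate by
    \<open>t^j\<close>.\<close>
  from r have "of_int n = (2 ^ j * of_int \<lfloor>r\<rfloor> :: real)" using assms(2) by (simp add: field_simps)
  then have n: "n = 2 ^ j * \<lfloor>r\<rfloor>" using of_int_eq_iff[where 'a = real, of n "2 ^ j * \<lfloor>r\<rfloor>"] by simp
  show ?thesis unfolding g l n
    by (simp add: m_assoc t_a[symmetric]) (simp add: int_pow_neg flip: m_assoc)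
qed

fun represents_config :: "'a \<Rightarrow> real \<Rightarrow> int \<Rightarrow> (bool \<times> real \<times> int) list \<Rightarrow> bool" where
  "represents_config g r k [] \<longleftrightarrow> represents g r k"
| "represents_config g r k ((e, r', k') # l) \<longleftrightarrow>
    (\<exists>g1 g2. g = g1 \<otimes> (if e then b else inv b) \<otimes> g2 \<and> represents_config g1 r' k' l \<and> represents g2 r k)"

lemma represents_carrier: "represents g r k \<Longrightarrow> g \<in> carrier G"
  by (auto simp: represents_def)

lemma represents_config_carrier: "represents_config g r k l \<Longrightarrow> g \<in> carrier G"
proof (induction l arbitrary: g r k)
  case (Cons p l)
  obtain e r' k' where "p = (e, r', k')" by (cases p) auto
  with Cons.prems obtain g1 g2 where "g = g1 \<otimes> (if e then b else inv b) \<otimes> g2"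
    "represents_config g1 r' k' l" "represents g2 r k" by auto
  with Cons.IH represents_carrier show ?case by (metis gens(3) inv_closed m_closed)
qed (simp add: represents_carrier)

lemma represents_config_mult_a:
  assumes "represents_config g r k l"
  shows "represents_config (g \<otimes> a [^] (y :: int)) (r + 2 powi (- k) * y) k l"
proof (cases l)
  case (Cons p l')
  obtain e r' k' where p: "p = (e, r', k')" by (cases p) auto
  with assms Cons obtain g1 g2 where g: "g = g1 \<otimes> (if e then b else inv b) \<otimes> g2"
    "represents_config g1 r' k' l'" "represents g2 r k" by auto
  have "g \<otimes> a [^] y = g1 \<otimes> (if e then b else inv b) \<otimes> (g2 \<otimes> a [^] y)"
    using g represents_carrier[OF g(3)] represents_config_carrier[OF g(2)] by (simp add: m_assoc)
  with g represents_mult_a[OF g(3), of y] show ?thesis unfolding Cons p represents_config.simps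
    by blast
qed (use assms represents_mult_a in auto)

lemma represents_config_mult_t:
  assumes "represents_config g r k l"
  shows "represents_config (g \<otimes> t [^] (y :: int)) r (k + y) l"
proof (cases l)
  case (Cons p l')
  obtain e r' k' where p: "p = (e, r', k')" by (cases p) auto
  with assms Cons obtain g1 g2 where g: "g = g1 \<otimes> (if e then b else inv b) \<otimes> g2"
    "represents_config g1 r' k' l'" "represents g2 r k" by auto
  have "g \<otimes> t [^] y = g1 \<otimes> (if e then b else inv b) \<otimes> (g2 \<otimes> t [^] y)"
    using g represents_carrier[OF g(3)] represents_config_carrier[OF g(2)] by (simp add: m_assoc)
  with g represents_mult_t[OF g(3), of y] show ?thesis unfolding Cons p represents_config.simps
    by blast
qed (use assms represents_mult_t in auto)

fun gen_value :: "gen_atb \<Rightarrow> 'a" where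
  "gen_value a3 = a" | "gen_value t3 = t" | "gen_value b3 = b"

definition letter_value :: "gen_atb letter \<Rightarrow> 'a" where
  "letter_value x = (if snd x then gen_value (fst x) else inv (gen_value (fst x)))"

lemma letter_value_carrier [simp]: "letter_value x \<in> carrier G"
  by (cases "fst x") (auto simp: letter_value_def)

text \<open>A push puts the trivial pair after the new letter; a pop is \<open>conj_b\<close> or
  \<open>conj_b'\<close> followed by absorption into the pair below.\<close>

lemma represents_config_step:
  assumes g: "represents_config g r k l" and step: "britton_step x (r, k, l) = (r1, k1, l1)"
  shows "represents_config (g \<otimes> letter_value x) r1 k1 l1"
proof -
  note gc = represents_config_carrier[OF g]
  have push: "represents_config (g \<otimes> letter_value (b3, e)) 0 0 ((e, r, k) # l)" for e
  proof -
    have "g \<otimes> letter_value (b3, e) = g \<otimes> (if e then b else inv b) \<otimes> \<one>"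
      using gc by (simp add: letter_value_def)
    with g represents_one show ?thesis unfolding represents_config.simps by blast
  qed
  consider (a) e where "x = (a3, e)" | (t) e where "x = (t3, e)" | (T) "x = (b3, True)"
    | (F) "x = (b3, False)" by (cases x rule: letter_code.cases; cases "snd x") auto
  then show ?thesis
  proof cases
    case a
    then show ?thesis
      using step represents_config_mult_a[OF g, of 1] represents_config_mult_a[OF g, of "-1"]
      by (auto simp: letter_value_def int_pow_neg split: if_splits)
  next
    case t
    then show ?thesis
      using step represents_config_mult_t[OF g, of 1] represents_config_mult_t[OF g, of "-1"]
      by (auto simp: letter_value_def int_pow_neg split: if_splits)
  next
    case T
    show ?thesis
    proof (cases "l \<noteq> [] \<and> \<not> fst (hd l) \<and> k = 0 \<and> r \<in> \<int>")
      case True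
      then obtain r' k' m where l: "l = (False, r', k') # m" by (cases l) auto
      with g True obtain g1 g2 where g12: "g = g1 \<otimes> inv b \<otimes> g2" "represents_config g1 r' k' m"
        "represents g2 r 0" by auto
      have "g \<otimes> letter_value x = g1 \<otimes> (inv b \<otimes> a [^] \<lfloor>r\<rfloor> \<otimes> b)"
        using represents_0_right[OF g12(3)] True represents_config_carrier[OF g12(2)]
        by (simp add: g12(1) T letter_value_def m_assoc)
      with represents_config_mult_t[OF g12(2), of "\<lfloor>r\<rfloor>"] show ?thesis
        using step True by (auto simp: T l conj_b)
    next
      case False
      with step T have "r1 = 0 \<and> k1 = 0 \<and> l1 = (True, r, k) # l" by (cases l) (auto split: if_splits)
      with push[of True] T show ?thesis by (simp only:)
    qed
  next
    case F
    show ?thesis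
    proof (cases "l \<noteq> [] \<and> fst (hd l) \<and> r = 0")
      case True
      then obtain r' k' m where l: "l = (True, r', k') # m" by (cases l) auto
      with g True obtain g1 g2 where g12: "g = g1 \<otimes> b \<otimes> g2" "represents_config g1 r' k' m"
        "represents g2 0 k" by auto
      have "g \<otimes> letter_value x = g1 \<otimes> (b \<otimes> t [^] k \<otimes> inv b)"
        using represents_0_left[OF g12(3)] represents_config_carrier[OF g12(2)]
        by (simp add: g12(1) F letter_value_def m_assoc)
      with represents_config_mult_a[OF g12(2), of k] show ?thesis
        using step True by (auto simp: F l conj_b')
    next
      case False
      with step F have "r1 = 0 \<and> k1 = 0 \<and> l1 = (False, r, k) # l" by (cases l) (auto split: if_splits)
      with push[of False] F show ?thesis by (simp only:)
    qed
  qed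
qed

lemma represents_config_fold:
  assumes "represents_config g r k l" "fold britton_step w (r, k, l) = (r1, k1, l1)"
  shows "represents_config (g \<otimes> word_value G gen_value w) r1 k1 l1"
  using assms
proof (induction w arbitrary: g r k l)
  case Nil
  then show ?case using represents_config_carrier by auto
next
  case (Cons x w)
  obtain r2 k2 l2 where 2: "britton_step x (r, k, l) = (r2, k2, l2)" by (metis prod.exhaust)
  have v: "word_value G gen_value v \<in> carrier G" for v :: "gen_atb word"
  proof (induction v)
    case (Cons y v)
    have "gen_value (fst y) \<in> carrier G" by (cases "fst y") auto
    with Cons show ?case by (cases y) auto
  qed simp
  have "word_value G gen_value (x # w) = letter_value x \<otimes> word_value G gen_value w"
    by (cases x) (simp add: letter_value_def)
  with Cons.IH[OF represents_config_step[OF Cons.prems(1) 2]] Cons.prems show ?case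
    using represents_config_carrier[OF Cons.prems(1)] v by (simp add: 2 m_assoc)
qed

lemma britton_sound:
  assumes "fold britton_step w (0, 0, []) = (0, 0, [])"
  shows "word_value G gen_value w = \<one>"
proof -
  have "represents_config \<one> 0 0 []" by (simp add: represents_one)
  from represents_config_fold[OF this assms] have "represents (\<one> \<otimes> word_value G gen_value w) 0 0"
    by simp
  from represents_0_left[OF this] represents_carrier[OF this] show ?thesis
  proof -
    have "word_value G gen_value v \<in> carrier G" for v :: "gen_atb word"
    proof (induction v)
      case (Cons y v)
      have "gen_value (fst y) \<in> carrier G" by (cases "fst y") auto
      with Cons show ?case by (cases y) auto
    qed simp
    with \<open>\<one> \<otimes> word_value G gen_value w = t [^] 0\<close> show ?thesis by simp
  qed
qed

end

lemma baumslag_gersten_G12: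
  "baumslag_gersten G12 (letter_G12 a3) (letter_G12 t3) (letter_G12 b3)"
proof -
  interpret group G12 unfolding G12_def by (rule group_presented_group)
  have "pres_eq rel_ab (inv_word (atb_to_ab t3) @ atb_to_ab a3 @ atb_to_ab t3) (atb_to_ab a3 @ atb_to_ab a3)"
    using pres_eq.relation[of _ _ rel_ab "[]" "[]"] by (simp add: rel_ab_def)
  then show ?thesis
    by unfold_locales
      (simp_all only: letter_G12_eq,
       simp_all add: G12_def carrier_presented_group inv_pres_class pres_class_mult pres_class_eq_iff
         pres_eq.refl rangeI)
qed

theorem word_problem_iff_britton:
  "w \<in> word_problem_G12 \<longleftrightarrow> fold britton_step w (0, 0, []) = (0, 0, [])"
proof
  assume "w \<in> word_problem_G12"
  then show "fold britton_step w (0, 0, []) = (0, 0, [])"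
    by (intro britton_complete word_problem_pres_eq)
next
  interpret baumslag_gersten G12 "letter_G12 a3" "letter_G12 t3" "letter_G12 b3"
    by (rule baumslag_gersten_G12)
  have "gen_value = letter_G12"
  proof
    fix x show "gen_value x = letter_G12 x" by (cases x) (simp_all only: gen_value.simps)
  qed
  moreover assume "fold britton_step w (0, 0, []) = (0, 0, [])"
  ultimately show "w \<in> word_problem_G12"
    using britton_sound[of w] by (simp add: word_problem_G12_def)
qed

section \<open>A structured language for the machine\<close>

datatype aexp = Num nat | Var nat | Plus aexp aexp | Minus aexp aexp | Arr nat aexp | Inp aexp

text \<open>
  In \<open>Rep d e p\<close> the number \<open>d\<close> declares that the loop runs at most \<open>\<beta> ^ d\<close> times, for a bound \<open>\<beta>\<close>
  that is linear in the length of the input. The weakest precondition below enforces the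
  declaration, so that running times can be read off the program text.
\<close>

datatype com =
    Nop
  | Assign nat aexp (infix "::=" 61)
  | Write nat aexp aexp
  | Semi com com (infixr ";;" 60)
  | Cond aexp com com
  | Rep nat aexp com

type_synonym vars = "nat \<Rightarrow> nat"
type_synonym arrs = "nat \<Rightarrow> nat \<Rightarrow> nat"

text \<open>
  Variable \<open>v\<close> lives in register \<open>2v\<close>; register 1 keeps the input length \<open>n\<close> and the other odd
  registers hold temporaries. Cell \<open>i\<close> of array \<open>k < 16\<close> lives at address \<open>n + 16i + k\<close>, behind the
  input.
\<close>

definition tmp :: "nat \<Rightarrow> reg" where "tmp d = 2 * d + 1"

text \<open>The machine has no multiplication, so four doublings form \<open>16 * i\<close>.\<close>

definition comp_addr :: "nat \<Rightarrow> nat \<Rightarrow> prog" where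
  "comp_addr k d =
    Seq (Add (tmp d) (tmp d) (tmp d)) (Seq (Add (tmp d) (tmp d) (tmp d))
    (Seq (Add (tmp d) (tmp d) (tmp d)) (Seq (Add (tmp d) (tmp d) (tmp d))
    (Seq (Add (tmp d) (tmp d) 1) (Seq (Set (tmp (d + 1)) k) (Add (tmp d) (tmp d) (tmp (d + 1))))))))"

text \<open>The result is left in \<open>tmp d\<close>; a second operand is computed at depth
  \<open>d + 1\<close>, so the first one survives.\<close>

fun comp_exp :: "aexp \<Rightarrow> nat \<Rightarrow> prog" where
  "comp_exp (Num k) d = Set (tmp d) k"
| "comp_exp (Var v) d = Copy (tmp d) (2 * v)"
| "comp_exp (Plus a b) d = Seq (comp_exp a d) (Seq (comp_exp b (d + 1)) (Add (tmp d) (tmp d) (tmp (d + 1))))"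
| "comp_exp (Minus a b) d = Seq (comp_exp a d) (Seq (comp_exp b (d + 1)) (Sub (tmp d) (tmp d) (tmp (d + 1))))"
| "comp_exp (Arr k a) d = Seq (comp_exp a d) (Seq (comp_addr k d) (Load (tmp d) (tmp d)))"
| "comp_exp (Inp a) d = Seq (comp_exp a d) (Load (tmp d) (tmp d))"

text \<open>A loop evaluates its count once into \<open>tmp d\<close> and decrements it there; the
  body is compiled at depth \<open>d + 1\<close> and so leaves the counter alone.\<close>

fun comp_com :: "com \<Rightarrow> nat \<Rightarrow> prog" where
  "comp_com Nop d = Skip"
| "comp_com (v ::= e) d = Seq (comp_exp e d) (Copy (2 * v) (tmp d))"
| "comp_com (Write k a e) d =
    Seq (comp_exp a d) (Seq (comp_addr k d) (Seq (comp_exp e (d + 1)) (Store (tmp d) (tmp (d + 1)))))"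
| "comp_com (p ;; q) d = Seq (comp_com p d) (comp_com q d)"
| "comp_com (Cond e p q) d = Seq (comp_exp e d) (If (tmp d) (comp_com p d) (comp_com q d))"
| "comp_com (Rep l e p) d = Seq (comp_exp e d) (While (tmp d)
    (Seq (comp_com p (d + 1)) (Seq (Set (tmp (d + 1)) 1) (Sub (tmp d) (tmp d) (tmp (d + 1))))))"

fun exp_cost :: "aexp \<Rightarrow> nat" where
  "exp_cost (Num k) = 1"
| "exp_cost (Var v) = 1"
| "exp_cost (Plus a b) = exp_cost a + exp_cost b + 1"
| "exp_cost (Minus a b) = exp_cost a + exp_cost b + 1"
| "exp_cost (Arr k a) = exp_cost a + 8"
| "exp_cost (Inp a) = exp_cost a + 1"

text \<open>Both branches of a conditional are charged. A round costs 3 beyond the body: a test,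
  setting the constant 1 and the decrement; the extra 1 of a loop is its last test.\<close>

fun com_cost :: "nat \<Rightarrow> com \<Rightarrow> nat" where
  "com_cost \<beta> Nop = 1"
| "com_cost \<beta> (v ::= e) = exp_cost e + 1"
| "com_cost \<beta> (Write k a e) = exp_cost a + exp_cost e + 8"
| "com_cost \<beta> (p ;; q) = com_cost \<beta> p + com_cost \<beta> q"
| "com_cost \<beta> (Cond e p q) = exp_cost e + 1 + com_cost \<beta> p + com_cost \<beta> q"
| "com_cost \<beta> (Rep d e p) = exp_cost e + 1 + \<beta> ^ d * (com_cost \<beta> p + 3)"

fun loop_degree :: "com \<Rightarrow> nat" where
  "loop_degree (p ;; q) = max (loop_degree p) (loop_degree q)"
| "loop_degree (Cond e p q) = max (loop_degree p) (loop_degree q)"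
| "loop_degree (Rep d e p) = d + loop_degree p"
| "loop_degree _ = 0"

text \<open>The cost is a polynomial in \<open>\<beta>\<close> with nonnegative coefficients whose
  degree is at most the loop nesting; the sum of its coefficients is its value at 1.\<close>

lemma com_cost_le:
  assumes "\<beta> \<ge> 1"
  shows "com_cost \<beta> p \<le> com_cost 1 p * \<beta> ^ loop_degree p"
proof (induction p)
  case (Semi p q)
  have "com_cost 1 p * \<beta> ^ loop_degree p \<le> com_cost 1 p * \<beta> ^ loop_degree (p ;; q)"
    "com_cost 1 q * \<beta> ^ loop_degree q \<le> com_cost 1 q * \<beta> ^ loop_degree (p ;; q)"
    using assms by (auto intro!: mult_le_mono2 power_increasing)
  with Semi show ?case unfolding com_cost.simps add_mult_distrib by linarith
next
  case (Cond e p q)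
  have "com_cost 1 p * \<beta> ^ loop_degree p \<le> com_cost 1 p * \<beta> ^ loop_degree (Cond e p q)"
    "com_cost 1 q * \<beta> ^ loop_degree q \<le> com_cost 1 q * \<beta> ^ loop_degree (Cond e p q)"
    "(exp_cost e + 1) * 1 \<le> (exp_cost e + 1) * \<beta> ^ loop_degree (Cond e p q)"
    using assms by (intro mult_le_mono2 power_increasing one_le_power; simp)+
  with Cond show ?case unfolding com_cost.simps add_mult_distrib by linarith
next
  case (Rep d e p)
  have sum3: "a \<le> a' \<Longrightarrow> b \<le> b' \<Longrightarrow> c \<le> c' \<Longrightarrow> a + (b + c) \<le> a' + b' + c'" for a b c a' b' c' :: nat
    by simp
  have "(exp_cost e + 1) * 1 \<le> (exp_cost e + 1) * \<beta> ^ (d + loop_degree p)"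
    using assms by (intro mult_le_mono2) simp
  moreover have "\<beta> ^ d * com_cost \<beta> p \<le> \<beta> ^ d * (com_cost 1 p * \<beta> ^ loop_degree p)"
    using Rep by (rule mult_le_mono2)
  moreover have "\<beta> ^ d * 3 \<le> \<beta> ^ d * (3 * \<beta> ^ loop_degree p)"
    using assms by (intro mult_le_mono2) simp
  ultimately have "com_cost \<beta> (Rep d e p) \<le> (exp_cost e + 1) * \<beta> ^ (d + loop_degree p) +
      \<beta> ^ d * (com_cost 1 p * \<beta> ^ loop_degree p) + \<beta> ^ d * (3 * \<beta> ^ loop_degree p)"
    unfolding com_cost.simps add_mult_distrib2 mult_1_right by (rule sum3)
  moreover have "com_cost 1 (Rep d e p) * \<beta> ^ loop_degree (Rep d e p) = (exp_cost e + 1) * \<beta> ^ (d + loop_degree p) +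
      \<beta> ^ d * (com_cost 1 p * \<beta> ^ loop_degree p) + \<beta> ^ d * (3 * \<beta> ^ loop_degree p)"
    by (simp add: algebra_simps power_add)
  ultimately show ?case by (simp only:)
qed auto

fun mod_vars :: "com \<Rightarrow> nat set" where
  "mod_vars (v ::= e) = {v}"
| "mod_vars (p ;; q) = mod_vars p \<union> mod_vars q"
| "mod_vars (Cond e p q) = mod_vars p \<union> mod_vars q"
| "mod_vars (Rep d e p) = mod_vars p"
| "mod_vars _ = {}"

fun mod_arrs :: "com \<Rightarrow> nat set" where
  "mod_arrs (Write k a e) = {k}"
| "mod_arrs (p ;; q) = mod_arrs p \<union> mod_arrs q"
| "mod_arrs (Cond e p q) = mod_arrs p \<union> mod_arrs q"
| "mod_arrs (Rep d e p) = mod_arrs p"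
| "mod_arrs _ = {}"

section \<open>Weakest preconditions\<close>

locale machine =
  fixes n V \<beta> :: nat and inp :: "nat \<Rightarrow> nat"
  assumes V: "n \<le> V" "1 \<le> V" "inp i \<le> V"
begin

fun aval :: "aexp \<Rightarrow> vars \<Rightarrow> arrs \<Rightarrow> nat" where
  "aval (Num k) vs as = k"
| "aval (Var v) vs as = vs v"
| "aval (Plus a b) vs as = aval a vs as + aval b vs as"
| "aval (Minus a b) vs as = aval a vs as - aval b vs as"
| "aval (Arr k a) vs as = as k (aval a vs as)"
| "aval (Inp a) vs as = inp (aval a vs as)"

fun safe :: "aexp \<Rightarrow> vars \<Rightarrow> arrs \<Rightarrow> bool" where
  "safe (Num k) vs as \<longleftrightarrow> k \<le> V"
| "safe (Var v) vs as \<longleftrightarrow> True"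
| "safe (Plus a b) vs as \<longleftrightarrow> safe a vs as \<and> safe b vs as \<and> aval a vs as + aval b vs as \<le> V"
| "safe (Minus a b) vs as \<longleftrightarrow> safe a vs as \<and> safe b vs as"
| "safe (Arr k a) vs as \<longleftrightarrow> k < 16 \<and> safe a vs as"
| "safe (Inp a) vs as \<longleftrightarrow> safe a vs as \<and> aval a vs as < n"

text \<open>The number of rounds of a loop is fixed on entry, so its precondition is a finite
  iterate of that of the body. Termination and absence of overflow are built in.\<close>

primrec wp :: "com \<Rightarrow> (vars \<Rightarrow> arrs \<Rightarrow> bool) \<Rightarrow> vars \<Rightarrow> arrs \<Rightarrow> bool" where
  "wp Nop = (\<lambda>Q. Q)"
| "wp (v ::= e) = (\<lambda>Q vs as. safe e vs as \<and> Q (vs(v := aval e vs as)) as)"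
| "wp (Write k a e) = (\<lambda>Q vs as. k < 16 \<and> safe a vs as \<and> safe e vs as \<and>
    Q vs (as(k := (as k)(aval a vs as := aval e vs as))))"
| "wp (p ;; q) = (\<lambda>Q. wp p (wp q Q))"
| "wp (Cond e p q) = (\<lambda>Q vs as. safe e vs as \<and> (if aval e vs as \<noteq> 0 then wp p Q vs as else wp q Q vs as))"
| "wp (Rep d e p) = (\<lambda>Q vs as. safe e vs as \<and> aval e vs as \<le> \<beta> ^ d \<and> (wp p ^^ aval e vs as) Q vs as)"

lemma wp_mono: "wp p P vs as \<Longrightarrow> (\<And>vs as. P vs as \<Longrightarrow> Q vs as) \<Longrightarrow> wp p Q vs as"
proof (induction p arbitrary: P Q vs as)
  case (Semi p q)
  from Semi.prems(1) have "wp p (wp q P) vs as" by simp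
  then have "wp p (wp q Q) vs as" by (rule Semi.IH(1)) (erule Semi.IH(2), erule Semi.prems(2))
  then show ?case by simp
next
  case (Cond e p q)
  then show ?case by (auto split: if_splits)
next
  case (Rep d e p)
  have "(wp p ^^ c) P vs as \<Longrightarrow> (wp p ^^ c) Q vs as" for c vs as
  proof (induction c arbitrary: vs as)
    case 0
    then show ?case using Rep.prems(2) by simp
  next
    case (Suc c)
    from Suc.prems have "wp p ((wp p ^^ c) P) vs as" by simp
    then have "wp p ((wp p ^^ c) Q) vs as" by (rule Rep.IH) (erule Suc.IH)
    then show ?case by simp
  qed
  with Rep.prems(1) show ?case by simp
qed auto

definition unchanged :: "com \<Rightarrow> vars \<Rightarrow> arrs \<Rightarrow> vars \<Rightarrow> arrs \<Rightarrow> bool" where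
  "unchanged p vs as vs' as' \<longleftrightarrow>
    (\<forall>v. v \<notin> mod_vars p \<longrightarrow> vs' v = vs v) \<and> (\<forall>k. k \<notin> mod_arrs p \<longrightarrow> as' k = as k)"

text \<open>The frame rule that lets specifications mention only what changes;
  \<open>wp_conseq\<close> combines it with weakening.\<close>

lemma wp_unchanged:
  "wp p Q vs as \<Longrightarrow> wp p (\<lambda>vs' as'. Q vs' as' \<and> unchanged p vs as vs' as') vs as"
proof (induction p arbitrary: Q vs as)
  case (Semi p q)
  from Semi.prems have "wp p (wp q Q) vs as" by simp
  then have "wp p (\<lambda>vs' as'. wp q Q vs' as' \<and> unchanged p vs as vs' as') vs as"
    by (rule Semi.IH(1))
  then have "wp p (wp q (\<lambda>vs' as'. Q vs' as' \<and> unchanged (p ;; q) vs as vs' as')) vs as"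
  proof (rule wp_mono)
    fix vs1 as1 assume 1: "wp q Q vs1 as1 \<and> unchanged p vs as vs1 as1"
    then have "wp q (\<lambda>vs' as'. Q vs' as' \<and> unchanged q vs1 as1 vs' as') vs1 as1"
      by (intro Semi.IH(2)) simp
    then show "wp q (\<lambda>vs' as'. Q vs' as' \<and> unchanged (p ;; q) vs as vs' as') vs1 as1"
      by (rule wp_mono) (use 1 in \<open>auto simp: unchanged_def\<close>)
  qed
  then show ?case by simp
next
  case (Cond e p q)
  then have "safe e vs as" by simp
  show ?case
  proof (cases "aval e vs as \<noteq> 0")
    case True
    with Cond.prems have "wp p Q vs as" by simp
    from Cond.IH(1)[OF this] have "wp p (\<lambda>vs' as'. Q vs' as' \<and> unchanged (Cond e p q) vs as vs' as') vs as"
      by (rule wp_mono) (auto simp: unchanged_def)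
    with True \<open>safe e vs as\<close> show ?thesis by simp
  next
    case False
    with Cond.prems have "wp q Q vs as" by simp
    from Cond.IH(2)[OF this] have "wp q (\<lambda>vs' as'. Q vs' as' \<and> unchanged (Cond e p q) vs as vs' as') vs as"
      by (rule wp_mono) (auto simp: unchanged_def)
    with False \<open>safe e vs as\<close> show ?thesis by simp
  qed
next
  case (Rep d e p)
  have "(wp p ^^ c) Q vs as \<Longrightarrow> (wp p ^^ c) (\<lambda>vs' as'. Q vs' as' \<and> unchanged p vs as vs' as') vs as"
    for c vs as
  proof (induction c arbitrary: vs as)
    case 0
    then show ?case by (simp add: unchanged_def)
  next
    case (Suc c)
    from Suc.prems have "wp p ((wp p ^^ c) Q) vs as" by simp
    from Rep.IH[OF this]
    have "wp p ((wp p ^^ c) (\<lambda>vs' as'. Q vs' as' \<and> unchanged p vs as vs' as')) vs as"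
    proof (rule wp_mono)
      fix vs1 as1 assume 1: "(wp p ^^ c) Q vs1 as1 \<and> unchanged p vs as vs1 as1"
      have mono: "(wp p ^^ c) P vs as \<Longrightarrow> (\<And>vs as. P vs as \<Longrightarrow> Q vs as) \<Longrightarrow> (wp p ^^ c) Q vs as"
        for P Q vs as
        by (induction c arbitrary: vs as) (auto elim: wp_mono)
      from 1 Suc.IH have "(wp p ^^ c) (\<lambda>vs' as'. Q vs' as' \<and> unchanged p vs1 as1 vs' as') vs1 as1"
        by blast
      then show "(wp p ^^ c) (\<lambda>vs' as'. Q vs' as' \<and> unchanged p vs as vs' as') vs1 as1"
        by (rule mono) (use 1 in \<open>auto simp: unchanged_def\<close>)
    qed
    then show ?case by simp
  qed
  with Rep.prems show ?case by (simp add: unchanged_def)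
qed (auto simp: unchanged_def)

lemma wp_conseq:
  assumes "wp p P vs as"
    and "\<And>vs' as'. P vs' as' \<Longrightarrow> unchanged p vs as vs' as' \<Longrightarrow> Q vs' as'"
  shows "wp p Q vs as"
  using wp_unchanged[OF assms(1)] by (rule wp_mono) (use assms(2) in blast)

lemma wp_Rep:
  assumes "safe e vs as" "aval e vs as \<le> \<beta> ^ d" and "I 0 vs as"
    and step: "\<And>i vs' as'. i < aval e vs as \<Longrightarrow> I i vs' as' \<Longrightarrow> wp p (I (Suc i)) vs' as'"
    and "\<And>vs' as'. I (aval e vs as) vs' as' \<Longrightarrow> Q vs' as'"
  shows "wp (Rep d e p) Q vs as"
proof -
  \<comment> \<open>Induction on the number \<open>c\<close> of rounds still to run.\<close>
  have "c \<le> aval e vs as \<Longrightarrow> I (aval e vs as - c) vs' as' \<Longrightarrow> (wp p ^^ c) Q vs' as'" for c vs' as'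
  proof (induction c arbitrary: vs' as')
    case 0
    then show ?case using assms(5) by simp
  next
    case (Suc c)
    then have "wp p (I (Suc (aval e vs as - Suc c))) vs' as'" by (intro step) auto
    moreover have "Suc (aval e vs as - Suc c) = aval e vs as - c" using Suc.prems by simp
    ultimately have "wp p ((wp p ^^ c) Q) vs' as'" using Suc by (auto elim: wp_mono)
    then show ?case by simp
  qed
  with assms show ?thesis by simp
qed

end

definition For :: "nat \<Rightarrow> nat \<Rightarrow> aexp \<Rightarrow> com \<Rightarrow> com" where
  "For d v e p = v ::= Num 0 ;; Rep d e (p ;; v ::= Plus (Var v) (Num 1))"

lemma For_simps [simp]:
  "loop_degree (For d v e p) = d + loop_degree p"
  "mod_vars (For d v e p) = insert v (mod_vars p)"
  "mod_arrs (For d v e p) = mod_arrs p"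
  by (auto simp: For_def)

context machine
begin

text \<open>The bound is evaluated after the loop variable has been reset, hence the \<open>x\<close> in the premises.\<close>

lemma wp_For:
  assumes "\<And>x. safe e (vs(v := x)) as" "\<And>x. aval e (vs(v := x)) as = c"
    and "c \<le> \<beta> ^ d" "c \<le> V" and "I 0 (vs(v := 0)) as"
    and step: "\<And>i vs' as'. i < c \<Longrightarrow> vs' v = i \<Longrightarrow> I i vs' as' \<Longrightarrow>
      wp p (\<lambda>vs'' as''. vs'' v = i \<and> I (Suc i) (vs''(v := Suc i)) as'') vs' as'"
    and "\<And>vs' as'. vs' v = c \<Longrightarrow> I c vs' as' \<Longrightarrow> Q vs' as'"
  shows "wp (For d v e p) Q vs as"
proof -
  have "wp (Rep d e (p ;; v ::= Plus (Var v) (Num 1))) Q (vs(v := 0)) as"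
  proof (rule wp_Rep[where I = "\<lambda>i vs as. vs v = i \<and> I i vs as"])
    fix i vs' as' assume "i < aval e (vs(v := 0)) as" and i: "vs' v = i \<and> I i vs' as'"
    then have "i < c" using assms(2) by simp
    with i have "wp p (\<lambda>vs'' as''. vs'' v = i \<and> I (Suc i) (vs''(v := Suc i)) as'') vs' as'"
      by (intro step) auto
    then show "wp (p ;; v ::= Plus (Var v) (Num 1)) (\<lambda>vs as. vs v = Suc i \<and> I (Suc i) vs as) vs' as'"
      unfolding wp.simps
      by (rule wp_mono) (use \<open>i < c\<close> assms(4) V in \<open>auto simp: Suc_le_eq\<close>)
  qed (use assms in auto)
  then show ?thesis by (simp add: For_def)
qed

section \<open>Correctness and cost of compiled programs\<close>

definition encodes :: "ram_state \<Rightarrow> vars \<Rightarrow> arrs \<Rightarrow> bool" where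
  "encodes s vs as \<longleftrightarrow> reg_of s 1 = n \<and> (\<forall>v. reg_of s (2 * v) = vs v) \<and> (\<forall>v. vs v \<le> V) \<and>
    (\<forall>k<16. \<forall>i. mem_of s (n + 16 * i + k) = as k i \<and> as k i \<le> V) \<and> (\<forall>i<n. mem_of s i = inp i)"

text \<open>Variables and array cells hold at most \<open>V\<close>, but an address
  \<open>n + 16 * i + k\<close> with \<open>k < 16\<close> can reach
  \<open>17 * V + 15\<close>.\<close>

definition W :: nat where "W = 17 * V + 16"

definition below :: "nat \<Rightarrow> ram_state \<Rightarrow> ram_state \<Rightarrow> bool" where
  "below d s s' \<longleftrightarrow> (\<forall>j < tmp d. odd j \<longrightarrow> reg_of s' j = reg_of s j)"

text \<open>Expressions leave the memory and all variables alone; commands guarantee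
  \<open>below\<close>, which protects the saved input length and the counters of enclosing
  loops.\<close>

definition same_below :: "nat \<Rightarrow> ram_state \<Rightarrow> ram_state \<Rightarrow> bool" where
  "same_below d s s' \<longleftrightarrow> mem_of s' = mem_of s \<and>
    (\<forall>j. even j \<or> j < tmp d \<longrightarrow> reg_of s' j = reg_of s j)"

lemma same_below_encodes:
  "same_below d s s' \<Longrightarrow> encodes s vs as \<Longrightarrow> 1 \<le> d \<Longrightarrow> encodes s' vs as"
  by (auto simp: same_below_def encodes_def tmp_def)

lemma same_below_trans:
  "same_below d s s' \<Longrightarrow> same_below d' s' s'' \<Longrightarrow> d \<le> d' \<Longrightarrow> same_below d s s''"
  by (auto simp: same_below_def tmp_def)

lemma same_below_tmp: "same_below (Suc d) s s' \<Longrightarrow> reg_of s' (tmp d) = reg_of s (tmp d)"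
  by (auto simp: same_below_def tmp_def)

lemma exec_comp_addr:
  assumes "encodes s vs as" "reg_of s (tmp d) = i" "i \<le> V" "k < 16" "1 \<le> d"
  shows "\<exists>s'. exec W (comp_addr k d) s 7 s' \<and> reg_of s' (tmp d) = n + 16 * i + k \<and> same_below d s s'"
proof -
  obtain r m where s: "s = State r m" by (cases s)
  let ?r = "\<lambda>x. r(tmp d := x)"
  have n: "r 1 = n" and i: "r (tmp d) = i" "tmp d \<noteq> 1" "tmp d \<noteq> tmp (Suc d)" "tmp d \<noteq> Suc 0"
    using assms by (auto simp: s encodes_def tmp_def)
  note b = V(1) assms(3,4) W_def
  have add: "x + x \<le> W \<Longrightarrow> exec W (Add (tmp d) (tmp d) (tmp d)) (State (?r x) m) 1 (State (?r (x + x)) m)" for x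
    using exec.Add[of "?r x" "tmp d" "tmp d" W "tmp d" m] by simp
  have 0: "State r m = State (?r i) m" using i by auto
  have 5: "exec W (Add (tmp d) (tmp d) 1) (State (?r (16 * i)) m) 1 (State (?r (16 * i + n)) m)"
    using exec.Add[of "?r (16 * i)" "tmp d" 1 W "tmp d" m] n i b by simp
  have 6: "exec W (Set (tmp (d + 1)) k) (State (?r (16 * i + n)) m) 1
      (State ((?r (16 * i + n))(tmp (d + 1) := k)) m)"
    using b by (intro exec.Set) simp
  have 7: "exec W (Add (tmp d) (tmp d) (tmp (d + 1))) (State ((?r (16 * i + n))(tmp (d + 1) := k)) m) 1
      (State (((?r (16 * i + n))(tmp (d + 1) := k))(tmp d := n + 16 * i + k)) m)"
    using exec.Add[of "(?r (16 * i + n))(tmp (d + 1) := k)" "tmp d" "tmp (d + 1)" W "tmp d" m] i b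
    by (simp add: add.commute)
  have "exec W (comp_addr k d) s (1 + (1 + (1 + (1 + (1 + (1 + 1))))))
      (State (((?r (16 * i + n))(tmp (d + 1) := k))(tmp d := n + 16 * i + k)) m)"
    unfolding comp_addr_def s 0
  proof (intro exec.Seq)
    show "exec W (Add (tmp d) (tmp d) (tmp d)) (State (?r i) m) 1 (State (?r (2 * i)) m)"
      using add[of i] b by (simp add: mult_2)
    show "exec W (Add (tmp d) (tmp d) (tmp d)) (State (?r (2 * i)) m) 1 (State (?r (4 * i)) m)"
      using add[of "2 * i"] b by simp
    show "exec W (Add (tmp d) (tmp d) (tmp d)) (State (?r (4 * i)) m) 1 (State (?r (8 * i)) m)"
      using add[of "4 * i"] b by simp
    show "exec W (Add (tmp d) (tmp d) (tmp d)) (State (?r (8 * i)) m) 1 (State (?r (16 * i)) m)"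
      using add[of "8 * i"] b by simp
  qed (fact 5 6 7)+
  moreover have "1 + (1 + (1 + (1 + (1 + (1 + 1))))) = (7 :: nat)" by simp
  ultimately have "exec W (comp_addr k d) s 7
      (State (((?r (16 * i + n))(tmp (d + 1) := k))(tmp d := n + 16 * i + k)) m)" by (simp only:)
  then show ?thesis
    by (intro exI[of _ "State (((?r (16 * i + n))(tmp (d + 1) := k))(tmp d := n + 16 * i + k)) m"])
      (auto simp: s same_below_def tmp_def)
qed

lemma aval_le_V:
  assumes "encodes s vs as" "safe e vs as"
  shows "aval e vs as \<le> V"
  using assms V by (induction e) (auto simp: encodes_def)

lemma exec_comp_exp:
  assumes "encodes s vs as" "safe e vs as" "1 \<le> d"
  shows "\<exists>s'. exec W (comp_exp e d) s (exp_cost e) s' \<and> reg_of s' (tmp d) = aval e vs as \<and> same_below d s s'"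
  using assms
proof (induction e arbitrary: s d)
  case (Num k)
  obtain r m where s: "s = State r m" by (cases s)
  from Num have "exec W (Set (tmp d) k) s 1 (State (r(tmp d := k)) m)"
    unfolding s by (intro exec.Set) (simp add: W_def)
  then show ?case
    by (intro exI[of _ "State (r(tmp d := k)) m"]) (auto simp: s same_below_def tmp_def)
next
  case (Var v)
  obtain r m where s: "s = State r m" by (cases s)
  from Var have r: "r (2 * v) = vs v" "vs v \<le> V" by (auto simp: s encodes_def)
  have "exec W (Copy (tmp d) (2 * v)) s 1 (State (r(tmp d := r (2 * v))) m)"
    unfolding s by (rule exec.Copy) (use r in \<open>simp add: W_def\<close>)
  then show ?case using r
    by (intro exI[of _ "State (r(tmp d := r (2 * v))) m"]) (auto simp: s same_below_def tmp_def)
next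
  case (Plus a b)
  obtain s1 where 1: "exec W (comp_exp a d) s (exp_cost a) s1" "reg_of s1 (tmp d) = aval a vs as"
    "same_below d s s1" using Plus.IH(1)[of s d] Plus.prems by auto
  then have "encodes s1 vs as" using Plus.prems same_below_encodes by blast
  then obtain s2 where 2: "exec W (comp_exp b (d + 1)) s1 (exp_cost b) s2"
    "reg_of s2 (tmp (d + 1)) = aval b vs as" "same_below (d + 1) s1 s2"
    using Plus.IH(2)[of s1 "d + 1"] Plus.prems by auto
  obtain r m where s2: "s2 = State r m" by (cases s2)
  have r: "r (tmp d) = aval a vs as" "r (tmp (d + 1)) = aval b vs as"
    using 1 2 same_below_tmp[of d s1 s2] by (auto simp: s2)
  have "exec W (Add (tmp d) (tmp d) (tmp (d + 1))) s2 1 (State (r(tmp d := r (tmp d) + r (tmp (d + 1)))) m)"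
    unfolding s2 by (rule exec.Add) (use r Plus.prems in \<open>simp add: W_def\<close>)
  with 1 2 have "exec W (comp_exp (Plus a b) d) s (exp_cost a + (exp_cost b + 1))
      (State (r(tmp d := r (tmp d) + r (tmp (d + 1)))) m)"
    unfolding comp_exp.simps by (intro exec.Seq)
  then show ?case using r same_below_trans[OF 1(3) 2(3)]
    by (intro exI[of _ "State (r(tmp d := r (tmp d) + r (tmp (d + 1)))) m"])
      (auto simp: s2 same_below_def tmp_def)
next
  case (Minus a b)
  obtain s1 where 1: "exec W (comp_exp a d) s (exp_cost a) s1" "reg_of s1 (tmp d) = aval a vs as"
    "same_below d s s1" using Minus.IH(1)[of s d] Minus.prems by auto
  then have "encodes s1 vs as" using Minus.prems same_below_encodes by blast
  then obtain s2 where 2: "exec W (comp_exp b (d + 1)) s1 (exp_cost b) s2"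
    "reg_of s2 (tmp (d + 1)) = aval b vs as" "same_below (d + 1) s1 s2"
    using Minus.IH(2)[of s1 "d + 1"] Minus.prems by auto
  obtain r m where s2: "s2 = State r m" by (cases s2)
  have r: "r (tmp d) = aval a vs as" "r (tmp (d + 1)) = aval b vs as"
    using 1 2 same_below_tmp[of d s1 s2] by (auto simp: s2)
  have "aval a vs as \<le> V" using Minus.prems aval_le_V by simp
  then have "exec W (Sub (tmp d) (tmp d) (tmp (d + 1))) s2 1 (State (r(tmp d := r (tmp d) - r (tmp (d + 1)))) m)"
    unfolding s2 by (intro exec.Sub) (use r in \<open>simp add: W_def\<close>)
  with 1 2 have "exec W (comp_exp (Minus a b) d) s (exp_cost a + (exp_cost b + 1))
      (State (r(tmp d := r (tmp d) - r (tmp (d + 1)))) m)"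
    unfolding comp_exp.simps by (intro exec.Seq)
  then show ?case using r same_below_trans[OF 1(3) 2(3)]
    by (intro exI[of _ "State (r(tmp d := r (tmp d) - r (tmp (d + 1)))) m"])
      (auto simp: s2 same_below_def tmp_def)
next
  case (Arr k a)
  obtain s1 where 1: "exec W (comp_exp a d) s (exp_cost a) s1" "reg_of s1 (tmp d) = aval a vs as"
    "same_below d s s1" using Arr.IH[of s d] Arr.prems by auto
  then have e1: "encodes s1 vs as" using Arr.prems same_below_encodes by blast
  have i: "aval a vs as \<le> V" using Arr.prems aval_le_V by simp
  obtain s2 where 2: "exec W (comp_addr k d) s1 7 s2" "reg_of s2 (tmp d) = n + 16 * aval a vs as + k"
    "same_below d s1 s2" using exec_comp_addr[OF e1 1(2) i, of k] Arr.prems by auto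
  then have "encodes s2 vs as" using Arr.prems e1 same_below_encodes by blast
  moreover obtain r m where s2: "s2 = State r m" by (cases s2)
  ultimately have m: "m (r (tmp d)) = as k (aval a vs as)" "as k (aval a vs as) \<le> V"
    using 2(2) Arr.prems by (auto simp: encodes_def)
  then have "exec W (Load (tmp d) (tmp d)) s2 1 (State (r(tmp d := m (r (tmp d)))) m)"
    unfolding s2 by (intro exec.Load) (simp add: W_def)
  with 1 2 have "exec W (comp_exp (Arr k a) d) s (exp_cost a + (7 + 1)) (State (r(tmp d := m (r (tmp d)))) m)"
    unfolding comp_exp.simps by (intro exec.Seq)
  then show ?case using m same_below_trans[OF 1(3) 2(3)]
    by (intro exI[of _ "State (r(tmp d := m (r (tmp d)))) m"]) (auto simp: s2 same_below_def tmp_def)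
next
  case (Inp a)
  obtain s1 where 1: "exec W (comp_exp a d) s (exp_cost a) s1" "reg_of s1 (tmp d) = aval a vs as"
    "same_below d s s1" using Inp.IH[of s d] Inp.prems by auto
  then have "encodes s1 vs as" using Inp.prems same_below_encodes by blast
  moreover obtain r m where s1: "s1 = State r m" by (cases s1)
  ultimately have m: "m (r (tmp d)) = inp (aval a vs as)"
    using 1(2) Inp.prems by (auto simp: encodes_def)
  then have "exec W (Load (tmp d) (tmp d)) s1 1 (State (r(tmp d := m (r (tmp d)))) m)"
    unfolding s1 using V(3)[of "aval a vs as"] by (intro exec.Load) (simp add: W_def)
  with 1 have "exec W (comp_exp (Inp a) d) s (exp_cost a + 1) (State (r(tmp d := m (r (tmp d)))) m)"
    unfolding comp_exp.simps by (intro exec.Seq)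
  then show ?case using m 1(3)
    by (intro exI[of _ "State (r(tmp d := m (r (tmp d)))) m"]) (auto simp: s1 same_below_def tmp_def)
qed

lemma below_trans: "below d s s' \<Longrightarrow> below d' s' s'' \<Longrightarrow> d \<le> d' \<Longrightarrow> below d s s''"
  by (auto simp: below_def tmp_def)

lemma same_below_below: "same_below d s s' \<Longrightarrow> below d s s'"
  by (auto simp: same_below_def below_def)

lemma exec_comp_com:
  assumes "wp p Q vs as" "encodes s vs as" "1 \<le> d"
  shows "\<exists>c s' vs' as'. exec W (comp_com p d) s c s' \<and> c \<le> com_cost \<beta> p \<and> Q vs' as' \<and>
    encodes s' vs' as' \<and> below d s s'"
  using assms
proof (induction p arbitrary: s Q vs as d)
  case Nop
  then show ?case using exec.Skip[of W s] by (auto simp: below_def)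
next
  case (Assign v e)
  then obtain s1 where 1: "exec W (comp_exp e d) s (exp_cost e) s1" "reg_of s1 (tmp d) = aval e vs as"
    "same_below d s s1" using exec_comp_exp[of s vs as e d] by auto
  then have e1: "encodes s1 vs as" using Assign.prems same_below_encodes by blast
  obtain r m where s1: "s1 = State r m" by (cases s1)
  have le: "aval e vs as \<le> V" using Assign.prems aval_le_V by simp
  have "exec W (Copy (2 * v) (tmp d)) s1 1 (State (r(2 * v := r (tmp d))) m)"
    unfolding s1 by (rule exec.Copy) (use 1 le in \<open>simp add: s1 W_def\<close>)
  with 1 have "exec W (comp_com (v ::= e) d) s (exp_cost e + 1) (State (r(2 * v := r (tmp d))) m)"
    unfolding comp_com.simps by (intro exec.Seq)
  moreover have "encodes (State (r(2 * v := r (tmp d))) m) (vs(v := aval e vs as)) as"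
    using e1 1(2) le by (auto simp: s1 encodes_def)
  moreover have "below d s (State (r(2 * v := r (tmp d))) m)"
    using same_below_below[OF 1(3)] by (auto simp: below_def s1)
  ultimately show ?case using Assign.prems(1) unfolding wp.simps com_cost.simps by blast
next
  case (Write k a e)
  from Write.prems have safe: "k < 16" "safe a vs as" "safe e vs as" by auto
  obtain s1 where 1: "exec W (comp_exp a d) s (exp_cost a) s1" "reg_of s1 (tmp d) = aval a vs as"
    "same_below d s s1" using Write.prems safe exec_comp_exp[of s vs as a d] by auto
  then have e1: "encodes s1 vs as" using Write.prems same_below_encodes by blast
  have le: "aval a vs as \<le> V" "aval e vs as \<le> V" using Write.prems safe aval_le_V by auto
  obtain s2 where 2: "exec W (comp_addr k d) s1 7 s2" "reg_of s2 (tmp d) = n + 16 * aval a vs as + k"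
    "same_below d s1 s2" using exec_comp_addr[OF e1 1(2) le(1) safe(1)] Write.prems by auto
  then have e2: "encodes s2 vs as" using Write.prems e1 same_below_encodes by blast
  then obtain s3 where 3: "exec W (comp_exp e (d + 1)) s2 (exp_cost e) s3"
    "reg_of s3 (tmp (d + 1)) = aval e vs as" "same_below (d + 1) s2 s3"
    using safe exec_comp_exp[of s2 vs as e "d + 1"] by auto
  then have e3: "encodes s3 vs as" using e2 same_below_encodes by fastforce
  obtain r m where s3: "s3 = State r m" by (cases s3)
  have r: "r (tmp d) = n + 16 * aval a vs as + k" "r (tmp (d + 1)) = aval e vs as"
    using 2 3 same_below_tmp[of d s2 s3] by (auto simp: s3)
  let ?s = "State r (m(r (tmp d) := r (tmp (d + 1))))"
  have "exec W (Store (tmp d) (tmp (d + 1))) s3 1 ?s"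
    unfolding s3 by (rule exec.Store) (use r le in \<open>simp add: W_def\<close>)
  with 1 2 3 have "exec W (comp_com (Write k a e) d) s (exp_cost a + (7 + (exp_cost e + 1))) ?s"
    unfolding comp_com.simps by (intro exec.Seq)
  moreover have "encodes ?s vs (as(k := (as k)(aval a vs as := aval e vs as)))"
  proof -
    \<comment> \<open>Arrays interleave without overlap: array number and index are remainder and
      quotient modulo 16.\<close>
    have "n + 16 * i + k' = n + 16 * j + k \<longleftrightarrow> i = j \<and> k' = k" if "k' < 16" for i j k'
      using that safe(1) by presburger
    then show ?thesis using e3 r le safe(1) by (auto simp: s3 encodes_def)
  qed
  moreover have "below d s ?s"
    using same_below_below[OF same_below_trans[OF same_below_trans[OF 1(3) 2(3)] 3(3)]]
    by (auto simp: below_def s3)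
  ultimately show ?case using Write.prems(1) unfolding wp.simps com_cost.simps
    by (intro exI[of _ "exp_cost a + (7 + (exp_cost e + 1))"] exI[of _ ?s]) auto
next
  case (Semi p q)
  from Semi.prems have "wp p (wp q Q) vs as" by simp
  from Semi.IH(1)[OF this Semi.prems(2,3)] obtain c1 s1 vs1 as1 where 1:
    "exec W (comp_com p d) s c1 s1" "c1 \<le> com_cost \<beta> p" "wp q Q vs1 as1" "encodes s1 vs1 as1" "below d s s1"
    by blast
  from Semi.IH(2)[OF 1(3,4) Semi.prems(3)] obtain c2 s2 vs2 as2 where 2:
    "exec W (comp_com q d) s1 c2 s2" "c2 \<le> com_cost \<beta> q" "Q vs2 as2" "encodes s2 vs2 as2" "below d s1 s2"
    by blast
  have "exec W (comp_com (p ;; q) d) s (c1 + c2) s2" using 1 2 by (auto intro: exec.Seq)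
  moreover have "c1 + c2 \<le> com_cost \<beta> (p ;; q)" using 1 2 by simp
  ultimately show ?case using 2 below_trans[OF 1(5) 2(5)] by blast
next
  case (Cond e p q)
  then obtain s1 where 1: "exec W (comp_exp e d) s (exp_cost e) s1" "reg_of s1 (tmp d) = aval e vs as"
    "same_below d s s1" using exec_comp_exp[of s vs as e d] by auto
  then have e1: "encodes s1 vs as" using Cond.prems same_below_encodes by blast
  show ?case
  proof (cases "aval e vs as \<noteq> 0")
    case True
    with Cond.prems have "wp p Q vs as" by simp
    from Cond.IH(1)[OF this e1 Cond.prems(3)] obtain c2 s2 vs2 as2 where 2:
      "exec W (comp_com p d) s1 c2 s2" "c2 \<le> com_cost \<beta> p" "Q vs2 as2" "encodes s2 vs2 as2" "below d s1 s2"
      by blast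
    have "exec W (comp_com (Cond e p q) d) s (exp_cost e + (1 + c2)) s2"
      unfolding comp_com.simps by (intro exec.Seq exec.IfTrue) (use 1 2 True in auto)
    moreover have "exp_cost e + (1 + c2) \<le> com_cost \<beta> (Cond e p q)" using 2(2) by simp
    ultimately show ?thesis using 2 below_trans[OF same_below_below[OF 1(3)] 2(5)] by blast
  next
    case False
    with Cond.prems have "wp q Q vs as" by simp
    from Cond.IH(2)[OF this e1 Cond.prems(3)] obtain c2 s2 vs2 as2 where 2:
      "exec W (comp_com q d) s1 c2 s2" "c2 \<le> com_cost \<beta> q" "Q vs2 as2" "encodes s2 vs2 as2" "below d s1 s2"
      by blast
    have "exec W (comp_com (Cond e p q) d) s (exp_cost e + (1 + c2)) s2"
      unfolding comp_com.simps by (intro exec.Seq exec.IfFalse) (use 1 2 False in auto)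
    moreover have "exp_cost e + (1 + c2) \<le> com_cost \<beta> (Cond e p q)" using 2(2) by simp
    ultimately show ?thesis using 2 below_trans[OF same_below_below[OF 1(3)] 2(5)] by blast
  qed
next
  case (Rep l e p)
  then obtain s1 where 1: "exec W (comp_exp e d) s (exp_cost e) s1" "reg_of s1 (tmp d) = aval e vs as"
    "same_below d s s1" using exec_comp_exp[of s vs as e d] by auto
  then have e1: "encodes s1 vs as" using Rep.prems same_below_encodes by blast
  let ?body = "Seq (comp_com p (d + 1)) (Seq (Set (tmp (d + 1)) 1) (Sub (tmp d) (tmp d) (tmp (d + 1))))"
  \<comment> \<open>Induction on the counter \<open>x\<close>, for arbitrary states because every
    round changes them; the added 1 pays for the last, failing test.\<close>
  have loop: "\<exists>c s' vs' as'. exec W (While (tmp d) ?body) s c s' \<and> c \<le> 1 + x * (com_cost \<beta> p + 3) \<and>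
      Q vs' as' \<and> encodes s' vs' as' \<and> below d s s'"
    if "reg_of s (tmp d) = x" "x \<le> V" "(wp p ^^ x) Q vs as" "encodes s vs as" for x s vs as
    using that
  proof (induction x arbitrary: s vs as)
    case 0
    then have "exec W (While (tmp d) ?body) s 1 s" by (intro exec.WhileFalse)
    moreover have "below d s s" by (simp add: below_def)
    ultimately show ?case using 0 by (intro exI[of _ "1 :: nat"] exI[of _ s]) auto
  next
    case (Suc x)
    from Suc.prems(3) have "wp p ((wp p ^^ x) Q) vs as" by simp
    from Rep.IH[OF this Suc.prems(4), of "d + 1"] obtain c1 s1 vs1 as1 where 1:
      "exec W (comp_com p (d + 1)) s c1 s1" "c1 \<le> com_cost \<beta> p" "(wp p ^^ x) Q vs1 as1"
      "encodes s1 vs1 as1" "below (d + 1) s s1"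
      by auto
    obtain r m where s1: "s1 = State r m" by (cases s1)
    have r: "r (tmp d) = Suc x" using 1(5) Suc.prems(1) by (auto simp: below_def tmp_def s1)
    let ?s2 = "State (r(tmp (d + 1) := 1)) m"
    let ?s3 = "State (r(tmp (d + 1) := 1, tmp d := x)) m"
    have "exec W (Set (tmp (d + 1)) 1) s1 1 ?s2"
      unfolding s1 by (rule exec.Set) (simp add: W_def)
    moreover have "exec W (Sub (tmp d) (tmp d) (tmp (d + 1))) ?s2 1 ?s3"
      using exec.Sub[of "r(tmp (d + 1) := 1)" "tmp d" "tmp (d + 1)" W "tmp d" m] r Suc.prems(2)
      by (simp add: tmp_def W_def)
    ultimately have body: "exec W ?body s (c1 + (1 + 1)) ?s3" using 1(1) by (intro exec.Seq)
    have "2 * v \<noteq> tmp e" for v e unfolding tmp_def by presburger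
    moreover have "1 \<noteq> tmp d" "1 \<noteq> tmp (d + 1)" using \<open>1 \<le> d\<close> by (auto simp: tmp_def)
    ultimately have e3: "encodes ?s3 vs1 as1" using 1(4) unfolding encodes_def s1 by simp
    have "reg_of ?s3 (tmp d) = x" by simp
    from Suc.IH[OF this _ 1(3) e3] Suc.prems(2) obtain c2 s4 vs2 as2 where 2:
      "exec W (While (tmp d) ?body) ?s3 c2 s4" "c2 \<le> 1 + x * (com_cost \<beta> p + 3)" "Q vs2 as2"
      "encodes s4 vs2 as2" "below d ?s3 s4" by auto
    have "exec W (While (tmp d) ?body) s (1 + (c1 + (1 + 1)) + c2) s4"
      using Suc.prems(1) by (intro exec.WhileTrue[OF _ body 2(1)]) simp
    moreover have "below d s ?s3" using 1(5) by (auto simp: below_def s1 tmp_def)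
    then have "below d s s4" using below_trans[OF _ 2(5)] by blast
    moreover have "1 + (c1 + (1 + 1)) + c2 \<le> 1 + Suc x * (com_cost \<beta> p + 3)" using 1(2) 2(2) by simp
    ultimately show ?case using 2(3,4) by blast
  qed
  have x: "aval e vs as \<le> \<beta> ^ l" "(wp p ^^ aval e vs as) Q vs as" "safe e vs as"
    using Rep.prems by auto
  from loop[OF 1(2) aval_le_V[OF Rep.prems(2) x(3)] x(2) e1] obtain c s' vs' as' where 2:
    "exec W (While (tmp d) ?body) s1 c s'" "c \<le> 1 + aval e vs as * (com_cost \<beta> p + 3)"
    "Q vs' as'" "encodes s' vs' as'" "below d s1 s'" by blast
  have "aval e vs as * (com_cost \<beta> p + 3) \<le> \<beta> ^ l * (com_cost \<beta> p + 3)"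
    using x(1) by (rule mult_le_mono1)
  with 2(2) have "c \<le> 1 + \<beta> ^ l * (com_cost \<beta> p + 3)" by (meson add_left_mono order_trans)
  then have "exp_cost e + c \<le> com_cost \<beta> (Rep l e p)" by simp
  moreover have "exec W (comp_com (Rep l e p) d) s (exp_cost e + c) s'"
    unfolding comp_com.simps using 1(1) 2(1) by (intro exec.Seq)
  ultimately show ?case using 2(3,4) below_trans[OF same_below_below[OF 1(3)] 2(5)] by blast
qed

end

text \<open>The constant \<open>K\<close> absorbs letter codes and additive constants, since
  \<open>n + K \<le> (1 + K) * n\<close> for \<open>n \<ge> 1\<close>. All asymptotics are confined
  to this lemma; a program enters through its \<open>wp\<close> and its
  \<open>loop_degree\<close>.\<close>

lemma decidable_in_time_by_wp:
  fixes p :: com and code :: "'l \<Rightarrow> nat"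
  assumes "K \<ge> 1" and code: "\<And>x. code x \<le> K"
    and wp: "\<And>w. machine.wp (length w) ((length w + K) ^ Suc m) (length w + K)
      (\<lambda>i. if i < length w then code (w ! i) else 0) p
      (\<lambda>vs as. vs 0 = (if w \<in> L then 1 else 0)) ((\<lambda>_. 0)(0 := length w)) (\<lambda>_ _. 0)"
  shows "decidable_in_time code L (\<lambda>n. real n ^ loop_degree p)"
proof -
  define wb where "wb = (\<lambda>n. 17 * (n + K) ^ Suc m + 16)"
  define T where "T = (\<lambda>n. 1 + com_cost 1 p * (n + K) ^ loop_degree p)"
  have bigo: "(\<lambda>n. real (c + c' * (n + K) ^ e)) \<in> O(\<lambda>n. real n ^ e)" for c c' e
  proof (rule bigoI[of _ "real (c + c' * (1 + K) ^ e)"], rule eventually_sequentiallyI[of 1])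
    fix n :: nat assume n: "1 \<le> n"
    then have "n + K \<le> (1 + K) * n" using \<open>K \<ge> 1\<close> by (simp add: algebra_simps)
    then have "(n + K) ^ e \<le> (1 + K) ^ e * n ^ e"
      unfolding power_mult_distrib[symmetric] by (rule power_mono) simp
    then have "c' * (n + K) ^ e \<le> c' * ((1 + K) ^ e * n ^ e)" by (rule mult_le_mono2)
    moreover have "c * 1 \<le> c * n ^ e" using n by (intro mult_le_mono2) simp
    ultimately have "c + c' * (n + K) ^ e \<le> (c + c' * (1 + K) ^ e) * n ^ e"
      unfolding add_mult_distrib mult.assoc by linarith
    then have "real (c + c' * (n + K) ^ e) \<le> real ((c + c' * (1 + K) ^ e) * n ^ e)" by (simp only: of_nat_le_iff)
    then show "norm (real (c + c' * (n + K) ^ e)) \<le> real (c + c' * (1 + K) ^ e) * norm (real n ^ e)"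
      by (simp only: real_norm_def abs_of_nat of_nat_mult of_nat_power power_abs)
  qed
  \<comment> \<open>Register 0 is also variable 0, so the input length is saved in register 1, at
    the cost of the leading 1 in \<open>T\<close>.\<close>
  have "decides (Seq (Copy 1 0) (comp_com p 1)) code L wb T"
    unfolding decides_def
  proof
    fix w :: "'l list"
    let ?n = "length w" and ?inp = "\<lambda>i. if i < length w then code (w ! i) else 0"
    have pow: "?n + K \<le> (?n + K) ^ Suc m" using \<open>K \<ge> 1\<close> by (intro self_le_power) auto
    interpret machine ?n "(?n + K) ^ Suc m" "?n + K" ?inp
    proof
      show "?inp i \<le> (?n + K) ^ Suc m" for i
        using le_trans[OF code[of "w ! i"] le_trans[OF _ pow]] by simp
    qed (use pow \<open>K \<ge> 1\<close> in linarith)+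
    let ?s = "State ((\<lambda>_. 0)(0 := ?n, 1 := ?n)) (\<lambda>i. if i < length w then code (w ! i) else 0)"
    have "machine.W ((?n + K) ^ Suc m) = wb ?n" unfolding wb_def W_def ..
    moreover have "encodes ?s ((\<lambda>_. 0)(0 := ?n)) (\<lambda>_ _. 0)"
      using V(1) unfolding encodes_def by auto
    from exec_comp_com[OF wp[of w] this, of 1] obtain c s' vs' as' where 1:
      "exec (machine.W ((?n + K) ^ Suc m)) (comp_com p 1) ?s c s'" "c \<le> com_cost (?n + K) p"
      "vs' 0 = (if w \<in> L then 1 else 0)" "encodes s' vs' as'"
      by auto
    moreover have "exec (wb ?n) (Copy 1 0) (initial_state code w) 1 ?s"
      using exec.Copy[of "(\<lambda>_. 0)(0 := ?n)" 0 "wb ?n" 1] V(1)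
      by (simp add: initial_state_def wb_def)
    ultimately have "exec (wb ?n) (Seq (Copy 1 0) (comp_com p 1)) (initial_state code w) (1 + c) s'"
      by (intro exec.Seq) (simp_all only:)
    moreover have "1 + c \<le> T ?n" using 1(2) com_cost_le[of "?n + K" p] \<open>K \<ge> 1\<close> by (simp add: T_def)
    moreover have "reg_of s' 0 = (if w \<in> L then 1 else 0)"
      using 1(3,4) unfolding encodes_def by (metis mult_0_right)
    ultimately show "\<exists>c s. exec (wb ?n) (Seq (Copy 1 0) (comp_com p 1)) (initial_state code w) c s \<and>
        c \<le> T ?n \<and> reg_of s 0 = (if w \<in> L then 1 else 0)" by blast
  qed
  moreover have "(\<lambda>n. real (wb n)) \<in> O(\<lambda>n. real n ^ Suc m)"
    using bigo[of 16 17 "Suc m"] by (simp only: wb_def add.commute)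
  moreover have "(\<lambda>n. real (T n)) \<in> O(\<lambda>n. real n ^ loop_degree p)"
    using bigo[of 1] by (simp only: T_def)
  ultimately show ?thesis unfolding decidable_in_time_def by blast
qed

section \<open>Evaluating sums of powers of two\<close>

text \<open>
  \<open>d\<close> approximates \<open>\<tau>\<close> with saturation at \<open>\<plusminus>B\<close>: once saturated, it may have drifted back by at most \<open>w\<close>.
\<close>

definition sat :: "int \<Rightarrow> int \<Rightarrow> int \<Rightarrow> int \<Rightarrow> bool" where
  "sat B w \<tau> d \<longleftrightarrow> \<bar>d\<bar> \<le> B \<and> (d = \<tau> \<or> B - w \<le> d \<and> d \<le> \<tau> \<or> d \<le> w - B \<and> \<tau> \<le> d)"

definition clamp :: "int \<Rightarrow> int \<Rightarrow> int" where
  "clamp B d = max (- B) (min B d)"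

text \<open>A saturated value is at least \<open>B - w \<ge> 0\<close> away from 0 on the side of
  the true value, and doubling never brings it closer.\<close>

lemma sat_double: "sat B w \<tau> d \<Longrightarrow> 0 \<le> w \<Longrightarrow> w \<le> B \<Longrightarrow> sat B w (2 * \<tau>) (clamp B (2 * d))"
  unfolding sat_def clamp_def by linarith

text \<open>A summand can pull a saturated value back by at most its own size, which is charged to
  the drift.\<close>

lemma sat_add:
  "sat B w \<tau> d \<Longrightarrow> \<bar>c\<bar> \<le> w' \<Longrightarrow> 0 \<le> w \<Longrightarrow> w + w' \<le> B \<Longrightarrow> sat B (w + w') (\<tau> + c) (clamp B (d + c))"
  unfolding sat_def clamp_def by linarith

lemma sat_mono: "sat B w \<tau> d \<Longrightarrow> w \<le> w' \<Longrightarrow> sat B w' \<tau> d"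
  unfolding sat_def by linarith

text \<open>A nonzero \<open>\<tau>\<close> makes \<open>\<tau> * 2 ^ G\<close> larger than
  \<open>B\<close> in absolute value, so at the cut-off \<open>d\<close> is already saturated, and a
  larger exponent only moves the true value further out.\<close>

lemma sat_gap:
  assumes "sat B w (\<tau> * 2 ^ nat (min G \<gamma>)) d" "B < 2 ^ nat G" "0 \<le> \<gamma>" "w \<le> B"
  shows "sat B w (\<tau> * 2 ^ nat \<gamma>) d"
proof (cases "\<gamma> \<le> G")
  case False
  then have le: "(2 :: int) ^ nat G \<le> 2 ^ nat \<gamma>" by (intro power_increasing) auto
  from False assms(1) have s: "sat B w (\<tau> * 2 ^ nat G) d" by simp
  consider "\<tau> = 0" | "\<tau> > 0" | "\<tau> < 0" by linarith
  then show ?thesis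
  proof cases
    case 2
    then have "1 * 2 ^ nat G \<le> \<tau> * 2 ^ nat G" by (intro mult_right_mono) auto
    moreover have "\<tau> * 2 ^ nat G \<le> \<tau> * 2 ^ nat \<gamma>" using 2 le by (intro mult_left_mono) auto
    ultimately show ?thesis using s assms(2,4) unfolding sat_def by linarith
  next
    case 3
    then have "\<tau> * 2 ^ nat G \<le> - 1 * 2 ^ nat G" by (intro mult_right_mono) auto
    moreover have "\<tau> * 2 ^ nat \<gamma> \<le> \<tau> * 2 ^ nat G" using 3 le by (intro mult_left_mono_neg) auto
    ultimately show ?thesis using s assms(2,4) unfolding sat_def by linarith
  qed (use s in auto)
qed (use assms in auto)

text \<open>A saturated \<open>d\<close> exceeds the exact part \<open>u\<close> in size by at least
  \<open>G\<close>, so the true and the approximate sum are cut off to \<open>{0..G}\<close>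
  alike.\<close>

lemma sat_final:
  assumes "sat B w \<tau> d" "\<bar>u\<bar> \<le> w'" "G + w + w' \<le> B" "0 \<le> G"
  shows "nat (min G (d + u)) = nat (min G (\<tau> + u)) \<and> nat (min G (- (d + u))) = nat (min G (- (\<tau> + u)))"
proof -
  from assms(1) consider "d = \<tau>" | "B - w \<le> d" "d \<le> \<tau>" | "d \<le> w - B" "\<tau> \<le> d"
    unfolding sat_def by blast
  then show ?thesis by cases (use assms in auto)
qed

text \<open>
  Power number \<open>i\<close> has exponent \<open>e i\<close>, power number 0 being 1. Matrices are stored in rows of length
  \<open>S\<close>, whose starts are tabulated in \<open>aROW\<close>. Row \<open>i\<close> of \<open>aEP\<close> minus row \<open>i\<close> of \<open>aEN\<close> holds the coefficients of
  \<open>e i\<close> with respect to the powers, \<open>aD\<close> the differences \<open>e i - e j\<close> cut off to \<open>{0..G}\<close>, \<open>aORD\<close> the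
  numbers of the powers by descending exponent, \<open>aCP\<close> minus \<open>aCN\<close> the coefficients of the sum to
  be evaluated, and \<open>aH\<close> is a table for halving. Integers are kept as pairs of a positive and a
  negative part. A signed power in a list consists of its number (\<open>aRI\<close>, \<open>aKI\<close>) and its sign, 1 or
  0 (\<open>aRS\<close>, \<open>aKS\<close>). For level \<open>l\<close> of the stack, \<open>aLR\<close> and \<open>aLK\<close> point to the starts of its two lists and
  \<open>aLE\<close> gives the exponent of the letter \<open>b\<close> below it.
\<close>

abbreviation (input) "vn \<equiv> 0 :: nat"
abbreviation (input) "vS \<equiv> 1 :: nat"
abbreviation (input) "vG \<equiv> 2 :: nat"
abbreviation (input) "vB \<equiv> 3 :: nat"
abbreviation (input) "vN \<equiv> 4 :: nat"
abbreviation (input) "vL \<equiv> 5 :: nat"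
abbreviation (input) "vR \<equiv> 6 :: nat"
abbreviation (input) "vK \<equiv> 7 :: nat"
abbreviation (input) "vi \<equiv> 8 :: nat"
abbreviation (input) "vc \<equiv> 9 :: nat"
abbreviation (input) "vj \<equiv> 10 :: nat"
abbreviation (input) "vid \<equiv> 11 :: nat"
abbreviation (input) "vpr \<equiv> 12 :: nat"
abbreviation (input) "vx \<equiv> 13 :: nat"
abbreviation (input) "vy \<equiv> 14 :: nat"
abbreviation (input) "vux \<equiv> 15 :: nat"
abbreviation (input) "vuy \<equiv> 16 :: nat"
abbreviation (input) "vF \<equiv> 17 :: nat"
abbreviation (input) "vxx \<equiv> 18 :: nat"
abbreviation (input) "vyy \<equiv> 19 :: nat"
abbreviation (input) "vOX \<equiv> 20 :: nat"
abbreviation (input) "vOY \<equiv> 21 :: nat"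
abbreviation (input) "vbase \<equiv> 22 :: nat"
abbreviation (input) "vfrom \<equiv> 23 :: nat"
abbreviation (input) "vto \<equiv> 24 :: nat"
abbreviation (input) "vnr \<equiv> 25 :: nat"
abbreviation (input) "vbr \<equiv> 26 :: nat"
abbreviation (input) "vor \<equiv> 27 :: nat"
abbreviation (input) "vq \<equiv> 28 :: nat"
abbreviation (input) "vjj \<equiv> 29 :: nat"
abbreviation (input) "vp \<equiv> 30 :: nat"
abbreviation (input) "vok \<equiv> 31 :: nat"
abbreviation (input) "vqq \<equiv> 32 :: nat"
abbreviation (input) "vsg \<equiv> 33 :: nat"

abbreviation (input) "aH \<equiv> 0 :: nat"
abbreviation (input) "aROW \<equiv> 1 :: nat"
abbreviation (input) "aEP \<equiv> 2 :: nat"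
abbreviation (input) "aEN \<equiv> 3 :: nat"
abbreviation (input) "aD \<equiv> 4 :: nat"
abbreviation (input) "aORD \<equiv> 5 :: nat"
abbreviation (input) "aCP \<equiv> 6 :: nat"
abbreviation (input) "aCN \<equiv> 7 :: nat"
abbreviation (input) "aRI \<equiv> 8 :: nat"
abbreviation (input) "aRS \<equiv> 9 :: nat"
abbreviation (input) "aKI \<equiv> 10 :: nat"
abbreviation (input) "aKS \<equiv> 11 :: nat"
abbreviation (input) "aLR \<equiv> 12 :: nat"
abbreviation (input) "aLK \<equiv> 13 :: nat"
abbreviation (input) "aLE \<equiv> 14 :: nat"

text \<open>With subtraction truncated at 0, \<open>e - (e - v)\<close> is the minimum of
  \<open>e\<close> and \<open>v\<close>.\<close>

definition min_exp :: "nat \<Rightarrow> aexp \<Rightarrow> aexp" where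
  "min_exp v e = Minus e (Minus e (Var v))"

definition double_com :: com where
  "double_com = vx ::= min_exp vB (Plus (Var vx) (Var vx)) ;; vy ::= min_exp vB (Plus (Var vy) (Var vy))"

text \<open>The truncated differences in both directions restore a pair with at most one nonzero
  part before the cut-off at \<open>B\<close>.\<close>

definition add_coeff_sat :: com where
  "add_coeff_sat =
    vxx ::= Plus (Var vx) (Arr aCP (Var vid)) ;; vyy ::= Plus (Var vy) (Arr aCN (Var vid)) ;;
    vx ::= min_exp vB (Minus (Var vxx) (Var vyy)) ;; vy ::= min_exp vB (Minus (Var vyy) (Var vxx)) ;;
    vpr ::= Var vid"

text \<open>Horner's scheme: passing to the next smaller exponent doubles the sum once per unit of
  the gap. Cell \<open>id\<close> of \<open>aD\<close> lies in the row of power number 0, whose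
  exponent is 0, so it is nonzero exactly for negative exponents, which this pass skips.\<close>

definition top_down_body :: com where
  "top_down_body =
    vid ::= Arr aORD (Var vj) ;;
    Cond (Arr aD (Var vid)) Nop
      (Rep 1 (Arr aD (Plus (Arr aROW (Var vpr)) (Var vid))) double_com ;; add_coeff_sat)"

definition top_down :: com where
  "top_down =
    vx ::= Num 0 ;; vy ::= Num 0 ;; vpr ::= Arr aORD (Num 0) ;; For 2 vj (Var vN) top_down_body"

text \<open>A number minus twice its tabulated half is its parity; once a 1 is lost,
  \<open>vF\<close> records that the sum is not an integer.\<close>

definition halve_com :: com where
  "halve_com =
    Rep 1 (Arr aD (Plus (Arr aROW (Var vid)) (Var vpr))) (
      Cond (Plus (Minus (Minus (Var vux) (Arr aH (Var vux))) (Arr aH (Var vux)))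
          (Minus (Minus (Var vuy) (Arr aH (Var vuy))) (Arr aH (Var vuy)))) (vF ::= Num 1) Nop ;;
      vux ::= Arr aH (Var vux) ;; vuy ::= Arr aH (Var vuy))"

definition add_coeff :: com where
  "add_coeff =
    vxx ::= Plus (Var vux) (Arr aCP (Var vid)) ;; vyy ::= Plus (Var vuy) (Arr aCN (Var vid)) ;;
    vux ::= Minus (Var vxx) (Var vyy) ;; vuy ::= Minus (Var vyy) (Var vxx) ;;
    vpr ::= Var vid"

definition bottom_up_body :: com where
  "bottom_up_body =
    vid ::= Arr aORD (Minus (Minus (Var vN) (Num 1)) (Var vj)) ;;
    Cond (Arr aD (Var vid)) (halve_com ;; add_coeff) Nop"

text \<open>The powers come by ascending exponent, and the last gap, up to exponent 0, is closed by
  a final halving. The pass from above ends at exponent 0 by itself, since it visits power number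
  0.\<close>

definition bottom_up :: com where
  "bottom_up =
    vF ::= Num 0 ;; vux ::= Num 0 ;; vuy ::= Num 0 ;; vpr ::= Arr aORD (Minus (Var vN) (Num 1)) ;;
    For 2 vj (Var vN) bottom_up_body ;; vid ::= Num 0 ;; halve_com"

definition eval_coeffs :: com where
  "eval_coeffs = top_down ;; bottom_up ;;
    vxx ::= Plus (Var vx) (Var vux) ;; vyy ::= Plus (Var vy) (Var vuy) ;;
    vOX ::= min_exp vG (Minus (Var vxx) (Var vyy)) ;; vOY ::= min_exp vG (Minus (Var vyy) (Var vxx))"

lemma eval_coeffs_mod [simp]:
  "mod_vars double_com = {vx, vy}"
  "mod_vars top_down = {vx, vy, vpr, vj, vid, vxx, vyy}"
  "mod_vars halve_com = {vF, vux, vuy}"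
  "mod_vars bottom_up = {vF, vux, vuy, vpr, vj, vid, vxx, vyy}"
  "mod_vars eval_coeffs = {vx, vy, vpr, vj, vid, vxx, vyy, vF, vux, vuy, vOX, vOY}"
  "mod_arrs double_com = {}" "mod_arrs top_down = {}" "mod_arrs halve_com = {}"
  "mod_arrs bottom_up = {}" "mod_arrs eval_coeffs = {}"
  by (rule equalityI; simp add: double_com_def top_down_def top_down_body_def add_coeff_sat_def
      halve_com_def bottom_up_def bottom_up_body_def add_coeff_def eval_coeffs_def)+

lemma eval_coeffs_degree [simp]: "loop_degree eval_coeffs = 3"
  by (simp add: double_com_def top_down_def top_down_body_def add_coeff_sat_def halve_com_def
      bottom_up_def bottom_up_body_def add_coeff_def eval_coeffs_def)

text \<open>
  \<open>M\<close> bounds the sum of the absolute values of the coefficients in every evaluated sum, and exponents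
  matter only up to differences of \<open>G\<close>, as \<open>2 ^ G\<close> exceeds the saturation bound \<open>B\<close>. At most
  \<open>S - 1\<close> powers of two are ever introduced.
\<close>

locale solver = machine +
  assumes \<beta>: "\<beta> = n + 16" and V_eq: "V = \<beta> ^ 6"
begin

definition S :: nat where "S = n * n + 2"
text \<open>The factor 2 stands for the two coefficient rows of a compared difference; a row has
  weight at most \<open>n\<close> times its index, and indices are below \<open>S\<close>.
  \<open>B\<close> is what \<open>sat_final\<close> requires when drift and carry are both at most
  \<open>M\<close>.\<close>

definition M :: nat where "M = 2 * n * (n * n + 1)"
definition G :: nat where "G = n + 12"
definition B :: nat where "B = 2 * M + G"

lemma B_less: "B < 2 ^ G"
proof -
  \<comment> \<open>From \<open>m = 4\<close> on, passing from \<open>m\<close> to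
    \<open>m + 1\<close> at most doubles the cube, whence the shift by 4; the 12 in \<open>G\<close>
    covers the factor \<open>5 * 64\<close>.\<close>
  have "(n + 4) ^ 3 \<le> 64 * 2 ^ n"
  proof (induction n)
    case (Suc n)
    have "(Suc n + 4) ^ 3 \<le> 2 * (n + 4) ^ 3" by (simp add: power3_eq_cube algebra_simps)
    with Suc show ?case by simp
  qed simp
  moreover have "B < 5 * (n + 4) ^ 3" by (simp add: B_def M_def G_def power3_eq_cube algebra_simps)
  ultimately have "B < 5 * (64 * 2 ^ n)" by linarith
  also have "\<dots> \<le> 2 ^ G" by (simp add: G_def power_add)
  finally show ?thesis .
qed

lemma B_less_int: "int B < 2 ^ nat (int G)"
  using B_less by (simp flip: of_nat_less_iff)

text \<open>The largest numbers are matrix indices, of order \<open>n^4\<close>; the degree 6 and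
  the 16 in \<open>\<beta>\<close> leave room for the constants.\<close>

lemma bounds_V: "16 * B \<le> V" "S * S + S \<le> V"
proof -
  have n: "n \<le> \<beta>" "16 \<le> \<beta>" by (auto simp: \<beta>)
  have 1: "n * n \<le> \<beta> * \<beta>" "n * n * n \<le> \<beta> * \<beta> * \<beta>" using n by (auto intro!: mult_le_mono)
  have 2: "16 * \<beta> \<le> \<beta> * \<beta>" "16 * (\<beta> * \<beta>) \<le> \<beta> * \<beta> * \<beta>" using n by (simp_all add: mult_le_mono)
  have 3: "256 * (\<beta> * \<beta> * \<beta>) \<le> \<beta> * \<beta> * (\<beta> * \<beta> * \<beta>)"
    using mult_le_mono[OF mult_le_mono[OF n(2) n(2)], of "\<beta> * \<beta> * \<beta>" "\<beta> * \<beta> * \<beta>"] by simp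
  have "B = 4 * (n * n * n) + 5 * n + 12" by (simp add: B_def M_def G_def algebra_simps)
  then have "16 * B \<le> 256 * (\<beta> * \<beta> * \<beta>)" using 1 2 n by linarith
  also have "\<dots> \<le> \<beta> * \<beta> * (\<beta> * \<beta> * \<beta>) * \<beta>" using 3 n by (intro order_trans[OF 3]) simp
  also have "\<dots> = V" by (simp add: V_eq eval_nat_numeral algebra_simps)
  finally show "16 * B \<le> V" .
  have "S \<le> \<beta> * \<beta>" by (simp add: \<beta> S_def algebra_simps)
  then have "S * S \<le> \<beta> * \<beta> * (\<beta> * \<beta>)" by (intro mult_le_mono)
  moreover have "\<beta> * \<beta> * 1 \<le> \<beta> * \<beta> * (\<beta> * \<beta>)" using n by (intro mult_le_mono2) simp
  ultimately have "S * S + S \<le> 2 * (\<beta> * \<beta> * (\<beta> * \<beta>))" using \<open>S \<le> \<beta> * \<beta>\<close> by linarith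
  also have "\<dots> \<le> (\<beta> * \<beta>) * (\<beta> * \<beta> * (\<beta> * \<beta>))"
    using 2 n by (intro mult_le_mono1) linarith
  also have "\<dots> = V" by (simp add: V_eq eval_nat_numeral algebra_simps)
  finally show "S * S + S \<le> V" .
qed

lemma small_le_V [simp]:
  "B \<le> V" "2 * B \<le> V" "M \<le> B" "G \<le> B" "M \<le> V" "G \<le> V" "2 * M \<le> V" "S \<le> V" "n \<le> V"
  "n * n + 1 \<le> V" "B + M \<le> V" "4 * M \<le> V"
  using bounds_V V(1) by (auto simp: B_def S_def)

lemma row_le_V: "i < S \<Longrightarrow> j \<le> S \<Longrightarrow> i * S + j \<le> V"
  using bounds_V(2) mult_le_mono1[of i S S] by linarith

lemma loop_bounds: "i < S \<Longrightarrow> i \<le> \<beta> ^ 2" "i \<le> G \<Longrightarrow> i \<le> \<beta>" "i \<le> n \<Longrightarrow> i \<le> \<beta>"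
proof -
  have "S \<le> \<beta> ^ 2" by (simp add: \<beta> S_def power2_eq_square algebra_simps)
  then show "i < S \<Longrightarrow> i \<le> \<beta> ^ 2" by simp
qed (auto simp: \<beta> G_def)

text \<open>The exponents \<open>e\<close> may be astronomically large and occur in assertions
  alone; what the memory holds here is their order and their differences cut off at
  \<open>G\<close>.\<close>

definition powers :: "(nat \<Rightarrow> int) \<Rightarrow> vars \<Rightarrow> arrs \<Rightarrow> bool" where
  "powers e vs as \<longleftrightarrow> vs vS = S \<and> vs vG = G \<and> vs vB = B \<and> 0 < vs vN \<and> vs vN < S \<and> e 0 = 0 \<and>
    bij_betw (as aORD) {..<vs vN} {..<vs vN} \<and>
    (\<forall>i j. i \<le> j \<longrightarrow> j < vs vN \<longrightarrow> e (as aORD j) \<le> e (as aORD i)) \<and>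
    (\<forall>i<vs vN. \<forall>j<vs vN. as aD (i * S + j) = nat (min (int G) (e i - e j))) \<and>
    (\<forall>i<S. as aROW i = i * S) \<and> (\<forall>i\<le>2 * M. as aH i = i div 2)"

lemma powersD:
  assumes "powers e vs as"
  shows "vs vS = S" "vs vG = G" "vs vB = B" "0 < vs vN" "vs vN < S" "e 0 = 0"
    "bij_betw (as aORD) {..<vs vN} {..<vs vN}"
    "i < vs vN \<Longrightarrow> as aORD i < vs vN"
    "i \<le> j \<Longrightarrow> j < vs vN \<Longrightarrow> e (as aORD j) \<le> e (as aORD i)"
    "i < vs vN \<Longrightarrow> j < vs vN \<Longrightarrow> as aD (i * S + j) = nat (min (int G) (e i - e j))"
    "j < vs vN \<Longrightarrow> as aD j = nat (min (int G) (- e j))"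
    "i < S \<Longrightarrow> as aROW i = i * S" "i \<le> 2 * M \<Longrightarrow> as aH i = i div 2"
    "j < vs vN \<Longrightarrow> \<exists>i<vs vN. as aORD i = j"
proof -
  show "j < vs vN \<Longrightarrow> \<exists>i<vs vN. as aORD i = j"
    using assms unfolding powers_def bij_betw_def by (metis imageE lessThan_iff)
  show "i < vs vN \<Longrightarrow> as aORD i < vs vN"
    using assms unfolding powers_def bij_betw_def by blast
  have "0 < vs vN" "e 0 = 0" using assms by (auto simp: powers_def)
  then show "j < vs vN \<Longrightarrow> as aD j = nat (min (int G) (- e j))"
    using assms unfolding powers_def by (metis add_0 diff_0 mult_0)
qed (use assms in \<open>auto simp: powers_def\<close>)

lemma aval_min_exp [simp]: "aval (min_exp v e) vs as = min (aval e vs as) (vs v)"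
  by (simp add: min_exp_def)

lemma safe_min_exp [simp]: "safe (min_exp v e) vs as \<longleftrightarrow> safe e vs as"
  by (simp add: min_exp_def)

section \<open>The pass from above\<close>

lemma wp_double_com:
  assumes "vs vB = B" "vs vx = nat d" "vs vy = nat (- d)" "sat B w \<tau> d" "0 \<le> w" "w \<le> B"
    and e: "safe e vs as" "aval e vs as = g" "g \<le> G"
  shows "wp (Rep 1 e double_com) (\<lambda>vs' as'. \<exists>d. vs' vx = nat d \<and> vs' vy = nat (- d) \<and>
    sat B w (\<tau> * 2 ^ g) d) vs as"
proof (rule wp_Rep[where I = "\<lambda>i vs' as'. vs' vB = B \<and> (\<exists>d. vs' vx = nat d \<and> vs' vy = nat (- d) \<and>
    sat B w (\<tau> * 2 ^ i) d)"])
  fix i vs' as'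
  assume "vs' vB = B \<and> (\<exists>d. vs' vx = nat d \<and> vs' vy = nat (- d) \<and> sat B w (\<tau> * 2 ^ i) d)"
  then obtain d where d: "vs' vB = B" "vs' vx = nat d" "vs' vy = nat (- d)" "sat B w (\<tau> * 2 ^ i) d"
    by blast
  have "nat d + nat d \<le> V" "nat (- d) + nat (- d) \<le> V"
    using d(4) small_le_V(2) unfolding sat_def by linarith+
  moreover have "min (nat d + nat d) B = nat (clamp B (2 * d))"
    "min (nat (- d) + nat (- d)) B = nat (- clamp B (2 * d))"
    unfolding clamp_def by linarith+
  moreover have "sat B w (\<tau> * 2 ^ Suc i) (clamp B (2 * d))"
    using sat_double[OF d(4) assms(5,6)] by (simp add: algebra_simps)
  ultimately show "wp double_com (\<lambda>vs' as'. vs' vB = B \<and> (\<exists>d. vs' vx = nat d \<and> vs' vy = nat (- d) \<and>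
      sat B w (\<tau> * 2 ^ Suc i) d)) vs' as'"
    by (auto simp: double_com_def d)
qed (use assms loop_bounds in auto)

lemma wp_top_down:
  assumes p: "powers e vs as" and w: "(\<Sum>i<vs vN. as aCP i + as aCN i) \<le> M"
  shows "wp top_down (\<lambda>vs' as'. \<exists>d. vs' vx = nat d \<and> vs' vy = nat (- d) \<and>
    sat B M (\<Sum>i | i < vs vN \<and> 0 \<le> e i. (int (as aCP i) - int (as aCN i)) * 2 ^ nat (e i)) d) vs as"
proof -
  note pD = powersD[OF p]
  define N where "N = vs vN"
  define ord where "ord = as aORD"
  define c where "c i = int (as aCP i) - int (as aCN i)" for i
  \<comment> \<open>The weight of the coefficients read so far serves as the drift in
    \<open>sat\<close>; it never exceeds \<open>M\<close>.\<close>
  define wt where "wt j = (\<Sum>i<j. as aCP (ord i) + as aCN (ord i))" for j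
  define T where "T j = (\<Sum>i<j. if 0 \<le> e (ord i) then c (ord i) * 2 ^ nat (e (ord i)) else 0)" for j
  have bij: "bij_betw ord {..<N} {..<N}" using pD(7) by (simp add: N_def ord_def)
  have wtN: "wt N \<le> M"
    using w sum.reindex_bij_betw[OF bij, of "\<lambda>i. as aCP i + as aCN i"] by (simp add: wt_def N_def)
  have wt_mono: "j \<le> N \<Longrightarrow> wt j \<le> wt N" for j unfolding wt_def by (intro sum_mono2) auto
  have TN: "T N = (\<Sum>i | i < N \<and> 0 \<le> e i. c i * 2 ^ nat (e i))"
  proof -
    have "T N = (\<Sum>i<N. if 0 \<le> e i then c i * 2 ^ nat (e i) else 0)"
      unfolding T_def by (rule sum.reindex_bij_betw[OF bij])
    also have "\<dots> = (\<Sum>i | i < N \<and> 0 \<le> e i. c i * 2 ^ nat (e i))"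
      by (simp add: sum.If_cases Int_def lessThan_def)
    finally show ?thesis .
  qed
  \<comment> \<open>The contribution of the first \<open>j\<close> powers is
    \<open>\<tau> * 2 ^ e pr\<close>, where \<open>pr\<close> is the last power used, and the pair
    \<open>vx\<close>, \<open>vy\<close> approximates \<open>\<tau>\<close>.\<close>
  define I where "I j vs' as' \<longleftrightarrow> as' = as \<and> (\<forall>v. v \<notin> mod_vars top_down \<longrightarrow> vs' v = vs v) \<and>
      vs' vpr < N \<and> 0 \<le> e (vs' vpr) \<and> (\<forall>i<j. 0 \<le> e (ord i) \<longrightarrow> e (vs' vpr) \<le> e (ord i)) \<and>
      (\<forall>i. j \<le> i \<longrightarrow> i < N \<longrightarrow> e (ord i) \<le> e (vs' vpr)) \<and>
      (\<exists>d \<tau>. vs' vx = nat d \<and> vs' vy = nat (- d) \<and> sat B (wt j) \<tau> d \<and> \<tau> * 2 ^ nat (e (vs' vpr)) = T j)"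
    for j vs' and as' :: arrs
  have init: "I 0 (vs(vx := 0, vy := 0, vpr := ord 0, vj := 0)) as"
  proof -
    have "e 0 \<le> e (ord 0)"
    proof -
      from pD(14)[OF pD(4)] obtain i where "i < N" "ord i = 0" by (auto simp: N_def ord_def)
      with pD(9)[of 0 i] show ?thesis by (simp add: N_def ord_def)
    qed
    then show ?thesis using pD(4,6,8,9) unfolding I_def
      by (auto simp: N_def ord_def T_def wt_def sat_def intro!: exI[of _ 0])
  qed
  have step: "wp top_down_body
      (\<lambda>vs'' as''. vs'' vj = j \<and> I (Suc j) (vs''(vj := Suc j)) as'') vs' as'"
    if j: "j < N" "vs' vj = j" and I: "I j vs' as'" for j vs' as'
  proof -
    let ?id = "ord j"
    have as: "as' = as" and fr: "\<And>v. v \<notin> mod_vars top_down \<Longrightarrow> vs' v = vs v"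
      and pr: "vs' vpr < N" "0 \<le> e (vs' vpr)" "\<And>i. i < j \<Longrightarrow> 0 \<le> e (ord i) \<Longrightarrow> e (vs' vpr) \<le> e (ord i)"
        "\<And>i. j \<le> i \<Longrightarrow> i < N \<Longrightarrow> e (ord i) \<le> e (vs' vpr)"
      using I by (auto simp: I_def)
    obtain d \<tau> where d: "vs' vx = nat d" "vs' vy = nat (- d)" "sat B (wt j) \<tau> d"
      "\<tau> * 2 ^ nat (e (vs' vpr)) = T j" using I by (auto simp: I_def)
    have id: "?id < N" using pD(8) j by (simp add: N_def ord_def)
    have wtj: "wt (Suc j) = wt j + (as aCP ?id + as aCN ?id)" by (simp add: wt_def)
    have wle: "wt (Suc j) \<le> M" using wt_mono[of "Suc j"] wtN j by simp
    have D0: "as aD ?id = nat (min (int G) (- e ?id))" using pD(11) id by (simp add: N_def)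
    show ?thesis
    proof (cases "0 \<le> e ?id")
      case False
      then have "as aD ?id \<noteq> 0" using D0 by (simp add: G_def)
      moreover have "I (Suc j) (vs'(vid := ?id, vj := Suc j)) as"
      proof -
        have "sat B (wt (Suc j)) \<tau> d" using d(3) by (rule sat_mono) (simp add: wtj)
        moreover have "T (Suc j) = T j" using False by (simp add: T_def)
        ultimately show ?thesis using I d False by (auto simp: I_def less_Suc_eq)
      qed
      ultimately show ?thesis using j as by (simp add: top_down_body_def ord_def[symmetric])
    next
      case True
      let ?pr = "vs' vpr"
      let ?g = "nat (min (int G) (e ?pr - e ?id))"
      have D: "as aD (?pr * S + ?id) = ?g" using pD(10) pr id by (simp add: N_def)
      have D0': "as aD ?id = 0" using D0 True by simp
      have N: "N < S" using pD(5) by (simp add: N_def)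
      have "wp (Rep 1 (Arr aD (Plus (Arr aROW (Var vpr)) (Var vid))) double_com) (\<lambda>vs' as'. \<exists>d. vs' vx = nat d \<and> vs' vy = nat (- d) \<and>
          sat B (wt j) (\<tau> * 2 ^ ?g) d) (vs'(vid := ?id)) as"
      proof (rule wp_double_com)
        show "int (wt j) \<le> int B" using wle wtj small_le_V(3) by linarith
        show "safe (Arr aD (Plus (Arr aROW (Var vpr)) (Var vid))) (vs'(vid := ?id)) as"
          using pr(1) id N pD(12)[of ?pr] row_le_V[of ?pr ?id] by simp
        show "aval (Arr aD (Plus (Arr aROW (Var vpr)) (Var vid))) (vs'(vid := ?id)) as = ?g"
          using pr(1) id N pD(12)[of ?pr] D by simp
      qed (use d fr pD(3) in auto)
      then have "wp (Rep 1 (Arr aD (Plus (Arr aROW (Var vpr)) (Var vid))) double_com)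
        (wp add_coeff_sat (\<lambda>vs'' as''. vs'' vj = j \<and> I (Suc j) (vs''(vj := Suc j)) as''))
        (vs'(vid := ?id)) as"
      proof (rule wp_conseq)
        fix vs2 as2 assume u: "unchanged (Rep 1 (Arr aD (Plus (Arr aROW (Var vpr)) (Var vid))) double_com) (vs'(vid := ?id)) as vs2 as2"
          and "\<exists>d. vs2 vx = nat d \<and> vs2 vy = nat (- d) \<and> sat B (wt j) (\<tau> * 2 ^ ?g) d"
        then obtain d2 where d2: "vs2 vx = nat d2" "vs2 vy = nat (- d2)" "sat B (wt j) (\<tau> * 2 ^ ?g) d2"
          by blast
        have as2: "as2 = as" and fr2: "\<And>v. v \<notin> {vx, vy} \<Longrightarrow> vs2 v = (vs'(vid := ?id)) v"
          using u by (auto simp: unchanged_def)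
        have w1: "int (wt j) \<le> int B" and w2: "int (wt j) + (int (as aCP ?id) + int (as aCN ?id)) \<le> int B"
          using wle wtj small_le_V(3) by linarith+
        have w3: "\<bar>c ?id\<bar> \<le> int (as aCP ?id) + int (as aCN ?id)" unfolding c_def by linarith
        \<comment> \<open>The loop doubled for the cut-off gap; \<open>sat_gap\<close> passes to the
          true one.\<close>
        have "sat B (wt j) (\<tau> * 2 ^ nat (e ?pr - e ?id)) d2"
          using d2(3) B_less_int _ w1 by (rule sat_gap) (use pr(4)[of j] j in simp)
        then have s3: "sat B (wt (Suc j)) (\<tau> * 2 ^ nat (e ?pr - e ?id) + c ?id) (clamp B (d2 + c ?id))"
          unfolding wtj of_nat_add
          by (rule sat_add[OF _ w3 _ w2]) simp
        have val: "(\<tau> * 2 ^ nat (e ?pr - e ?id) + c ?id) * 2 ^ nat (e ?id) = T (Suc j)"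
        proof -
          have "nat (e ?pr) = nat (e ?pr - e ?id) + nat (e ?id)" using True pr(4)[of j] j by simp
          then have "\<tau> * 2 ^ nat (e ?pr - e ?id) * 2 ^ nat (e ?id) = T j"
            using d(4) by (simp add: power_add)
          then show ?thesis using True by (simp add: T_def algebra_simps)
        qed
        have le: "nat d2 \<le> B" "nat (- d2) \<le> B" using d2(3) unfolding sat_def by linarith+
        have le': "as aCP ?id \<le> M" "as aCN ?id \<le> M" using wle wtj by linarith+
        have 1: "nat d2 + as aCP ?id \<le> V" "nat (- d2) + as aCN ?id \<le> V"
          using le le' small_le_V(11) by linarith+
        have 2: "min (nat d2 + as aCP ?id - (nat (- d2) + as aCN ?id)) B = nat (clamp B (d2 + c ?id))"
          "min (nat (- d2) + as aCN ?id - (nat d2 + as aCP ?id)) B = nat (- clamp B (d2 + c ?id))"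
          unfolding clamp_def c_def by linarith+
        have "I (Suc j) (vs2(vxx := nat d2 + as aCP ?id, vyy := nat (- d2) + as aCN ?id,
            vx := nat (clamp B (d2 + c ?id)), vy := nat (- clamp B (d2 + c ?id)), vpr := ?id, vj := Suc j)) as2"
          unfolding I_def
        proof (intro conjI exI)
          show "sat B (wt (Suc j)) (\<tau> * 2 ^ nat (e ?pr - e ?id) + c ?id) (clamp B (d2 + c ?id))" by (fact s3)
          show "\<forall>i<Suc j. 0 \<le> e (ord i) \<longrightarrow> e ((vs2(vxx := nat d2 + as aCP ?id, vyy := nat (- d2) + as aCN ?id,
            vx := nat (clamp B (d2 + c ?id)), vy := nat (- clamp B (d2 + c ?id)), vpr := ?id, vj := Suc j)) vpr) \<le> e (ord i)"
            using pD(9) j by (auto simp: ord_def N_def)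
          show "\<forall>i. Suc j \<le> i \<longrightarrow> i < N \<longrightarrow> e (ord i) \<le> e ((vs2(vxx := nat d2 + as aCP ?id, vyy := nat (- d2) + as aCN ?id,
            vx := nat (clamp B (d2 + c ?id)), vy := nat (- clamp B (d2 + c ?id)), vpr := ?id, vj := Suc j)) vpr)"
            using pD(9) by (auto simp: ord_def N_def)
        qed (use as2 fr2 fr id True val in auto)
        then show "wp add_coeff_sat (\<lambda>vs'' as''. vs'' vj = j \<and> I (Suc j) (vs''(vj := Suc j)) as'') vs2 as2"
          using 1 2 j fr2 fr pD(3) by (simp add: add_coeff_sat_def d2 as2)
      qed
      then show ?thesis using D0' by (simp add: top_down_body_def ord_def[symmetric] as j(2))
    qed
  qed
  have "wp (For 2 vj (Var vN) top_down_body) (\<lambda>vs' as'. \<exists>d. vs' vx = nat d \<and> vs' vy = nat (- d) \<and> sat B M (T N) d)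
        (vs(vx := 0, vy := 0, vpr := ord 0)) as"
  proof (rule wp_For[where c = N and I = I, OF _ _ _ _ init step])
    show "N \<le> \<beta> ^ 2" "N \<le> V" using pD(5) small_le_V(8) loop_bounds(1) unfolding N_def by (simp, linarith)
    fix vs' as' assume "I N vs' as'"
    then obtain d \<tau> where d: "vs' vx = nat d" "vs' vy = nat (- d)" "sat B (wt N) \<tau> d"
      "\<tau> * 2 ^ nat (e (vs' vpr)) = T N" and pr: "0 \<le> e (vs' vpr)"
      "\<And>i. i < N \<Longrightarrow> 0 \<le> e (ord i) \<Longrightarrow> e (vs' vpr) \<le> e (ord i)" by (auto simp: I_def)
    \<comment> \<open>Power number 0 was visited, so the last unit \<open>2 ^ e pr\<close> is 1 and
      \<open>\<tau>\<close> is the whole sum.\<close>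
    from pD(14)[OF pD(4)] obtain i where "i < N" "ord i = 0" by (auto simp: N_def ord_def)
    with pr pD(6) have "e (vs' vpr) = 0" by fastforce
    with d have "sat B (wt N) (T N) d" by simp
    then have "sat B M (T N) d" by (rule sat_mono) (use wtN in simp)
    with d show "\<exists>d. vs' vx = nat d \<and> vs' vy = nat (- d) \<and> sat B M (T N) d" by blast
  qed (auto simp: N_def)
  moreover have "(\<Sum>i | i < vs vN \<and> 0 \<le> e i. (int (as aCP i) - int (as aCN i)) * 2 ^ nat (e i)) = T N"
    unfolding TN unfolding N_def c_def ..
  ultimately show ?thesis unfolding top_down_def by (simp add: ord_def)
qed

end

section \<open>The pass from below\<close>

lemma int_dvd_powi:
  assumes "\<not> (2 :: int) ^ nat \<gamma> dvd u" "0 \<le> \<gamma>"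
  shows "real_of_int u / 2 powi \<gamma> \<notin> \<int>"
proof
  assume "real_of_int u / 2 powi \<gamma> \<in> \<int>"
  then obtain z where "real_of_int u / 2 powi \<gamma> = of_int z" by (auto elim: Ints_cases)
  moreover have "(2 :: real) powi \<gamma> = 2 ^ nat \<gamma>" using assms(2) by (simp add: power_int_def)
  ultimately have "real_of_int u = of_int (z * 2 ^ nat \<gamma>)" by (simp add: field_simps)
  then have "u = z * 2 ^ nat \<gamma>" by (simp only: of_int_eq_iff)
  with assms(1) show False by simp
qed

context solver
begin

text \<open>Once the flag is set, \<open>u'\<close> has been rounded and only its size matters,
  hence the bound by \<open>\<bar>u\<bar>\<close> in every case.\<close>

definition halved :: "int \<Rightarrow> nat \<Rightarrow> int \<Rightarrow> vars \<Rightarrow> arrs \<Rightarrow> bool" where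
  "halved u F \<gamma> vs as \<longleftrightarrow> (\<exists>u'. vs vux = nat u' \<and> vs vuy = nat (- u') \<and> \<bar>u'\<bar> \<le> \<bar>u\<bar> \<and> vs vF \<le> 1 \<and>
    (F = 1 \<longrightarrow> vs vF = 1) \<and>
    (F = 0 \<longrightarrow> (if vs vF = 0 then u = u' * 2 ^ nat \<gamma> else \<not> 2 ^ nat \<gamma> dvd u)))"

lemma wp_halve_com:
  assumes p: "powers e vs as" and id: "vs vid < vs vN" "vs vpr < vs vN" "e (vs vpr) \<le> e (vs vid)"
    and u: "vs vux = nat u" "vs vuy = nat (- u)" "\<bar>u\<bar> \<le> int M" "vs vF \<le> 1"
  shows "wp halve_com (halved u (vs vF) (e (vs vid) - e (vs vpr))) vs as"
proof -
  note pD = powersD[OF p]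
  define \<gamma> where "\<gamma> = e (vs vid) - e (vs vpr)"
  define g where "g = nat (min (int G) \<gamma>)"
  have \<gamma>: "0 \<le> \<gamma>" using id by (simp add: \<gamma>_def)
  let ?e = "Arr aD (Plus (Arr aROW (Var vid)) (Var vpr))"
  have N: "vs vN < S" by (fact pD)
  have e: "safe ?e vs as" "aval ?e vs as = g" "g \<le> G"
    using pD(10)[OF id(1,2)] pD(12)[of "vs vid"] id N row_le_V[of "vs vid" "vs vpr"]
    by (auto simp: g_def \<gamma>_def)
  define I where "I i vs' as' \<longleftrightarrow> as' = as \<and> vs' vF \<le> 1 \<and> (vs vF = 1 \<longrightarrow> vs' vF = 1) \<and>
    (\<exists>u'. vs' vux = nat u' \<and> vs' vuy = nat (- u') \<and> \<bar>u'\<bar> \<le> \<bar>u\<bar> \<and>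
      (vs vF = 0 \<longrightarrow> (if vs' vF = 0 then u = u' * 2 ^ i else \<not> 2 ^ i dvd u)))"
    for i and vs' and as' :: arrs
  show ?thesis unfolding halve_com_def
  proof (rule wp_Rep[where I = I])
    show "aval ?e vs as \<le> \<beta> ^ 1" using e loop_bounds(2) by simp
    show "I 0 vs as" using u by (auto simp: I_def intro!: exI[of _ u])
  next
    fix i vs' as' assume "I i vs' as'"
    then obtain u' where as: "as' = as" and F: "vs' vF \<le> 1" "vs vF = 1 \<Longrightarrow> vs' vF = 1"
      and u': "vs' vux = nat u'" "vs' vuy = nat (- u')" "\<bar>u'\<bar> \<le> \<bar>u\<bar>"
      and i: "vs vF = 0 \<Longrightarrow> (if vs' vF = 0 then u = u' * 2 ^ i else \<not> 2 ^ i dvd u)"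
      by (auto simp: I_def)
    have H: "as aH (nat u') = nat u' div 2" "as aH (nat (- u')) = nat (- u') div 2"
      using u(3) u'(3) by (intro pD(13); linarith)+
    \<comment> \<open>Halving both parts of the pair amounts to rounding towards 0.\<close>
    define w where "w = (if 0 \<le> u' then u' div 2 else - (- u' div 2))"
    have w: "nat u' div 2 = nat w" "nat (- u') div 2 = nat (- w)" "\<bar>w\<bar> \<le> \<bar>u'\<bar>"
      unfolding w_def by (auto simp: nat_div_distrib)
    have par: "nat u' - nat u' div 2 - nat u' div 2 + (nat (- u') - nat (- u') div 2 - nat (- u') div 2)
        = (if even u' then 0 else 1)"
    proof -
      have *: "k - k div 2 - k div 2 = (if even k then 0 else 1)" for k :: nat by presburger
      show ?thesis unfolding * by (cases "0 \<le> u'") (auto simp: even_nat_iff)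
    qed
    then have par: "nat u' - (nat w + nat w) + (nat (- u') - (nat (- w) + nat (- w))) = (if even u' then 0 else 1)"
      by (simp add: w(1,2))
    have par2: "nat u' \<le> nat w + nat w \<and> nat (- u') \<le> nat (- w) + nat (- w) \<longleftrightarrow> even u'"
    proof
      assume "nat u' \<le> nat w + nat w \<and> nat (- u') \<le> nat (- w) + nat (- w)"
      then show "even u'" using par by (auto split: if_splits)
    next
      assume "even u'"
      then show "nat u' \<le> nat w + nat w \<and> nat (- u') \<le> nat (- w) + nat (- w)" using par by simp
    qed
    have even_w: "even u' \<Longrightarrow> u' = 2 * w" unfolding w_def by auto
    have odd: "\<not> 2 ^ Suc i dvd u" if "odd u'" "vs vF = 0" "vs' vF = 0"
    proof
      assume "2 ^ Suc i dvd u"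
      with i that have "(2 :: int) ^ i * 2 dvd 2 ^ i * u'" by (simp add: mult.commute)
      then have "2 dvd u'" by (simp only: dvd_mult_cancel_left) simp
      with that show False by simp
    qed
    have not_dvd: "\<not> 2 ^ Suc i dvd u" if "\<not> 2 ^ i dvd u"
      using that by (meson dvd_trans le_imp_power_dvd le_SucI order_refl)
    have F': "vs' vF = 0 \<or> vs' vF = 1" using F(1) by linarith
    have "I (Suc i) (vs'(vF := (if even u' then vs' vF else 1), vux := nat w, vuy := nat (- w))) as"
      unfolding I_def using F F' i odd not_dvd even_w w u'(3)
      by (auto intro!: exI[of _ w])
    moreover have "vs'(vF := vs' vF) = vs'" by simp
    ultimately show "wp (Cond (Plus (Minus (Minus (Var vux) (Arr aH (Var vux))) (Arr aH (Var vux)))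
          (Minus (Minus (Var vuy) (Arr aH (Var vuy))) (Arr aH (Var vuy)))) (vF ::= Num 1) Nop ;;
      vux ::= Arr aH (Var vux) ;; vuy ::= Arr aH (Var vuy)) (I (Suc i)) vs' as'"
      using V(2) H par2 by (cases "even u'") (auto simp: as u' par w simp del: fun_upd_triv)
  next
    fix vs' as' assume "I (aval ?e vs as) vs' as'"
    then obtain u' where F: "vs' vF \<le> 1" "vs vF = 1 \<Longrightarrow> vs' vF = 1"
      and u': "vs' vux = nat u'" "vs' vuy = nat (- u')" "\<bar>u'\<bar> \<le> \<bar>u\<bar>"
      and i: "vs vF = 0 \<Longrightarrow> (if vs' vF = 0 then u = u' * 2 ^ g else \<not> 2 ^ g dvd u)"
      using e by (auto simp: I_def)
    \<comment> \<open>For a gap beyond \<open>G\<close> the \<open>G\<close> halvings decide: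
      without a flag \<open>2^G\<close> divides \<open>u\<close>, and
      \<open>\<bar>u\<bar> \<le> M < 2^G\<close> forces \<open>u = 0\<close>; with a flag already
      \<open>2^G\<close> does not divide \<open>u\<close>.\<close>
    have "if vs' vF = 0 then u = u' * 2 ^ nat \<gamma> else \<not> 2 ^ nat \<gamma> dvd u" if "vs vF = 0"
    proof (cases "\<gamma> \<le> int G")
      case True
      then have "g = nat \<gamma>" by (simp add: g_def)
      with i that show ?thesis by auto
    next
      case False
      then have g: "g = G" "G \<le> nat \<gamma>" by (auto simp: g_def)
      show ?thesis
      proof (cases "vs' vF = 0")
        case True
        with i that g have eq: "u = u' * 2 ^ G" by simp
        have "int M \<le> int B" "int B < 2 ^ G" using B_less_int small_le_V(3) by simp_all
        with u(3) have "\<bar>u\<bar> < 2 ^ G" by linarith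
        with eq have "\<bar>u'\<bar> < 1" by (simp add: abs_mult)
        with eq True show ?thesis by simp
      next
        case False
        with i that g have "\<not> 2 ^ G dvd u" by simp
        with g False show ?thesis by (meson dvd_trans le_imp_power_dvd)
      qed
    qed
    with F u' show "halved u (vs vF) (e (vs vid) - e (vs vpr)) vs' as'"
      by (auto simp: halved_def \<gamma>_def)
  qed (use e in auto)
qed

lemma wp_bottom_up:
  assumes p: "powers e vs as" and w: "(\<Sum>i<vs vN. as aCP i + as aCN i) \<le> M"
  shows "wp bottom_up (\<lambda>vs' as'. \<exists>u. vs' vux = nat u \<and> vs' vuy = nat (- u) \<and> \<bar>u\<bar> \<le> int M \<and> vs' vF \<le> 1 \<and>
    (if vs' vF = 0
     then (\<Sum>i | i < vs vN \<and> e i < 0. (real (as aCP i) - real (as aCN i)) * 2 powi e i) = of_int u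
     else (\<Sum>i | i < vs vN \<and> e i < 0. (real (as aCP i) - real (as aCN i)) * 2 powi e i) \<notin> \<int>)) vs as"
proof -
  note pD = powersD[OF p]
  define N where "N = vs vN"
  define ord where "ord i = as aORD (N - 1 - i)" for i
  define c where "c i = int (as aCP i) - int (as aCN i)" for i
  define wt where "wt j = (\<Sum>i<j. as aCP (ord i) + as aCN (ord i))" for j
  define T :: "nat \<Rightarrow> real" where
    "T j = (\<Sum>i<j. if e (ord i) < 0 then of_int (c (ord i)) * 2 powi e (ord i) else 0)" for j
  have N0: "0 < N" "N < S" using pD by (auto simp: N_def)
  have "bij_betw (\<lambda>i. N - 1 - i) {..<N} {..<N}"
    by (rule bij_betw_byWitness[where f' = "\<lambda>i. N - 1 - i"]) auto
  from bij_betw_trans[OF this] have bij: "bij_betw ord {..<N} {..<N}"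
    using pD(7) by (simp add: N_def ord_def[abs_def] comp_def)
  have ord_less: "i < N \<Longrightarrow> ord i < N" for i using bij by (auto simp: bij_betw_def)
  have sorted: "i \<le> j \<Longrightarrow> j < N \<Longrightarrow> e (ord i) \<le> e (ord j)" for i j
    unfolding ord_def by (rule pD(9)) (auto simp: N_def[symmetric])
  have wtN: "wt N \<le> M"
    using w sum.reindex_bij_betw[OF bij, of "\<lambda>i. as aCP i + as aCN i"] by (simp add: wt_def N_def)
  have wt_mono: "j \<le> N \<Longrightarrow> wt j \<le> wt N" for j unfolding wt_def by (intro sum_mono2) auto
  have TN: "T N = (\<Sum>i | i < vs vN \<and> e i < 0. (real (as aCP i) - real (as aCN i)) * 2 powi e i)"
  proof -
    have "T N = (\<Sum>i<N. if e i < 0 then of_int (c i) * 2 powi e i else 0)"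
      unfolding T_def by (rule sum.reindex_bij_betw[OF bij])
    also have "\<dots> = (\<Sum>i | i < N \<and> e i < 0. of_int (c i) * 2 powi e i)"
      by (simp add: sum.If_cases Int_def lessThan_def)
    finally show ?thesis by (simp add: N_def c_def)
  qed
  \<comment> \<open>A flagged sum needs a certificate that later terms cannot repair: an exponent
    \<open>q\<close> no larger than any remaining negative one such that the sum is not a multiple
    of \<open>2^q\<close>. Every later term is such a multiple.\<close>
  define J where "J j pr F u \<longleftrightarrow> (if F = 0 then of_int u * 2 powi e pr = T j
      else \<exists>q\<le>0. (\<forall>i. j \<le> i \<longrightarrow> i < N \<longrightarrow> e (ord i) < 0 \<longrightarrow> q \<le> e (ord i)) \<and> T j * 2 powi (- q) \<notin> \<int>)"
    for j pr u and F :: nat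
  define I where "I j vs' as' \<longleftrightarrow> as' = as \<and> (\<forall>v. v \<notin> mod_vars bottom_up \<longrightarrow> vs' v = vs v) \<and>
      vs' vpr < N \<and> e (vs' vpr) \<le> 0 \<and> vs' vF \<le> 1 \<and>
      (\<forall>i. j \<le> i \<longrightarrow> i < N \<longrightarrow> e (vs' vpr) \<le> e (ord i)) \<and>
      (\<exists>u. vs' vux = nat u \<and> vs' vuy = nat (- u) \<and> \<bar>u\<bar> \<le> int (wt j) \<and> J j (vs' vpr) (vs' vF) u)"
    for j vs' and as' :: arrs
  have init: "I 0 (vs(vF := 0, vux := 0, vuy := 0, vpr := ord 0, vj := 0)) as"
  proof -
    from pD(14)[OF pD(4)] obtain i where "i < N" "as aORD i = 0" by (auto simp: N_def)
    with pD(6) pD(9)[of i "N - 1"] have "e (ord 0) \<le> 0" by (simp add: N_def ord_def)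
    then show ?thesis using ord_less N0 sorted unfolding I_def J_def
      by (auto simp: T_def wt_def intro!: exI[of _ 0])
  qed
  have step: "wp bottom_up_body (\<lambda>vs'' as''. vs'' vj = j \<and> I (Suc j) (vs''(vj := Suc j)) as'') vs' as'"
    if j: "j < N" "vs' vj = j" and I: "I j vs' as'" for j vs' as'
  proof -
    let ?id = "ord j" and ?pr = "vs' vpr"
    have as: "as' = as" and fr: "\<And>v. v \<notin> mod_vars bottom_up \<Longrightarrow> vs' v = vs v"
      and pr: "?pr < N" "e ?pr \<le> 0" "\<And>i. j \<le> i \<Longrightarrow> i < N \<Longrightarrow> e ?pr \<le> e (ord i)"
      and F: "vs' vF \<le> 1"
      using I by (auto simp: I_def)
    obtain u where u: "vs' vux = nat u" "vs' vuy = nat (- u)" "\<bar>u\<bar> \<le> int (wt j)" "J j ?pr (vs' vF) u"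
      using I by (auto simp: I_def)
    have id: "?id < N" using ord_less j by simp
    have wtj: "wt (Suc j) = wt j + (as aCP ?id + as aCN ?id)" by (simp add: wt_def)
    have wle: "wt (Suc j) \<le> M" using wt_mono[of "Suc j"] wtN j by simp
    have idx: "as aORD (vs vN - Suc j) = ?id" by (simp add: ord_def N_def)
    have "as aD ?id = nat (min (int G) (- e ?id))" using pD(11) id by (simp add: N_def)
    then have D0: "as aD ?id \<noteq> 0 \<longleftrightarrow> e ?id < 0" by (auto simp: G_def)
    show ?thesis
    proof (cases "e ?id < 0")
      case False
      have "I (Suc j) (vs'(vid := ?id, vj := Suc j)) as"
      proof -
        have "T (Suc j) = T j" using False by (simp add: T_def)
        then have "J (Suc j) ?pr (vs' vF) u" using u(4) unfolding J_def by (auto split: if_splits)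
        moreover have "\<bar>u\<bar> \<le> int (wt (Suc j))" using u(3) wtj by simp
        ultimately show ?thesis using I u by (auto simp: I_def)
      qed
      with D0 False show ?thesis using j as fr V(2) by (simp add: bottom_up_body_def idx)
    next
      case True
      let ?vs = "vs'(vid := ?id)"
      have p': "powers e ?vs as" using p fr unfolding powers_def by simp
      have "wp halve_com (halved u (vs' vF) (e ?id - e ?pr)) ?vs as"
        using wp_halve_com[OF p', of u] id pr(1) pr(3)[of j] j u F wle wtj fr by (simp add: N_def)
      then have "wp halve_com (wp add_coeff (\<lambda>vs'' as''. vs'' vj = j \<and> I (Suc j) (vs''(vj := Suc j)) as'')) ?vs as"
      proof (rule wp_conseq)
        fix vs2 as2 assume un: "unchanged halve_com ?vs as vs2 as2"
          and "halved u (vs' vF) (e ?id - e ?pr) vs2 as2"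
        then obtain u' where u': "vs2 vux = nat u'" "vs2 vuy = nat (- u')" "\<bar>u'\<bar> \<le> \<bar>u\<bar>" and F2: "vs2 vF \<le> 1"
          "vs' vF = 1 \<Longrightarrow> vs2 vF = 1"
          and val: "vs' vF = 0 \<Longrightarrow> (if vs2 vF = 0 then u = u' * 2 ^ nat (e ?id - e ?pr)
              else \<not> 2 ^ nat (e ?id - e ?pr) dvd u)"
          by (auto simp: halved_def)
        have as2: "as2 = as" and fr2: "\<And>v. v \<notin> {vF, vux, vuy} \<Longrightarrow> vs2 v = ?vs v"
          using un by (auto simp: unchanged_def)
        have gap: "0 \<le> e ?id - e ?pr" using pr(3)[of j] j by simp
        have T: "T (Suc j) = T j + of_int (c ?id) * 2 powi e ?id" using True by (simp add: T_def)
        have Tj: "T j = of_int u * 2 powi e ?pr" if "vs' vF = 0" using u(4) that by (simp add: J_def)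
        have J: "J (Suc j) ?id (vs2 vF) (u' + c ?id)"
        proof (cases "vs2 vF = 0")
          case F20: True
          then have F0: "vs' vF = 0" using F F2(2) by (cases "vs' vF = 0") auto
          with val F20 have "u = u' * 2 ^ nat (e ?id - e ?pr)" by simp
          then have "of_int u = of_int u' * (2 :: real) powi (e ?id - e ?pr)"
            using gap by (simp add: power_int_def)
          then have "T j = of_int u' * 2 powi e ?id"
            using Tj[OF F0] by (simp add: power_int_diff)
          then show ?thesis using F20 T by (simp add: J_def algebra_simps)
        next
          case F21: False
          have "\<exists>q\<le>0. (\<forall>i. j \<le> i \<longrightarrow> i < N \<longrightarrow> e (ord i) < 0 \<longrightarrow> q \<le> e (ord i)) \<and> T j * 2 powi (- q) \<notin> \<int>"
          proof (cases "vs' vF = 0")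
            case True
            \<comment> \<open>The halvings that failed end at the exponent of the current power,
              which becomes \<open>q\<close>.\<close>
            with val F21 have nd: "\<not> 2 ^ nat (e ?id - e ?pr) dvd u" by simp
            have "T j * 2 powi (- e ?id) = of_int u / 2 powi (e ?id - e ?pr)"
              using Tj[OF True] by (simp add: power_int_diff power_int_minus divide_simps)
            with int_dvd_powi[OF nd gap] have "T j * 2 powi (- e ?id) \<notin> \<int>" by simp
            then show ?thesis using \<open>e ?id < 0\<close> sorted by (intro exI[of _ "e ?id"]) auto
          next
            case False
            with u(4) show ?thesis by (simp add: J_def)
          qed
          then obtain q where q: "q \<le> 0" "\<And>i. j \<le> i \<Longrightarrow> i < N \<Longrightarrow> e (ord i) < 0 \<Longrightarrow> q \<le> e (ord i)"
            "T j * 2 powi (- q) \<notin> \<int>" by blast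
          have qid: "q \<le> e ?id" using q(2)[of j] j True by simp
          have "T (Suc j) * 2 powi (- q) = T j * 2 powi (- q) + of_int (c ?id) * 2 powi (e ?id - q)"
            unfolding T by (simp add: algebra_simps power_int_diff power_int_minus divide_simps)
          moreover have "of_int (c ?id) * (2 :: real) powi (e ?id - q) \<in> \<int>"
            using qid by (simp add: power_int_def)
          ultimately have "T (Suc j) * 2 powi (- q) \<notin> \<int>" using q(3) by (simp add: add_in_Ints_iff_right)
          then show ?thesis using F21 q(1,2) unfolding J_def by (auto intro!: exI[of _ q])
        qed
        have le: "nat u' \<le> M" "nat (- u') \<le> M" "as aCP ?id \<le> M" "as aCN ?id \<le> M"
          using u'(3) u(3) wle wtj by linarith+
        have 1: "nat u' + as aCP ?id \<le> V" "nat (- u') + as aCN ?id \<le> V"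
          using le small_le_V(7) by linarith+
        have 2: "nat u' + as aCP ?id - (nat (- u') + as aCN ?id) = nat (u' + c ?id)"
          "nat (- u') + as aCN ?id - (nat u' + as aCP ?id) = nat (- (u' + c ?id))"
          unfolding c_def by linarith+
        have 3: "\<bar>u' + c ?id\<bar> \<le> int (wt (Suc j))" using u'(3) u(3) unfolding wtj c_def by linarith
        have "I (Suc j) (vs2(vxx := nat u' + as aCP ?id, vyy := nat (- u') + as aCN ?id,
            vux := nat (u' + c ?id), vuy := nat (- (u' + c ?id)), vpr := ?id, vj := Suc j)) as2"
          unfolding I_def
        proof (intro conjI exI)
          show "\<forall>i. Suc j \<le> i \<longrightarrow> i < N \<longrightarrow> e ((vs2(vxx := nat u' + as aCP ?id, vyy := nat (- u') + as aCN ?id,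
            vux := nat (u' + c ?id), vuy := nat (- (u' + c ?id)), vpr := ?id, vj := Suc j)) vpr) \<le> e (ord i)"
            using sorted by auto
        qed (use as2 fr2 fr id True J F2(1) 3 in auto)
        then show "wp add_coeff (\<lambda>vs'' as''. vs'' vj = j \<and> I (Suc j) (vs''(vj := Suc j)) as'') vs2 as2"
          using 1 2 j fr2 fr by (simp add: add_coeff_def u' as2)
      qed
      then show ?thesis using D0 True j fr as V(2) by (simp add: bottom_up_body_def idx)
    qed
  qed
  let ?Q = "\<lambda>vs' as'. \<exists>u. vs' vux = nat u \<and> vs' vuy = nat (- u) \<and> \<bar>u\<bar> \<le> int M \<and> vs' vF \<le> 1 \<and>
      (if vs' vF = 0 then T N = of_int u else T N \<notin> \<int>)"
  have "wp (For 2 vj (Var vN) bottom_up_body) (wp (vid ::= Num 0 ;; halve_com) ?Q) (vs(vF := 0, vux := 0, vuy := 0, vpr := ord 0)) as"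
  proof (rule wp_For[where c = N and I = I, OF _ _ _ _ init step])
    show "N \<le> \<beta> ^ 2" using N0 loop_bounds(1) by simp
    show "N \<le> V" using N0 small_le_V(8) by linarith
    fix vs' as' assume I: "I N vs' as'"
    then obtain u where u: "vs' vux = nat u" "vs' vuy = nat (- u)" "\<bar>u\<bar> \<le> int (wt N)" "J N (vs' vpr) (vs' vF) u"
      by (auto simp: I_def)
    have as: "as' = as" and fr: "\<And>v. v \<notin> mod_vars bottom_up \<Longrightarrow> vs' v = vs v"
      and pr: "vs' vpr < N" "e (vs' vpr) \<le> 0" and F: "vs' vF \<le> 1" using I by (auto simp: I_def)
    let ?vs = "vs'(vid := 0)"
    have p': "powers e ?vs as" using p fr unfolding powers_def by simp
    have "wp halve_com (halved u (vs' vF) (- e (vs' vpr))) ?vs as"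
      using wp_halve_com[OF p', of u] N0 pr u F wtN fr pD(6) by (simp add: N_def)
    then have "wp halve_com ?Q ?vs as"
    proof (rule wp_mono)
      fix vs2 as2 assume "halved u (vs' vF) (- e (vs' vpr)) vs2 as2"
      then obtain u' where u': "vs2 vux = nat u'" "vs2 vuy = nat (- u')" "\<bar>u'\<bar> \<le> \<bar>u\<bar>" and F2: "vs2 vF \<le> 1"
        "vs' vF = 1 \<Longrightarrow> vs2 vF = 1"
        and val: "vs' vF = 0 \<Longrightarrow> (if vs2 vF = 0 then u = u' * 2 ^ nat (- e (vs' vpr))
              else \<not> 2 ^ nat (- e (vs' vpr)) dvd u)"
        by (auto simp: halved_def)
      have Tj: "T N = of_int u / 2 powi (- e (vs' vpr))" if "vs' vF = 0"
        using u(4) that by (simp add: J_def power_int_minus divide_simps)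
      have "if vs2 vF = 0 then T N = of_int u' else T N \<notin> \<int>"
      proof (cases "vs2 vF = 0")
        case True
        then have F0: "vs' vF = 0" using F F2(2) by (cases "vs' vF = 0") auto
        with val True have "u = u' * 2 ^ nat (- e (vs' vpr))" by simp
        then have "of_int u = of_int u' * (2 :: real) powi (- e (vs' vpr))"
          using pr(2) by (simp add: power_int_def)
        then show ?thesis using Tj[OF F0] True by simp
      next
        case F21: False
        have "T N \<notin> \<int>"
        proof (cases "vs' vF = 0")
          case True
          with val F21 have nd: "\<not> 2 ^ nat (- e (vs' vpr)) dvd u" by simp
          from int_dvd_powi[OF nd] pr(2) Tj[OF True] show ?thesis by simp
        next
          case False
          with u(4) obtain q where q: "q \<le> 0" "T N * 2 powi (- q) \<notin> \<int>" by (auto simp: J_def)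
          have "(2 :: real) powi (- q) \<in> \<int>" using q(1) by (simp add: power_int_def)
          with q(2) show ?thesis using Ints_mult by blast
        qed
        with F21 show ?thesis by simp
      qed
      moreover have "\<bar>u'\<bar> \<le> int M" using u'(3) u(3) wtN by linarith
      ultimately show "\<exists>u. vs2 vux = nat u \<and> vs2 vuy = nat (- u) \<and> \<bar>u\<bar> \<le> int M \<and> vs2 vF \<le> 1 \<and>
        (if vs2 vF = 0 then T N = of_int u else T N \<notin> \<int>)" using u' F2(1) by blast
    qed
    then show "wp (vid ::= Num 0 ;; halve_com) ?Q vs' as'"
      by (simp add: as)
  qed (auto simp: N_def)
  moreover have "as aORD (vs vN - Suc 0) = ord 0" by (simp add: ord_def N_def)
  ultimately show ?thesis unfolding bottom_up_def TN[symmetric] using V(2) by simp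
qed

text \<open>Nonnegative exponents contribute an integer \<open>t\<close>, known up to saturation,
  negative ones a number \<open>s\<close>, known exactly if integral. So \<open>s\<close> decides
  integrality, and \<open>sat_final\<close> gives the cut-off of \<open>t + s\<close>.\<close>

lemma wp_eval_coeffs:
  assumes p: "powers e vs as" and w: "(\<Sum>i<vs vN. as aCP i + as aCN i) \<le> M"
  defines "v \<equiv> \<Sum>i<vs vN. (real (as aCP i) - real (as aCN i)) * 2 powi e i"
  shows "wp eval_coeffs (\<lambda>vs' as'. vs' vF \<le> 1 \<and> vs' vOX \<le> G \<and> vs' vOY \<le> G \<and> (vs' vF = 0 \<longleftrightarrow> v \<in> \<int>) \<and>
    (v \<in> \<int> \<longrightarrow> vs' vOX = nat (min (int G) \<lfloor>v\<rfloor>) \<and> vs' vOY = nat (min (int G) (- \<lfloor>v\<rfloor>)))) vs as"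
proof -
  let ?Q = "\<lambda>vs' as'. vs' vF \<le> 1 \<and> vs' vOX \<le> G \<and> vs' vOY \<le> G \<and> (vs' vF = 0 \<longleftrightarrow> v \<in> \<int>) \<and>
    (v \<in> \<int> \<longrightarrow> vs' vOX = nat (min (int G) \<lfloor>v\<rfloor>) \<and> vs' vOY = nat (min (int G) (- \<lfloor>v\<rfloor>)))"
  let ?c = "\<lambda>i. int (as aCP i) - int (as aCN i)"
  define t where "t = (\<Sum>i | i < vs vN \<and> 0 \<le> e i. ?c i * 2 ^ nat (e i))"
  define s :: real where "s = (\<Sum>i | i < vs vN \<and> e i < 0. (real (as aCP i) - real (as aCN i)) * 2 powi e i)"
  have v: "v = of_int t + s"
  proof -
    have "of_int t = (\<Sum>i | i < vs vN \<and> 0 \<le> e i. (real (as aCP i) - real (as aCN i)) * 2 powi e i)"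
      unfolding t_def of_int_sum by (rule sum.cong) (auto simp: power_int_def)
    moreover have "{..<vs vN} = {i. i < vs vN \<and> 0 \<le> e i} \<union> {i. i < vs vN \<and> e i < 0}" by auto
    ultimately show ?thesis unfolding v_def s_def by (simp add: sum.union_disjoint[symmetric] disjoint_iff)
  qed
  show ?thesis unfolding eval_coeffs_def wp.simps(4)
  proof (rule wp_conseq[OF wp_top_down[OF p w]])
    fix vs1 as1 assume "\<exists>d. vs1 vx = nat d \<and> vs1 vy = nat (- d) \<and>
      sat B M (\<Sum>i | i < vs vN \<and> 0 \<le> e i. ?c i * 2 ^ nat (e i)) d" and un: "unchanged top_down vs as vs1 as1"
    then obtain d where d: "vs1 vx = nat d" "vs1 vy = nat (- d)" "sat B M t d" by (auto simp: t_def)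
    have as1: "as1 = as" and fr1: "\<And>v. v \<notin> {vx, vy, vpr, vj, vid, vxx, vyy} \<Longrightarrow> vs1 v = vs v"
      using un by (auto simp: unchanged_def)
    have p1: "powers e vs1 as1" using p fr1 unfolding powers_def as1 by simp
    have w1: "(\<Sum>i<vs1 vN. as1 aCP i + as1 aCN i) \<le> M" using w fr1 by (simp add: as1)
    show "wp bottom_up (wp (vxx ::= Plus (Var vx) (Var vux)) (wp (vyy ::= Plus (Var vy) (Var vuy))
      (wp (vOX ::= min_exp vG (Minus (Var vxx) (Var vyy))) (wp (vOY ::= min_exp vG (Minus (Var vyy) (Var vxx)))
      ?Q)))) vs1 as1"
    proof (rule wp_conseq[OF wp_bottom_up[OF p1 w1]])
      fix vs2 as2 assume un: "unchanged bottom_up vs1 as1 vs2 as2"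
        and ex: "\<exists>u. vs2 vux = nat u \<and> vs2 vuy = nat (- u) \<and> \<bar>u\<bar> \<le> int M \<and> vs2 vF \<le> 1 \<and>
        (if vs2 vF = 0
         then (\<Sum>i | i < vs1 vN \<and> e i < 0. (real (as1 aCP i) - real (as1 aCN i)) * 2 powi e i) = of_int u
         else (\<Sum>i | i < vs1 vN \<and> e i < 0. (real (as1 aCP i) - real (as1 aCN i)) * 2 powi e i) \<notin> \<int>)"
      have "vs1 vN = vs vN" using fr1 by simp
      with ex have "\<exists>u. vs2 vux = nat u \<and> vs2 vuy = nat (- u) \<and> \<bar>u\<bar> \<le> int M \<and> vs2 vF \<le> 1 \<and>
        (if vs2 vF = 0 then s = of_int u else s \<notin> \<int>)"
        unfolding s_def by (simp only: as1)
      then obtain u where u: "vs2 vux = nat u" "vs2 vuy = nat (- u)" "\<bar>u\<bar> \<le> int M" and F: "vs2 vF \<le> 1"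
        "if vs2 vF = 0 then s = of_int u else s \<notin> \<int>"
        by blast
      have as2: "as2 = as" and fr2: "\<And>v. v \<notin> {vF, vux, vuy, vpr, vj, vid, vxx, vyy} \<Longrightarrow> vs2 v = vs1 v"
        using un by (auto simp: unchanged_def as1)
      have le: "nat d \<le> B" "nat (- d) \<le> B" "nat u \<le> M" "nat (- u) \<le> M"
        using d(3) u(3) unfolding sat_def by linarith+
      have 1: "nat d + nat u \<le> V" "nat (- d) + nat (- u) \<le> V" using le small_le_V(11) by linarith+
      have vF: "vs2 vF = 0 \<longleftrightarrow> v \<in> \<int>" using F unfolding v by (auto split: if_splits)
      have out: "vs2 vF = 0 \<Longrightarrow> min (nat d + nat u - (nat (- d) + nat (- u))) G = nat (min (int G) \<lfloor>v\<rfloor>) \<and>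
          min (nat (- d) + nat (- u) - (nat d + nat u)) G = nat (min (int G) (- \<lfloor>v\<rfloor>))"
      proof -
        assume "vs2 vF = 0"
        then have fl: "\<lfloor>v\<rfloor> = t + u" using F(2) unfolding v by simp
        have "nat (min (int G) (d + u)) = nat (min (int G) (t + u)) \<and>
            nat (min (int G) (- (d + u))) = nat (min (int G) (- (t + u)))"
          using d(3) u(3) by (rule sat_final) (simp_all add: B_def)
        moreover have "min (nat d + nat u - (nat (- d) + nat (- u))) G = nat (min (int G) (d + u))"
          "min (nat (- d) + nat (- u) - (nat d + nat u)) G = nat (min (int G) (- (d + u)))"
          by linarith+
        ultimately show ?thesis unfolding fl by simp
      qed
      have vG: "vs2 vG = G" using fr2 fr1 powersD(2)[OF p] by simp
      show "wp (vxx ::= Plus (Var vx) (Var vux)) (wp (vyy ::= Plus (Var vy) (Var vuy))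
        (wp (vOX ::= min_exp vG (Minus (Var vxx) (Var vyy))) (wp (vOY ::= min_exp vG (Minus (Var vyy) (Var vxx)))
        ?Q))) vs2 as2"
        using 1 out vF F(1) fr2 by (simp add: u d vG)
    qed
  qed
qed

end

section \<open>Inserting a power of two\<close>

definition copy_row :: com where
  "copy_row = vnr ::= Arr aROW (Var vN) ;; vbr ::= Arr aROW (Var vbase) ;;
    For 2 vj (Var vN) (
      Write aEP (Plus (Var vnr) (Var vj)) (Arr aEP (Plus (Var vbr) (Var vj))) ;;
      Write aEN (Plus (Var vnr) (Var vj)) (Arr aEN (Plus (Var vbr) (Var vj))))"

text \<open>The two signs change places because the list is subtracted.\<close>

definition subtract_list :: com where
  "subtract_list =
    For 1 vq (Minus (Var vto) (Var vfrom)) (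
      vid ::= Arr aKI (Plus (Var vfrom) (Var vq)) ;; vsg ::= Arr aKS (Plus (Var vfrom) (Var vq)) ;;
      Write aEN (Plus (Var vnr) (Var vid)) (Plus (Arr aEN (Plus (Var vnr) (Var vid))) (Var vsg)) ;;
      Write aEP (Plus (Var vnr) (Var vid))
        (Plus (Arr aEP (Plus (Var vnr) (Var vid))) (Minus (Num 1) (Var vsg))))"

definition difference_coeffs :: com where
  "difference_coeffs = vor ::= Arr aROW (Var vjj) ;;
    For 2 vj (Var vN) (
      Write aCP (Var vj) (Plus (Arr aEP (Plus (Var vnr) (Var vj))) (Arr aEN (Plus (Var vor) (Var vj)))) ;;
      Write aCN (Var vj) (Plus (Arr aEN (Plus (Var vnr) (Var vj))) (Arr aEP (Plus (Var vor) (Var vj)))))"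

text \<open>\<open>vOX\<close> is 0 exactly if the old exponent is at least the new one, so
  \<open>vp\<close> counts the powers that precede the new one in the order.\<close>

definition compare_all :: com where
  "compare_all = vp ::= Num 0 ;;
    For 2 vjj (Var vN) (
      difference_coeffs ;; eval_coeffs ;;
      Write aD (Plus (Var vnr) (Var vjj)) (Var vOX) ;; Write aD (Plus (Var vor) (Var vN)) (Var vOY) ;;
      Cond (Var vOX) Nop (vp ::= Plus (Var vp) (Num 1)))"

text \<open>Shifting starts at the end, so no entry is overwritten before it has moved.\<close>

definition place_node :: com where
  "place_node =
    For 2 vj (Minus (Var vN) (Var vp))
      (Write aORD (Minus (Var vN) (Var vj)) (Arr aORD (Minus (Minus (Var vN) (Var vj)) (Num 1)))) ;;
    Write aORD (Var vp) (Var vN)"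

text \<open>
  Introduces the power \<open>2 ^ (e base - k)\<close>, where \<open>k\<close> is the value of the segment from \<open>from\<close> to
  \<open>to\<close> of the list of the \<open>t\<close>-exponents.
\<close>

definition new_power :: com where
  "new_power = copy_row ;; subtract_list ;; compare_all ;;
    Write aD (Plus (Var vnr) (Var vN)) (Num 0) ;; place_node ;; vN ::= Plus (Var vN) (Num 1)"

definition eval_list :: "nat \<Rightarrow> nat \<Rightarrow> com" where
  "eval_list kI kS =
    For 2 vj (Var vN) (Write aCP (Var vj) (Num 0) ;; Write aCN (Var vj) (Num 0)) ;;
    For 1 vq (Minus (Var vto) (Var vfrom)) (
      vid ::= Arr kI (Plus (Var vfrom) (Var vq)) ;; vsg ::= Arr kS (Plus (Var vfrom) (Var vq)) ;;
      Write aCP (Var vid) (Plus (Arr aCP (Var vid)) (Var vsg)) ;;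
      Write aCN (Var vid) (Plus (Arr aCN (Var vid)) (Minus (Num 1) (Var vsg)))) ;;
    eval_coeffs"

lemma new_power_mod:
  "mod_vars copy_row = {vnr, vbr, vj}" "mod_arrs copy_row = {aEP, aEN}"
  "mod_vars subtract_list = {vq, vid, vsg}" "mod_arrs subtract_list = {aEP, aEN}"
  "mod_vars difference_coeffs = {vor, vj}" "mod_arrs difference_coeffs = {aCP, aCN}"
  "mod_vars compare_all = {vp, vjj, vor} \<union> mod_vars eval_coeffs" "mod_arrs compare_all = {aD, aCP, aCN}"
  "mod_vars place_node = {vj}" "mod_arrs place_node = {aORD}"
  "mod_vars new_power = {vnr, vbr, vq, vsg, vp, vjj, vor, vN} \<union> mod_vars eval_coeffs"
  "mod_arrs new_power = {aEP, aEN, aD, aCP, aCN, aORD}"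
  "mod_vars (eval_list kI kS) = {vq, vsg} \<union> mod_vars eval_coeffs"
  "mod_arrs (eval_list kI kS) = {aCP, aCN}"
  by (rule equalityI; simp add: copy_row_def subtract_list_def difference_coeffs_def compare_all_def
      place_node_def new_power_def eval_list_def)+

lemma new_power_degree: "loop_degree new_power = 5" "loop_degree (eval_list kI kS) = 3"
  by (simp_all add: copy_row_def subtract_list_def difference_coeffs_def compare_all_def
      place_node_def new_power_def eval_list_def)

section \<open>Values of lists, matrix indices and the invariant of the coefficient rows\<close>

definition term_value :: "(nat \<Rightarrow> int) \<Rightarrow> (nat \<Rightarrow> nat) \<Rightarrow> (nat \<Rightarrow> nat) \<Rightarrow> nat \<Rightarrow> real" where
  "term_value e I s q = (real (s q) - real (1 - s q)) * 2 powi e (I q)"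

definition list_value :: "(nat \<Rightarrow> int) \<Rightarrow> (nat \<Rightarrow> nat) \<Rightarrow> (nat \<Rightarrow> nat) \<Rightarrow> nat \<Rightarrow> nat \<Rightarrow> real" where
  "list_value e I s a b = (\<Sum>q=a..<b. term_value e I s q)"

lemma list_value_Suc [simp]:
  "list_value e I s a (a + 0) = 0"
  "list_value e I s a (a + Suc q) = list_value e I s a (a + q) + term_value e I s (a + q)"
  by (simp_all add: list_value_def)

lemma sum_single_change:
  fixes f g :: "nat \<Rightarrow> 'a :: comm_monoid_add"
  assumes "k < N" "\<And>j. j < N \<Longrightarrow> f j = g j + (if j = k then d else 0)"
  shows "(\<Sum>j<N. f j) = (\<Sum>j<N. g j) + d"
proof -
  have "(\<Sum>j<N. f j) = (\<Sum>j<N. g j + (if j = k then d else 0))"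
    using assms(2) by (intro sum.cong) auto
  then show ?thesis using assms(1) by (simp add: sum.distrib)
qed

lemma row_index_eq:
  assumes "j < S" "j' < (S :: nat)"
  shows "i * S + j = i' * S + j' \<longleftrightarrow> i = i' \<and> j = j'"
proof
  assume eq: "i * S + j = i' * S + j'"
  have "j = (i * S + j) mod S" using assms(1) by simp
  also have "\<dots> = (i' * S + j') mod S" by (simp only: eq)
  also have "\<dots> = j'" using assms(2) by simp
  finally have "j = j'" .
  moreover from this eq assms have "i = i'" by simp
  ultimately show "i = i' \<and> j = j'" by simp
qed simp

lemma row_index_less: "i < N \<Longrightarrow> j < S \<Longrightarrow> i * S + j < N * (S :: nat)"
  using mult_le_mono1[of "Suc i" N S] by (simp del: mult_le_cancel2)

lemma down_closed_eq_lessThan: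
  fixes A :: "nat set"
  assumes "finite A" "\<And>i j. j \<in> A \<Longrightarrow> i \<le> j \<Longrightarrow> i \<in> A"
  shows "A = {..<card A}"
proof -
  define m where "m = (LEAST m. m \<notin> A)"
  have "\<exists>m. m \<notin> A" using assms(1) ex_new_if_finite infinite_UNIV_nat by blast
  then have "m \<notin> A" unfolding m_def by (rule LeastI_ex)
  moreover have "i \<in> A" if "i < m" for i using that not_less_Least unfolding m_def by blast
  ultimately have "A = {..<m}" using assms(2) by (metis lessThan_iff not_less subsetI subset_antisym)
  then show ?thesis by simp
qed

context solver
begin

text \<open>The bound \<open>n * i\<close> reproduces itself: a new row is the row of some
  \<open>base < N\<close> plus at most \<open>n\<close> terms. Zeros outside the leading block keep
  the old sums valid when \<open>N\<close> grows.\<close>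

definition exponents :: "(nat \<Rightarrow> int) \<Rightarrow> vars \<Rightarrow> arrs \<Rightarrow> bool" where
  "exponents e vs as \<longleftrightarrow>
    (\<forall>i<vs vN. (\<Sum>j<vs vN. (real (as aEP (i * S + j)) - real (as aEN (i * S + j))) * 2 powi e j) = e i) \<and>
    (\<forall>i<vs vN. (\<Sum>j<vs vN. as aEP (i * S + j) + as aEN (i * S + j)) \<le> n * i) \<and>
    (\<forall>i<S. \<forall>j<S. vs vN \<le> i \<or> vs vN \<le> j \<longrightarrow> as aEP (i * S + j) = 0 \<and> as aEN (i * S + j) = 0)"

lemma nN_le_M: "N < S \<Longrightarrow> 2 * (n * N) \<le> M"
  using mult_le_mono2[of N "n * n + 1" n] by (simp add: S_def M_def)

lemma wp_copy_row:
  assumes p: "powers e vs as" and b: "vs vbase < vs vN"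
  defines "N \<equiv> vs vN"
  shows "wp copy_row (\<lambda>vs' as'. vs' vnr = N * S \<and>
    (\<forall>j<N. as' aEP (N * S + j) = as aEP (vs vbase * S + j) \<and> as' aEN (N * S + j) = as aEN (vs vbase * S + j)) \<and>
    (\<forall>i. i < N * S \<or> N * S + N \<le> i \<longrightarrow> as' aEP i = as aEP i \<and> as' aEN i = as aEN i)) vs as"
proof -
  note pD = powersD[OF p]
  have N: "N < S" using pD(5) by (simp add: N_def)
  let ?vs = "vs(vnr := N * S, vbr := vs vbase * S)"
  have "wp (For 2 vj (Var vN) (
      Write aEP (Plus (Var vnr) (Var vj)) (Arr aEP (Plus (Var vbr) (Var vj))) ;;
      Write aEN (Plus (Var vnr) (Var vj)) (Arr aEN (Plus (Var vbr) (Var vj)))))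
    (\<lambda>vs' as'. vs' vnr = N * S \<and>
    (\<forall>j<N. as' aEP (N * S + j) = as aEP (vs vbase * S + j) \<and> as' aEN (N * S + j) = as aEN (vs vbase * S + j)) \<and>
    (\<forall>i. i < N * S \<or> N * S + N \<le> i \<longrightarrow> as' aEP i = as aEP i \<and> as' aEN i = as aEN i)) ?vs as"
  proof (rule wp_For[where c = N and I = "\<lambda>c vs' as'. vs' vnr = N * S \<and> vs' vbr = vs vbase * S \<and>
    (\<forall>j<c. as' aEP (N * S + j) = as aEP (vs vbase * S + j) \<and> as' aEN (N * S + j) = as aEN (vs vbase * S + j)) \<and>
    (\<forall>i. i < N * S \<or> N * S + c \<le> i \<longrightarrow> as' aEP i = as aEP i \<and> as' aEN i = as aEN i)"])
    show "N \<le> \<beta> ^ 2" using N loop_bounds(1) by simp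
    show "N \<le> V" using N small_le_V(8) by linarith
    fix j vs' as' assume j: "j < N" "vs' vj = j" and I: "vs' vnr = N * S \<and> vs' vbr = vs vbase * S \<and>
      (\<forall>k<j. as' aEP (N * S + k) = as aEP (vs vbase * S + k) \<and> as' aEN (N * S + k) = as aEN (vs vbase * S + k)) \<and>
      (\<forall>i. i < N * S \<or> N * S + j \<le> i \<longrightarrow> as' aEP i = as aEP i \<and> as' aEN i = as aEN i)"
    have "vs vbase * S + j < N * S" using b j N by (intro row_index_less) (auto simp: N_def)
    moreover have "N * S + j \<le> V" "vs vbase * S + j \<le> V"
      using j b N row_le_V[of N j] row_le_V[of "vs vbase" j] by (auto simp: N_def)
    ultimately show "wp (Write aEP (Plus (Var vnr) (Var vj)) (Arr aEP (Plus (Var vbr) (Var vj))) ;;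
        Write aEN (Plus (Var vnr) (Var vj)) (Arr aEN (Plus (Var vbr) (Var vj))))
      (\<lambda>vs'' as''. vs'' vj = j \<and> (vs''(vj := Suc j)) vnr = N * S \<and> (vs''(vj := Suc j)) vbr = vs vbase * S \<and>
      (\<forall>k<Suc j. as'' aEP (N * S + k) = as aEP (vs vbase * S + k) \<and> as'' aEN (N * S + k) = as aEN (vs vbase * S + k)) \<and>
      (\<forall>i. i < N * S \<or> N * S + Suc j \<le> i \<longrightarrow> as'' aEP i = as aEP i \<and> as'' aEN i = as aEN i)) vs' as'"
      using I j by (auto simp: less_Suc_eq)
  qed (auto simp: N_def)
  then show ?thesis
    using pD(12)[of N] pD(12)[of "vs vbase"] N b by (simp add: copy_row_def N_def)
qed

lemma wp_subtract_list:
  assumes nr: "vs vnr = vs vN * S" "vs vN < S" and f: "vs vfrom \<le> vs vto" "vs vto \<le> n"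
    and ids: "\<And>q. vs vfrom \<le> q \<Longrightarrow> q < vs vto \<Longrightarrow> as aKI q < vs vN \<and> as aKS q \<le> 1"
    and w: "(\<Sum>j<vs vN. as aEP (vs vN * S + j) + as aEN (vs vN * S + j)) + (vs vto - vs vfrom) \<le> M"
    and v: "(\<Sum>j<vs vN. (real (as aEP (vs vN * S + j)) - real (as aEN (vs vN * S + j))) * 2 powi e j) = v"
  defines "N \<equiv> vs vN"
  shows "wp subtract_list (\<lambda>vs' as'.
    (\<Sum>j<N. (real (as' aEP (N * S + j)) - real (as' aEN (N * S + j))) * 2 powi e j) =
      v - list_value e (as aKI) (as aKS) (vs vfrom) (vs vto) \<and>
    (\<Sum>j<N. as' aEP (N * S + j) + as' aEN (N * S + j)) =
      (\<Sum>j<N. as aEP (N * S + j) + as aEN (N * S + j)) + (vs vto - vs vfrom) \<and>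
    (\<forall>i. i < N * S \<or> N * S + N \<le> i \<longrightarrow> as' aEP i = as aEP i \<and> as' aEN i = as aEN i)) vs as"
proof -
  define I where "I q vs' as' \<longleftrightarrow> (\<forall>v. v \<notin> mod_vars subtract_list \<longrightarrow> vs' v = vs v) \<and>
    (\<forall>k. k \<notin> mod_arrs subtract_list \<longrightarrow> as' k = as k) \<and>
    (\<Sum>j<N. (real (as' aEP (N * S + j)) - real (as' aEN (N * S + j))) * 2 powi e j) =
      v - list_value e (as aKI) (as aKS) (vs vfrom) (vs vfrom + q) \<and>
    (\<Sum>j<N. as' aEP (N * S + j) + as' aEN (N * S + j)) =
      (\<Sum>j<N. as aEP (N * S + j) + as aEN (N * S + j)) + q \<and>
    (\<forall>i. i < N * S \<or> N * S + N \<le> i \<longrightarrow> as' aEP i = as aEP i \<and> as' aEN i = as aEN i)"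
    for q vs' and as' :: arrs
  show ?thesis unfolding subtract_list_def
  proof (rule wp_For[where c = "vs vto - vs vfrom" and I = I])
    show "vs vto - vs vfrom \<le> \<beta> ^ 1" using f loop_bounds(3)[of "vs vto - vs vfrom"] by simp
    show "vs vto - vs vfrom \<le> V" using f small_le_V(9) by linarith
    show "I 0 (vs(vq := 0)) as" using v list_value_Suc(1) by (simp add: I_def N_def new_power_mod)
  next
    fix q vs' as' assume q: "q < vs vto - vs vfrom" "vs' vq = q" and I: "I q vs' as'"
    have fr: "\<And>v. v \<notin> {vq, vid, vsg} \<Longrightarrow> vs' v = vs v" "\<And>k. k \<notin> {aEP, aEN} \<Longrightarrow> as' k = as k"
      using I by (auto simp: I_def new_power_mod)
    let ?q = "vs vfrom + q"
    define k s where "k = as aKI ?q" and "s = as aKS ?q"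
    have ks: "k < N" "s \<le> 1" using ids[of ?q] q by (auto simp: k_def s_def N_def)
    let ?EP = "(as' aEP)(N * S + k := as' aEP (N * S + k) + (1 - s))"
    let ?EN = "(as' aEN)(N * S + k := as' aEN (N * S + k) + s)"
    have iV: "N * S + k \<le> V" using row_le_V[of N k] ks nr by (simp add: N_def)
    have qV: "?q \<le> V" using q f small_le_V(9) by linarith
    have "as' aEP (N * S + k) + as' aEN (N * S + k) \<le> (\<Sum>j<N. as' aEP (N * S + j) + as' aEN (N * S + j))"
      using ks by (intro member_le_sum[where f = "\<lambda>j. as' aEP (N * S + j) + as' aEN (N * S + j)"]) auto
    also have "\<dots> + 1 \<le> M" using I w q unfolding I_def N_def by linarith
    finally have "as' aEP (N * S + k) + as' aEN (N * S + k) + 1 \<le> V" using small_le_V(5) by linarith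
    then have eV: "as' aEN (N * S + k) + s \<le> V" "as' aEP (N * S + k) + (1 - s) \<le> V" using ks by linarith+
    have 1: "(\<Sum>j<N. (real (?EP (N * S + j)) - real (?EN (N * S + j))) * 2 powi e j) =
        (\<Sum>j<N. (real (as' aEP (N * S + j)) - real (as' aEN (N * S + j))) * 2 powi e j) +
        - term_value e (as aKI) (as aKS) ?q"
      by (rule sum_single_change[OF ks(1)]) (auto simp: term_value_def k_def s_def algebra_simps)
    have 2: "(\<Sum>j<N. ?EP (N * S + j) + ?EN (N * S + j)) = (\<Sum>j<N. as' aEP (N * S + j) + as' aEN (N * S + j)) + 1"
      by (rule sum_single_change[OF ks(1)]) (use ks(2) in auto)
    have "I (Suc q) (vs'(vid := k, vsg := s, vq := Suc q)) (as'(aEN := ?EN, aEP := ?EP))"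
      unfolding I_def
    proof (intro conjI)
      show "(\<Sum>j<N. (real ((as'(aEN := ?EN, aEP := ?EP)) aEP (N * S + j)) - real ((as'(aEN := ?EN, aEP := ?EP)) aEN (N * S + j))) * 2 powi e j) =
        v - list_value e (as aKI) (as aKS) (vs vfrom) (vs vfrom + Suc q)"
        using 1 I unfolding I_def list_value_Suc by simp
      show "(\<Sum>j<N. (as'(aEN := ?EN, aEP := ?EP)) aEP (N * S + j) + (as'(aEN := ?EN, aEP := ?EP)) aEN (N * S + j)) =
        (\<Sum>j<N. as aEP (N * S + j) + as aEN (N * S + j)) + Suc q"
        using 2 I unfolding I_def by simp
      show "\<forall>i. i < N * S \<or> N * S + N \<le> i \<longrightarrow> (as'(aEN := ?EN, aEP := ?EP)) aEP i = as aEP i \<and> (as'(aEN := ?EN, aEP := ?EP)) aEN i = as aEN i"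
        using I ks(1) unfolding I_def by auto
    qed (use fr in \<open>auto simp: new_power_mod\<close>)
    moreover have "as' aKI = as aKI" "as' aKS = as aKS" "vs' vfrom = vs vfrom" "vs' vnr = N * S"
      using fr nr by (auto simp: N_def)
    ultimately show "wp (vid ::= Arr aKI (Plus (Var vfrom) (Var vq)) ;; vsg ::= Arr aKS (Plus (Var vfrom) (Var vq)) ;;
      Write aEN (Plus (Var vnr) (Var vid)) (Plus (Arr aEN (Plus (Var vnr) (Var vid))) (Var vsg)) ;;
      Write aEP (Plus (Var vnr) (Var vid))
        (Plus (Arr aEP (Plus (Var vnr) (Var vid))) (Minus (Num 1) (Var vsg))))
      (\<lambda>vs'' as''. vs'' vq = q \<and> I (Suc q) (vs''(vq := Suc q)) as'') vs' as'"
      using q iV qV eV V(2) by (simp add: k_def[symmetric] s_def[symmetric])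
  next
    fix vs' as' assume "I (vs vto - vs vfrom) vs' as'"
    then show "(\<Sum>j<N. (real (as' aEP (N * S + j)) - real (as' aEN (N * S + j))) * 2 powi e j) =
      v - list_value e (as aKI) (as aKS) (vs vfrom) (vs vto) \<and>
    (\<Sum>j<N. as' aEP (N * S + j) + as' aEN (N * S + j)) =
      (\<Sum>j<N. as aEP (N * S + j) + as aEN (N * S + j)) + (vs vto - vs vfrom) \<and>
    (\<forall>i. i < N * S \<or> N * S + N \<le> i \<longrightarrow> as' aEP i = as aEP i \<and> as' aEN i = as aEN i)"
      using f(1) unfolding I_def by simp
  qed auto
qed

lemma wp_difference_coeffs:
  assumes p: "powers e vs as" and jj: "vs vjj < vs vN" and nr: "vs vnr = vs vN * S"
    and w: "(\<Sum>j<vs vN. as aEP (vs vN * S + j) + as aEN (vs vN * S + j)) \<le> n * vs vN"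
      "(\<Sum>j<vs vN. as aEP (vs vjj * S + j) + as aEN (vs vjj * S + j)) \<le> n * vs vN"
  defines "N \<equiv> vs vN"
  shows "wp difference_coeffs (\<lambda>vs' as'. vs' vor = vs vjj * S \<and> (\<Sum>j<N. as' aCP j + as' aCN j) \<le> M \<and>
    (\<Sum>j<N. (real (as' aCP j) - real (as' aCN j)) * 2 powi e j) =
      (\<Sum>j<N. (real (as aEP (N * S + j)) - real (as aEN (N * S + j))) * 2 powi e j) -
      (\<Sum>j<N. (real (as aEP (vs vjj * S + j)) - real (as aEN (vs vjj * S + j))) * 2 powi e j)) vs as"
proof -
  note pD = powersD[OF p]
  have N: "N < S" using pD(5) by (simp add: N_def)
  let ?P = "\<lambda>j. as aEP (N * S + j) + as aEN (vs vjj * S + j)"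
  let ?Q = "\<lambda>j. as aEN (N * S + j) + as aEP (vs vjj * S + j)"
  have wPQ: "(\<Sum>j<N. ?P j + ?Q j) \<le> M"
  proof -
    have "(\<Sum>j<N. ?P j + ?Q j) = (\<Sum>j<N. as aEP (N * S + j) + as aEN (N * S + j)) +
        (\<Sum>j<N. as aEP (vs vjj * S + j) + as aEN (vs vjj * S + j))"
      by (simp add: sum.distrib)
    with w nN_le_M[OF N] show ?thesis unfolding N_def by linarith
  qed
  have le: "?P j \<le> V" "?Q j \<le> V" if "j < N" for j
  proof -
    have "?P j + ?Q j \<le> (\<Sum>j<N. ?P j + ?Q j)"
      using that by (intro member_le_sum[where f = "\<lambda>j. ?P j + ?Q j"]) auto
    with wPQ small_le_V(5) show "?P j \<le> V" "?Q j \<le> V" by linarith+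
  qed
  define I where "I c vs' as' \<longleftrightarrow> (\<forall>v. v \<noteq> vj \<longrightarrow> vs' v = (vs(vor := vs vjj * S)) v) \<and>
    as' aEP = as aEP \<and> as' aEN = as aEN \<and> (\<forall>j<c. as' aCP j = ?P j \<and> as' aCN j = ?Q j)"
    for c vs' and as' :: arrs
  have "wp (For 2 vj (Var vN) (
      Write aCP (Var vj) (Plus (Arr aEP (Plus (Var vnr) (Var vj))) (Arr aEN (Plus (Var vor) (Var vj)))) ;;
      Write aCN (Var vj) (Plus (Arr aEN (Plus (Var vnr) (Var vj))) (Arr aEP (Plus (Var vor) (Var vj))))))
    (\<lambda>vs' as'. vs' vor = vs vjj * S \<and> (\<forall>j<N. as' aCP j = ?P j \<and> as' aCN j = ?Q j)) (vs(vor := vs vjj * S)) as"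
  proof (rule wp_For[where c = N and I = I])
    show "N \<le> \<beta> ^ 2" using N loop_bounds(1) by simp
    show "N \<le> V" using N small_le_V(8) by linarith
    fix j vs' as' assume j: "j < N" "vs' vj = j" and I: "I j vs' as'"
    have "N * S + j \<le> V" "vs vjj * S + j \<le> V"
      using j jj N row_le_V[of N j] row_le_V[of "vs vjj" j] by (auto simp: N_def)
    then show "wp (
      Write aCP (Var vj) (Plus (Arr aEP (Plus (Var vnr) (Var vj))) (Arr aEN (Plus (Var vor) (Var vj)))) ;;
      Write aCN (Var vj) (Plus (Arr aEN (Plus (Var vnr) (Var vj))) (Arr aEP (Plus (Var vor) (Var vj)))))
      (\<lambda>vs'' as''. vs'' vj = j \<and> I (Suc j) (vs''(vj := Suc j)) as'') vs' as'"
      using I j le[OF j(1)] nr by (auto simp: I_def less_Suc_eq N_def)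
  qed (auto simp: I_def N_def)
  then have "wp (For 2 vj (Var vN) (
      Write aCP (Var vj) (Plus (Arr aEP (Plus (Var vnr) (Var vj))) (Arr aEN (Plus (Var vor) (Var vj)))) ;;
      Write aCN (Var vj) (Plus (Arr aEN (Plus (Var vnr) (Var vj))) (Arr aEP (Plus (Var vor) (Var vj))))))
    (\<lambda>vs' as'. vs' vor = vs vjj * S \<and> (\<Sum>j<N. as' aCP j + as' aCN j) \<le> M \<and>
    (\<Sum>j<N. (real (as' aCP j) - real (as' aCN j)) * 2 powi e j) =
      (\<Sum>j<N. (real (as aEP (N * S + j)) - real (as aEN (N * S + j))) * 2 powi e j) -
      (\<Sum>j<N. (real (as aEP (vs vjj * S + j)) - real (as aEN (vs vjj * S + j))) * 2 powi e j))
    (vs(vor := vs vjj * S)) as"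
  proof (rule wp_mono, intro conjI)
    fix vs' and as' :: arrs
    assume A: "vs' vor = vs vjj * S \<and> (\<forall>j<N. as' aCP j = ?P j \<and> as' aCN j = ?Q j)"
    then show "vs' vor = vs vjj * S" by blast
    have "(\<Sum>j<N. as' aCP j + as' aCN j) = (\<Sum>j<N. ?P j + ?Q j)" using A by (intro sum.cong) auto
    with wPQ show "(\<Sum>j<N. as' aCP j + as' aCN j) \<le> M" by simp
    show "(\<Sum>j<N. (real (as' aCP j) - real (as' aCN j)) * 2 powi e j) =
      (\<Sum>j<N. (real (as aEP (N * S + j)) - real (as aEN (N * S + j))) * 2 powi e j) -
      (\<Sum>j<N. (real (as aEP (vs vjj * S + j)) - real (as aEN (vs vjj * S + j))) * 2 powi e j)"
      unfolding sum_subtractf[symmetric] using A by (intro sum.cong) (auto simp: algebra_simps)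
  qed
  then show ?thesis
    using pD(12)[of "vs vjj"] jj N by (simp add: difference_coeffs_def N_def)
qed

end

text \<open>Counting replaces searching: by \<open>down_closed_eq_lessThan\<close> the exponents
  that are at least \<open>x\<close> fill exactly the positions below \<open>p\<close>.\<close>

lemma insert_sorted:
  fixes e :: "nat \<Rightarrow> int"
  assumes bij: "bij_betw ord {..<N} {..<N}"
    and sorted: "\<And>i j. i \<le> j \<Longrightarrow> j < N \<Longrightarrow> e (ord j) \<le> e (ord i)"
    and p: "p = card {j. j < N \<and> x \<le> e j}"
    and ord'_def: "ord' = (\<lambda>i. if i = p then N else if p < i \<and> i \<le> N then ord (i - 1) else ord i)"
  shows "bij_betw ord' {..<Suc N} {..<Suc N}"
    and "i \<le> j \<Longrightarrow> j < Suc N \<Longrightarrow> (e(N := x)) (ord' j) \<le> (e(N := x)) (ord' i)"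
proof -
  have less: "i < N \<Longrightarrow> ord i < N" for i using bij by (auto simp: bij_betw_def)
  have inj: "i < N \<Longrightarrow> j < N \<Longrightarrow> ord i = ord j \<Longrightarrow> i = j" for i j
    using bij by (auto simp: bij_betw_def inj_on_def)
  define A where "A = {i. i < N \<and> x \<le> e (ord i)}"
  have "ord ` A = {j. j < N \<and> x \<le> e j}"
  proof -
    have "\<exists>i<N. j = ord i" if "j < N" for j
      using bij that unfolding bij_betw_def by (metis imageE lessThan_iff)
    then show ?thesis using less by (auto simp: A_def)
  qed
  moreover have "inj_on ord A" using inj by (auto simp: inj_on_def A_def)
  ultimately have "card A = p" using p card_image by metis
  moreover have "A = {..<card A}"
    by (rule down_closed_eq_lessThan) (use sorted in \<open>auto simp: A_def intro: order_trans\<close>)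
  ultimately have A: "i < p \<longleftrightarrow> i < N \<and> x \<le> e (ord i)" for i unfolding A_def by blast
  have pN: "p \<le> N" using A[of N] by simp
  have "inj_on ord' {..<Suc N}"
  proof (rule inj_onI)
    fix i j assume ij: "i \<in> {..<Suc N}" "j \<in> {..<Suc N}" "ord' i = ord' j"
    have 1: "k < Suc N \<Longrightarrow> k \<noteq> p \<Longrightarrow> ord' k = ord (if p < k then k - 1 else k) \<and> (if p < k then k - 1 else k) < N" for k
      using pN by (auto simp: ord'_def)
    show "i = j"
    proof (cases "i = p \<or> j = p")
      case True
      moreover have "k < Suc N \<Longrightarrow> k \<noteq> p \<Longrightarrow> ord' k \<noteq> ord' p" for k
        using 1[of k] less[of "if p < k then k - 1 else k"] by (simp add: ord'_def)
      ultimately show ?thesis using ij by (metis lessThan_iff)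
    next
      case False
      let ?i = "if p < i then i - 1 else i" and ?j = "if p < j then j - 1 else j"
      have "ord' i = ord ?i \<and> ?i < N" "ord' j = ord ?j \<and> ?j < N"
        using False ij(1,2) 1 by (auto simp del: if_split)
      then have "?i = ?j" using inj[of ?i ?j] ij(3) by (simp only:)
      with False show ?thesis by (auto split: if_splits)
    qed
  qed
  moreover have "ord' ` {..<Suc N} \<subseteq> {..<Suc N}"
  proof
    fix y assume "y \<in> ord' ` {..<Suc N}"
    then obtain i where i: "i < Suc N" "y = ord' i" by auto
    consider "i = p" | "p < i" | "i < p" by linarith
    then show "y \<in> {..<Suc N}"
    proof cases
      case 2
      then have "i - 1 < N" using i(1) by linarith
      then show ?thesis using less[of "i - 1"] 2 i by (simp add: ord'_def)
    qed (use i pN less[of i] in \<open>auto simp: ord'_def\<close>)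
  qed
  ultimately show "bij_betw ord' {..<Suc N} {..<Suc N}"
    by (simp add: bij_betw_def endo_inj_surj)
  show "(e(N := x)) (ord' j) \<le> (e(N := x)) (ord' i)" if ij: "i \<le> j" "j < Suc N"
  proof -
    have v: "(e(N := x)) (ord' k) = (if k = p then x else e (ord (if p < k then k - 1 else k)))" if "k < Suc N" for k
    proof (cases "k = p")
      case False
      let ?k = "if p < k then k - 1 else k"
      have "?k < N" using that pN False by auto
      then have "ord ?k \<noteq> N" using less[of ?k] by linarith
      moreover have "ord' k = ord ?k" using that False by (auto simp: ord'_def)
      ultimately show ?thesis using False by (simp only: fun_upd_apply if_False)
    qed (simp add: ord'_def)
    consider "i = j" | "i < p" "j < p" | "i < p" "j = p" | "i < p" "p < j" | "i = p" "p < j" | "p < i" "p < j"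
      using ij by linarith
    then show ?thesis
    proof cases
      case 1
      then show ?thesis by simp
    next
      case 2
      then show ?thesis using ij sorted[of i j] pN by (simp add: v del: fun_upd_apply)
    next
      case 3
      then show ?thesis using ij A[of i] by (simp add: v del: fun_upd_apply)
    next
      case 4
      then show ?thesis using ij sorted[of i "j - 1"] by (simp add: v del: fun_upd_apply)
    next
      case 5
      then have "\<not> j - 1 < p" "j - 1 < N" using ij by linarith+
      then show ?thesis using 5 ij A[of "j - 1"] by (simp add: v del: fun_upd_apply)
    next
      case 6
      then show ?thesis using ij sorted[of "i - 1" "j - 1"] by (simp add: v del: fun_upd_apply)
    qed
  qed
qed

context solver
begin

lemma powers_cong:
  assumes "powers e vs as" "vs' vN = vs vN" "vs' vS = vs vS" "vs' vG = vs vG" "vs' vB = vs vB"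
    "as' aH = as aH" "as' aROW = as aROW" "as' aORD = as aORD"
    "\<And>i j. i < vs vN \<Longrightarrow> j < vs vN \<Longrightarrow> as' aD (i * S + j) = as aD (i * S + j)"
  shows "powers e vs' as'"
  using assms unfolding powers_def by simp

text \<open>The difference of the new exponent and an old one is an integer and a combination of old
  powers of weight at most \<open>M\<close>, so \<open>eval_coeffs\<close> yields both of its
  cut-offs.\<close>

lemma wp_compare_all:
  assumes p: "powers e vs as" and nr: "vs vnr = vs vN * S"
    and row: "\<And>i. i < vs vN \<Longrightarrow> (\<Sum>j<vs vN. (real (as aEP (i * S + j)) - real (as aEN (i * S + j))) * 2 powi e j) = e i"
      "\<And>i. i \<le> vs vN \<Longrightarrow> (\<Sum>j<vs vN. as aEP (i * S + j) + as aEN (i * S + j)) \<le> n * i"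
    and new: "(\<Sum>j<vs vN. (real (as aEP (vs vN * S + j)) - real (as aEN (vs vN * S + j))) * 2 powi e j) = of_int x"
  defines "N \<equiv> vs vN"
  shows "wp compare_all (\<lambda>vs' as'. vs' vp = card {j. j < N \<and> x \<le> e j} \<and>
    (\<forall>j<N. as' aD (N * S + j) = nat (min (int G) (x - e j)) \<and> as' aD (j * S + N) = nat (min (int G) (e j - x))) \<and>
    (\<forall>i<N. \<forall>j<N. as' aD (i * S + j) = as aD (i * S + j))) vs as"
proof -
  note pD = powersD[OF p]
  have N: "N < S" using pD(5) by (simp add: N_def)
  define J where "J c vs' as' \<longleftrightarrow> (\<forall>v. v \<notin> mod_vars compare_all \<longrightarrow> vs' v = vs v) \<and>
    (\<forall>k. k \<notin> mod_arrs compare_all \<longrightarrow> as' k = as k) \<and> vs' vp = card {j. j < c \<and> x \<le> e j} \<and>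
    (\<forall>j<c. as' aD (N * S + j) = nat (min (int G) (x - e j)) \<and> as' aD (j * S + N) = nat (min (int G) (e j - x))) \<and>
    (\<forall>i<N. \<forall>j<N. as' aD (i * S + j) = as aD (i * S + j))"
    for c vs' and as' :: arrs
  have "wp (For 2 vjj (Var vN) (
      difference_coeffs ;; eval_coeffs ;;
      Write aD (Plus (Var vnr) (Var vjj)) (Var vOX) ;; Write aD (Plus (Var vor) (Var vN)) (Var vOY) ;;
      Cond (Var vOX) Nop (vp ::= Plus (Var vp) (Num 1)))) (J N) (vs(vp := 0)) as"
  proof (rule wp_For[where c = N and I = J])
    show "N \<le> \<beta> ^ 2" using N loop_bounds(1) by simp
    show "N \<le> V" using N small_le_V(8) by linarith
    show "J 0 (vs(vp := 0, vjj := 0)) as" by (simp add: J_def new_power_mod)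
  next
    fix c vs1 as1 assume c: "c < N" "vs1 vjj = c" and J: "J c vs1 as1"
    have fr: "\<And>v. v \<notin> mod_vars compare_all \<Longrightarrow> vs1 v = vs v" "\<And>k. k \<notin> {aD, aCP, aCN} \<Longrightarrow> as1 k = as k"
      using J by (auto simp: J_def new_power_mod)
    have vN: "vs1 vN = N" "vs1 vnr = N * S" using fr(1) nr by (simp_all add: N_def new_power_mod)
    have E: "as1 aEP = as aEP" "as1 aEN = as aEN" using fr(2) by simp_all
    have p1: "powers e vs1 as1"
      by (rule powers_cong[OF p]) (use fr J in \<open>auto simp: new_power_mod J_def N_def\<close>)
    have w: "(\<Sum>j<vs1 vN. as1 aEP (vs1 vN * S + j) + as1 aEN (vs1 vN * S + j)) \<le> n * vs1 vN"
      "(\<Sum>j<vs1 vN. as1 aEP (vs1 vjj * S + j) + as1 aEN (vs1 vjj * S + j)) \<le> n * vs1 vN"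
    proof -
      show "(\<Sum>j<vs1 vN. as1 aEP (vs1 vN * S + j) + as1 aEN (vs1 vN * S + j)) \<le> n * vs1 vN"
        using row(2)[of N] by (simp add: vN E N_def)
      have "n * c \<le> n * N" using c by simp
      then show "(\<Sum>j<vs1 vN. as1 aEP (vs1 vjj * S + j) + as1 aEN (vs1 vjj * S + j)) \<le> n * vs1 vN"
        using row(2)[of c] c unfolding vN E N_def by (metis le_trans less_imp_le)
    qed
    have jj: "vs1 vjj < vs1 vN" "vs1 vnr = vs1 vN * S" using c vN by auto
    show "wp (difference_coeffs ;; eval_coeffs ;;
        Write aD (Plus (Var vnr) (Var vjj)) (Var vOX) ;; Write aD (Plus (Var vor) (Var vN)) (Var vOY) ;;
        Cond (Var vOX) Nop (vp ::= Plus (Var vp) (Num 1)))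
      (\<lambda>vs'' as''. vs'' vjj = c \<and> J (Suc c) (vs''(vjj := Suc c)) as'') vs1 as1"
      unfolding wp.simps(4)[of difference_coeffs] wp.simps(4)[of eval_coeffs]
    proof (rule wp_conseq[OF wp_difference_coeffs[OF p1 jj w]])
      fix vs2 as2 assume u2: "unchanged difference_coeffs vs1 as1 vs2 as2"
        and A: "vs2 vor = vs1 vjj * S \<and> (\<Sum>j<vs1 vN. as2 aCP j + as2 aCN j) \<le> M \<and>
          (\<Sum>j<vs1 vN. (real (as2 aCP j) - real (as2 aCN j)) * 2 powi e j) =
          (\<Sum>j<vs1 vN. (real (as1 aEP (vs1 vN * S + j)) - real (as1 aEN (vs1 vN * S + j))) * 2 powi e j) -
          (\<Sum>j<vs1 vN. (real (as1 aEP (vs1 vjj * S + j)) - real (as1 aEN (vs1 vjj * S + j))) * 2 powi e j)"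
      have fr2: "\<And>v. v \<notin> {vor, vj} \<Longrightarrow> vs2 v = vs1 v" "\<And>k. k \<notin> {aCP, aCN} \<Longrightarrow> as2 k = as1 k"
        using u2 by (auto simp: unchanged_def new_power_mod)
      have vN2: "vs2 vN = N" using fr2 vN by simp
      have v: "(\<Sum>i<vs2 vN. (real (as2 aCP i) - real (as2 aCN i)) * 2 powi e i) = of_int (x - e c)"
        using A new row(1)[of c] c unfolding vN vN2 E N_def by simp
      have w2: "(\<Sum>i<vs2 vN. as2 aCP i + as2 aCN i) \<le> M" using A unfolding vN vN2 by simp
      have p2: "powers e vs2 as2"
        by (rule powers_cong[OF p1]) (use fr2 in auto)
      show "wp eval_coeffs (wp (Write aD (Plus (Var vnr) (Var vjj)) (Var vOX) ;; Write aD (Plus (Var vor) (Var vN)) (Var vOY) ;;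
        Cond (Var vOX) Nop (vp ::= Plus (Var vp) (Num 1)))
        (\<lambda>vs'' as''. vs'' vjj = c \<and> J (Suc c) (vs''(vjj := Suc c)) as'')) vs2 as2"
      proof (rule wp_conseq[OF wp_eval_coeffs[OF p2 w2]], unfold v)
        fix vs3 as3 assume u3: "unchanged eval_coeffs vs2 as2 vs3 as3"
          and "vs3 vF \<le> 1 \<and> vs3 vOX \<le> G \<and> vs3 vOY \<le> G \<and> (vs3 vF = 0 \<longleftrightarrow> (of_int (x - e c) :: real) \<in> \<int>) \<and>
          ((of_int (x - e c) :: real) \<in> \<int> \<longrightarrow> vs3 vOX = nat (min (int G) \<lfloor>of_int (x - e c) :: real\<rfloor>) \<and>
            vs3 vOY = nat (min (int G) (- \<lfloor>of_int (x - e c) :: real\<rfloor>)))"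
        then have O: "vs3 vOX = nat (min (int G) (x - e c))" "vs3 vOY = nat (min (int G) (e c - x))"
          unfolding floor_of_int by simp_all
        have fr3: "\<And>v. v \<notin> mod_vars eval_coeffs \<Longrightarrow> vs3 v = vs2 v" "as3 = as2"
          using u3 by (auto simp: unchanged_def)
        have vs3: "vs3 vnr = N * S" "vs3 vjj = c" "vs3 vor = c * S" "vs3 vN = N"
          "vs3 vp = card {j. j < c \<and> x \<le> e j}"
          using fr3(1) fr2(1) vN c A J by (simp_all add: J_def)
        have "card {j. j < c \<and> x \<le> e j} \<le> card {..<c}" by (intro card_mono) auto
        then have cV: "card {j. j < c \<and> x \<le> e j} + 1 \<le> V" using c(1) N small_le_V(8) unfolding card_lessThan by linarith
        have iV: "N * S + c \<le> V" "c * S + N \<le> V" using row_le_V N c by simp_all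
        have card_Suc: "card {j. j < Suc c \<and> x \<le> e j} = card {j. j < c \<and> x \<le> e j} + (if x \<le> e c then 1 else 0)"
        proof -
          have "{j. j < Suc c \<and> x \<le> e j} = {j. j < c \<and> x \<le> e j} \<union> (if x \<le> e c then {c} else {})"
            by (auto simp: less_Suc_eq)
          then show ?thesis by simp
        qed
        have OX0: "vs3 vOX = 0 \<longleftrightarrow> x \<le> e c" unfolding O by (auto simp: G_def)
        let ?D = "(as3 aD)(N * S + c := vs3 vOX, c * S + N := vs3 vOY)"
        \<comment> \<open>Row \<open>N\<close> and column \<open>N\<close> are filled together; they
          meet only in the diagonal cell, which \<open>new_power\<close> sets afterwards.\<close>
        have D: "\<forall>j<Suc c. ?D (N * S + j) = nat (min (int G) (x - e j)) \<and> ?D (j * S + N) = nat (min (int G) (e j - x))"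
        proof (intro allI impI)
          fix j assume "j < Suc c"
          then have "N * S + j = c * S + N \<longleftrightarrow> False" "j * S + N = N * S + c \<longleftrightarrow> False"
            "N * S + j = N * S + c \<longleftrightarrow> j = c" "j * S + N = c * S + N \<longleftrightarrow> j = c"
            using row_index_eq[of j S N N c] row_index_eq[of N S c j N] row_index_eq[of N S N j c] N c by auto
          then show "?D (N * S + j) = nat (min (int G) (x - e j)) \<and> ?D (j * S + N) = nat (min (int G) (e j - x))"
            using J \<open>j < Suc c\<close> fr2(2) by (auto simp: J_def fr3(2) O less_Suc_eq)
        qed
        have D': "\<forall>i<N. \<forall>j<N. ?D (i * S + j) = as aD (i * S + j)"
        proof (intro allI impI)
          fix i j assume "i < N" "j < N"
          then have "i * S + j = c * S + N \<longleftrightarrow> False" "i * S + j = N * S + c \<longleftrightarrow> False"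
            using row_index_eq[of j S N i c] row_index_eq[of j S c i N] N c by auto
          then show "?D (i * S + j) = as aD (i * S + j)"
            using J \<open>i < N\<close> \<open>j < N\<close> fr2(2) by (auto simp: J_def fr3(2))
        qed
        let ?vs = "vs3(vp := card {j. j < Suc c \<and> x \<le> e j}, vjj := Suc c)"
        have J': "J (Suc c) ?vs (as3(aD := ?D))"
          unfolding J_def
        proof (intro conjI)
          show "\<forall>v. v \<notin> mod_vars compare_all \<longrightarrow> ?vs v = vs v"
            using fr3(1) fr2(1) fr(1) by (auto simp: new_power_mod)
          show "\<forall>k. k \<notin> mod_arrs compare_all \<longrightarrow> (as3(aD := ?D)) k = as k"
            using fr3(2) fr2(2) fr(2) by (auto simp: new_power_mod)
        qed (use D D' in simp_all)
        have upd: "as3(aD := (as3 aD)(N * S + c := vs3 vOX), aD := ((as3 aD)(N * S + c := vs3 vOX))(c * S + N := vs3 vOY)) = as3(aD := ?D)"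
          by simp
        show "wp (Write aD (Plus (Var vnr) (Var vjj)) (Var vOX) ;; Write aD (Plus (Var vor) (Var vN)) (Var vOY) ;;
          Cond (Var vOX) Nop (vp ::= Plus (Var vp) (Num 1)))
          (\<lambda>vs'' as''. vs'' vjj = c \<and> J (Suc c) (vs''(vjj := Suc c)) as'') vs3 as3"
        proof (cases "vs3 vOX = 0")
          case True
          then have "card {j. j < Suc c \<and> x \<le> e j} = Suc (card {j. j < c \<and> x \<le> e j})"
            using OX0 card_Suc by simp
          then show ?thesis using J' True iV cV V(2) by (simp add: vs3)
        next
          case False
          then have "card {j. j < Suc c \<and> x \<le> e j} = vs3 vp" using OX0 card_Suc vs3 by simp
          then have "?vs = vs3(vjj := Suc c)" by auto
          then show ?thesis using J' False iV V(2) by (simp add: vs3)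
        qed
      qed
    qed
  qed (auto simp: N_def)
  then have "wp (For 2 vjj (Var vN) (
      difference_coeffs ;; eval_coeffs ;;
      Write aD (Plus (Var vnr) (Var vjj)) (Var vOX) ;; Write aD (Plus (Var vor) (Var vN)) (Var vOY) ;;
      Cond (Var vOX) Nop (vp ::= Plus (Var vp) (Num 1)))) (\<lambda>vs' as'. vs' vp = card {j. j < N \<and> x \<le> e j} \<and>
    (\<forall>j<N. as' aD (N * S + j) = nat (min (int G) (x - e j)) \<and> as' aD (j * S + N) = nat (min (int G) (e j - x))) \<and>
    (\<forall>i<N. \<forall>j<N. as' aD (i * S + j) = as aD (i * S + j))) (vs(vp := 0)) as"
    by (rule wp_mono) (simp add: J_def)
  then show ?thesis by (simp add: compare_all_def)
qed

lemma wp_place_node: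
  assumes "vs vp \<le> vs vN" "vs vN < S"
  defines "N \<equiv> vs vN" and "p \<equiv> vs vp"
  shows "wp place_node (\<lambda>vs' as'. as' aORD =
    (\<lambda>i. if i = p then N else if p < i \<and> i \<le> N then as aORD (i - 1) else as aORD i)) vs as"
proof -
  have N: "N < S" "p \<le> N" using assms by simp_all
  define J where "J c vs' as' \<longleftrightarrow> vs' vN = N \<and> vs' vp = p \<and>
      as' aORD = (\<lambda>i. if N - c < i \<and> i \<le> N then as aORD (i - 1) else as aORD i)"
    for c and vs' :: vars and as' :: arrs
  show ?thesis unfolding place_node_def wp.simps(4)
  proof (rule wp_For[where c = "N - p" and I = J])
    show "N - p \<le> \<beta> ^ 2" using N loop_bounds(1)[of "N - p"] by simp
    show "N - p \<le> V" using N small_le_V(8) by linarith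
    show "J 0 (vs(vj := 0)) as" by (auto simp: J_def N_def p_def)
  next
    fix c vs' as' assume c: "c < N - p" "vs' vj = c" and J: "J c vs' as'"
    have "as' aORD (N - c - 1) = as aORD (N - c - 1)" using J c by (auto simp: J_def)
    then have "J (Suc c) (vs'(vj := Suc c)) (as'(aORD := (as' aORD)(N - c := as' aORD (N - c - 1))))"
      using J c by (auto simp: J_def fun_eq_iff)
    then show "wp (Write aORD (Minus (Var vN) (Var vj)) (Arr aORD (Minus (Minus (Var vN) (Var vj)) (Num 1))))
      (\<lambda>vs'' as''. vs'' vj = c \<and> J (Suc c) (vs''(vj := Suc c)) as'') vs' as'"
      using J c V(2) by (simp add: J_def)
  next
    fix vs' as' assume J: "J (N - p) vs' as'"
    then show "wp (Write aORD (Var vp) (Var vN)) (\<lambda>vs' as'. as' aORD =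
      (\<lambda>i. if i = p then N else if p < i \<and> i \<le> N then as aORD (i - 1) else as aORD i)) vs' as'"
      using N by (auto simp: J_def fun_eq_iff)
  qed (use N in \<open>auto simp: N_def p_def\<close>)
qed

lemma wp_eval_list:
  assumes p: "powers e vs as" and f: "vs vfrom \<le> vs vto" "vs vto \<le> n"
    and k: "kI < 16" "kS < 16" "kI \<notin> {aCP, aCN}" "kS \<notin> {aCP, aCN}"
    and ids: "\<And>q. vs vfrom \<le> q \<Longrightarrow> q < vs vto \<Longrightarrow> as kI q < vs vN \<and> as kS q \<le> 1"
  defines "v \<equiv> list_value e (as kI) (as kS) (vs vfrom) (vs vto)"
  shows "wp (eval_list kI kS) (\<lambda>vs' as'. vs' vF \<le> 1 \<and> vs' vOX \<le> G \<and> vs' vOY \<le> G \<and> (vs' vF = 0 \<longleftrightarrow> v \<in> \<int>) \<and>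
    (v \<in> \<int> \<longrightarrow> vs' vOX = nat (min (int G) \<lfloor>v\<rfloor>) \<and> vs' vOY = nat (min (int G) (- \<lfloor>v\<rfloor>)))) vs as"
proof -
  note pD = powersD[OF p]
  define N where "N = vs vN"
  have N: "N < S" using pD(5) by (simp add: N_def)
  define J1 where "J1 c vs' as' \<longleftrightarrow> (\<forall>v. v \<noteq> vj \<longrightarrow> vs' v = vs v) \<and> (\<forall>k. k \<notin> {aCP, aCN} \<longrightarrow> as' k = as k) \<and>
    (\<forall>j<c. as' aCP j = 0 \<and> as' aCN j = 0)" for c vs' and as' :: arrs
  define J2 where "J2 c vs' as' \<longleftrightarrow> (\<forall>v. v \<notin> {vj, vq, vid, vsg} \<longrightarrow> vs' v = vs v) \<and> (\<forall>k. k \<notin> {aCP, aCN} \<longrightarrow> as' k = as k) \<and>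
    (\<Sum>j<N. (real (as' aCP j) - real (as' aCN j)) * 2 powi e j) = list_value e (as kI) (as kS) (vs vfrom) (vs vfrom + c) \<and>
    (\<Sum>j<N. as' aCP j + as' aCN j) = c" for c vs' and as' :: arrs
  have nM: "n \<le> M" by (simp add: M_def)
  show ?thesis unfolding eval_list_def wp.simps(4)[of "For _ _ _ _"]
  proof (rule wp_For[where c = N and I = J1])
    show "N \<le> \<beta> ^ 2" using N loop_bounds(1) by simp
    show "N \<le> V" using N small_le_V(8) by linarith
    show "J1 0 (vs(vj := 0)) as" by (simp add: J1_def)
    fix j vs' as' assume "j < N" "vs' vj = j" "J1 j vs' as'"
    then show "wp (Write aCP (Var vj) (Num 0) ;; Write aCN (Var vj) (Num 0))
      (\<lambda>vs'' as''. vs'' vj = j \<and> J1 (Suc j) (vs''(vj := Suc j)) as'') vs' as'"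
      by (auto simp: J1_def less_Suc_eq)
  next
    fix vs1 as1 assume 1: "J1 N vs1 as1"
    have vs1: "vs1 vfrom = vs vfrom" "vs1 vto = vs vto" using 1 by (auto simp: J1_def)
    show "wp (For 1 vq (Minus (Var vto) (Var vfrom)) (
      vid ::= Arr kI (Plus (Var vfrom) (Var vq)) ;; vsg ::= Arr kS (Plus (Var vfrom) (Var vq)) ;;
      Write aCP (Var vid) (Plus (Arr aCP (Var vid)) (Var vsg)) ;;
      Write aCN (Var vid) (Plus (Arr aCN (Var vid)) (Minus (Num 1) (Var vsg)))))
      (wp eval_coeffs (\<lambda>vs' as'. vs' vF \<le> 1 \<and> vs' vOX \<le> G \<and> vs' vOY \<le> G \<and> (vs' vF = 0 \<longleftrightarrow> v \<in> \<int>) \<and>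
    (v \<in> \<int> \<longrightarrow> vs' vOX = nat (min (int G) \<lfloor>v\<rfloor>) \<and> vs' vOY = nat (min (int G) (- \<lfloor>v\<rfloor>))))) vs1 as1"
    proof (rule wp_For[where c = "vs vto - vs vfrom" and I = J2])
      show "vs vto - vs vfrom \<le> \<beta> ^ 1" using f loop_bounds(3)[of "vs vto - vs vfrom"] by simp
      show "vs vto - vs vfrom \<le> V" using f small_le_V(9) by linarith
      show "J2 0 (vs1(vq := 0)) as1" using 1 list_value_Suc(1) by (simp add: J2_def J1_def)
    next
      fix q vs' as' assume q: "q < vs vto - vs vfrom" "vs' vq = q" and J: "J2 q vs' as'"
      let ?q = "vs vfrom + q"
      define i s where "i = as kI ?q" and "s = as kS ?q"
      have is': "i < N" "s \<le> 1" using ids[of ?q] q by (auto simp: i_def s_def N_def)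
      let ?CP = "(as' aCP)(i := as' aCP i + s)" and ?CN = "(as' aCN)(i := as' aCN i + (1 - s))"
      have qV: "?q \<le> V" using q f small_le_V(9) by linarith
      have "as' aCP i + as' aCN i \<le> (\<Sum>j<N. as' aCP j + as' aCN j)"
        using is' by (intro member_le_sum[where f = "\<lambda>j. as' aCP j + as' aCN j"]) auto
      also have "\<dots> = q" using J by (simp add: J2_def)
      finally have eV: "as' aCP i + s \<le> V" "as' aCN i + (1 - s) \<le> V" using q f is' small_le_V(9) by linarith+
      have S1: "(\<Sum>j<N. (real (?CP j) - real (?CN j)) * 2 powi e j) =
          (\<Sum>j<N. (real (as' aCP j) - real (as' aCN j)) * 2 powi e j) + term_value e (as kI) (as kS) ?q"
        by (rule sum_single_change[OF is'(1)]) (auto simp: term_value_def i_def s_def algebra_simps)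
      have S2: "(\<Sum>j<N. ?CP j + ?CN j) = (\<Sum>j<N. as' aCP j + as' aCN j) + 1"
        by (rule sum_single_change[OF is'(1)]) (use is'(2) in auto)
      have "J2 (Suc q) (vs'(vid := i, vsg := s, vq := Suc q)) (as'(aCP := ?CP, aCN := ?CN))"
        unfolding J2_def
      proof (intro conjI)
        show "(\<Sum>j<N. (real ((as'(aCP := ?CP, aCN := ?CN)) aCP j) - real ((as'(aCP := ?CP, aCN := ?CN)) aCN j)) * 2 powi e j) =
          list_value e (as kI) (as kS) (vs vfrom) (vs vfrom + Suc q)"
          using S1 J unfolding J2_def list_value_Suc by simp
        show "(\<Sum>j<N. (as'(aCP := ?CP, aCN := ?CN)) aCP j + (as'(aCP := ?CP, aCN := ?CN)) aCN j) = Suc q"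
          using S2 J unfolding J2_def by simp
      qed (use J in \<open>auto simp: J2_def\<close>)
      moreover have "as' kI = as kI" "as' kS = as kS" "vs' vfrom = vs vfrom" using J k by (auto simp: J2_def)
      ultimately show "wp (vid ::= Arr kI (Plus (Var vfrom) (Var vq)) ;; vsg ::= Arr kS (Plus (Var vfrom) (Var vq)) ;;
        Write aCP (Var vid) (Plus (Arr aCP (Var vid)) (Var vsg)) ;;
        Write aCN (Var vid) (Plus (Arr aCN (Var vid)) (Minus (Num 1) (Var vsg))))
        (\<lambda>vs'' as''. vs'' vq = q \<and> J2 (Suc q) (vs''(vq := Suc q)) as'') vs' as'"
        using q qV eV k V(2) by (simp add: i_def[symmetric] s_def[symmetric])
    next
      fix vs' as' assume J: "J2 (vs vto - vs vfrom) vs' as'"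
      have vN: "vs' vN = N" using J by (simp add: J2_def N_def)
      have p': "powers e vs' as'" by (rule powers_cong[OF p]) (use J in \<open>auto simp: J2_def\<close>)
      have w: "(\<Sum>i<vs' vN. as' aCP i + as' aCN i) \<le> M" using J f nM by (simp add: J2_def vN)
      have "(\<Sum>i<vs' vN. (real (as' aCP i) - real (as' aCN i)) * 2 powi e i) = v"
        using J f by (simp add: J2_def vN v_def)
      with wp_eval_coeffs[OF p' w] show "wp eval_coeffs (\<lambda>vs' as'. vs' vF \<le> 1 \<and> vs' vOX \<le> G \<and> vs' vOY \<le> G \<and> (vs' vF = 0 \<longleftrightarrow> v \<in> \<int>) \<and>
        (v \<in> \<int> \<longrightarrow> vs' vOX = nat (min (int G) \<lfloor>v\<rfloor>) \<and> vs' vOY = nat (min (int G) (- \<lfloor>v\<rfloor>)))) vs' as'"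
        by simp
    qed (auto simp: vs1)
  qed (auto simp: N_def)
qed

lemma wp_new_power:
  assumes p: "powers e vs as" and ex: "exponents e vs as" and b: "vs vbase < vs vN" and N: "vs vN \<le> n * n"
    and f: "vs vfrom \<le> vs vto" "vs vto \<le> n"
    and ids: "\<And>q. vs vfrom \<le> q \<Longrightarrow> q < vs vto \<Longrightarrow> as aKI q < vs vN \<and> as aKS q \<le> 1"
    and k: "list_value e (as aKI) (as aKS) (vs vfrom) (vs vto) = of_int k"
  shows "wp new_power (\<lambda>vs' as'. vs' vN = Suc (vs vN) \<and>
    powers (e(vs vN := e (vs vbase) - k)) vs' as' \<and> exponents (e(vs vN := e (vs vbase) - k)) vs' as') vs as"
proof -
  note pD = powersD[OF p]
  define N where "N = vs vN"
  define x where "x = e (vs vbase) - k"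
  define e' where "e' = e(N := x)"
  have NS: "N < S" "Suc N < S" using assms(4) by (simp_all add: N_def S_def)
  have bN: "vs vbase < N" using b by (simp add: N_def)
  have exv: "(\<Sum>j<N. (real (as aEP (i * S + j)) - real (as aEN (i * S + j))) * 2 powi e j) = e i"
    and exw: "(\<Sum>j<N. as aEP (i * S + j) + as aEN (i * S + j)) \<le> n * i" if "i < N" for i
    using ex that by (simp_all add: exponents_def N_def)
  have ex0: "as aEP (i * S + j) = 0 \<and> as aEN (i * S + j) = 0" if "i < S" "j < S" "N \<le> i \<or> N \<le> j" for i j
    using ex that unfolding exponents_def N_def by blast
  \<comment> \<open>Because \<open>base < N\<close>, there is room for the at most \<open>n\<close>
    new terms.\<close>
  have wN: "n * vs vbase + (vs vto - vs vfrom) \<le> n * N"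
  proof -
    have "n * Suc (vs vbase) \<le> n * N" using bN by (intro mult_le_mono2) simp
    then show ?thesis using f by simp
  qed
  let ?Q = "\<lambda>vs' as'. vs' vN = Suc N \<and>
    powers (e(N := e (vs vbase) - k)) vs' as' \<and> exponents (e(N := e (vs vbase) - k)) vs' as'"
  show ?thesis unfolding new_power_def wp.simps(4)
  proof (rule wp_conseq[OF wp_copy_row[OF p b]], fold N_def)
    fix vs1 as1 assume u1: "unchanged copy_row vs as vs1 as1"
      and A: "vs1 vnr = N * S \<and>
      (\<forall>j<N. as1 aEP (N * S + j) = as aEP (vs vbase * S + j) \<and> as1 aEN (N * S + j) = as aEN (vs vbase * S + j)) \<and>
      (\<forall>i. i < N * S \<or> N * S + N \<le> i \<longrightarrow> as1 aEP i = as aEP i \<and> as1 aEN i = as aEN i)"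
    have fr1: "\<And>v. v \<notin> {vnr, vbr, vj} \<Longrightarrow> vs1 v = vs v" "\<And>k. k \<notin> {aEP, aEN} \<Longrightarrow> as1 k = as k"
      using u1 by (auto simp: unchanged_def new_power_mod)
    have v1: "vs1 vN = N" "vs1 vfrom = vs vfrom" "vs1 vto = vs vto" "vs1 vnr = N * S" "as1 aKI = as aKI" "as1 aKS = as aKS"
      using fr1 A by (simp_all add: N_def)
    have s1: "(\<Sum>j<N. as1 aEP (N * S + j) + as1 aEN (N * S + j)) = (\<Sum>j<N. as aEP (vs vbase * S + j) + as aEN (vs vbase * S + j))"
      "(\<Sum>j<N. (real (as1 aEP (N * S + j)) - real (as1 aEN (N * S + j))) * 2 powi e j) = e (vs vbase)"
      unfolding exv[OF bN, symmetric] using A by (auto intro!: sum.cong)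
    have "vs1 vnr = vs1 vN * S" "vs1 vN < S" "vs1 vfrom \<le> vs1 vto" "vs1 vto \<le> n"
      "\<And>q. vs1 vfrom \<le> q \<Longrightarrow> q < vs1 vto \<Longrightarrow> as1 aKI q < vs1 vN \<and> as1 aKS q \<le> 1"
      "(\<Sum>j<vs1 vN. as1 aEP (vs1 vN * S + j) + as1 aEN (vs1 vN * S + j)) + (vs1 vto - vs1 vfrom) \<le> M"
      "(\<Sum>j<vs1 vN. (real (as1 aEP (vs1 vN * S + j)) - real (as1 aEN (vs1 vN * S + j))) * 2 powi e j) = real_of_int (e (vs vbase))"
      using f ids NS s1 exw[OF bN] wN nN_le_M[OF NS(1)] by (simp_all add: v1 N_def[symmetric])
    note sub = wp_subtract_list[OF this]
    show "wp subtract_list (wp compare_all (wp (Write aD (Plus (Var vnr) (Var vN)) (Num 0)) (wp place_node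
      (wp (vN ::= Plus (Var vN) (Num 1)) ?Q)))) vs1 as1"
    proof (rule wp_conseq[OF sub], unfold v1)
      fix vs2 as2 assume u2: "unchanged subtract_list vs1 as1 vs2 as2"
        and A2: "(\<Sum>j<N. (real (as2 aEP (N * S + j)) - real (as2 aEN (N * S + j))) * 2 powi e j) =
          real_of_int (e (vs vbase)) - list_value e (as aKI) (as aKS) (vs vfrom) (vs vto) \<and>
          (\<Sum>j<N. as2 aEP (N * S + j) + as2 aEN (N * S + j)) =
          (\<Sum>j<N. as1 aEP (N * S + j) + as1 aEN (N * S + j)) + (vs vto - vs vfrom) \<and>
          (\<forall>i. i < N * S \<or> N * S + N \<le> i \<longrightarrow> as2 aEP i = as1 aEP i \<and> as2 aEN i = as1 aEN i)"
      have fr2: "\<And>v. v \<notin> {vnr, vbr, vj, vq, vid, vsg} \<Longrightarrow> vs2 v = vs v" "\<And>k. k \<notin> {aEP, aEN} \<Longrightarrow> as2 k = as k"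
        "vs2 vnr = N * S"
        using u2 fr1 v1 by (auto simp: unchanged_def new_power_mod)
      have v2: "vs2 vN = N" using fr2 by (simp add: N_def)
      have old: "as2 aEP i = as aEP i" "as2 aEN i = as aEN i" if "i < N * S \<or> N * S + N \<le> i" for i
        using A A2 that by auto
      have newv: "(\<Sum>j<N. (real (as2 aEP (N * S + j)) - real (as2 aEN (N * S + j))) * 2 powi e j) = of_int x"
        using A2 k by (simp add: x_def)
      have neww: "(\<Sum>j<N. as2 aEP (N * S + j) + as2 aEN (N * S + j)) \<le> n * N"
        using A2 s1 exw[OF bN] wN by simp
      have oldv: "(\<Sum>j<N. (real (as2 aEP (i * S + j)) - real (as2 aEN (i * S + j))) * 2 powi e j) = e i"
        and oldw: "(\<Sum>j<N. as2 aEP (i * S + j) + as2 aEN (i * S + j)) \<le> n * i" if "i < N" for i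
        using exv[OF that] exw[OF that] row_index_less[OF that, of _ S] NS(1) by (simp_all add: old)
      have p2: "powers e vs2 as2"
        by (rule powers_cong[OF p]) (use fr2 in auto)
      have "\<And>i. i < vs2 vN \<Longrightarrow> (\<Sum>j<vs2 vN. (real (as2 aEP (i * S + j)) - real (as2 aEN (i * S + j))) * 2 powi e j) = e i"
        "\<And>i. i \<le> vs2 vN \<Longrightarrow> (\<Sum>j<vs2 vN. as2 aEP (i * S + j) + as2 aEN (i * S + j)) \<le> n * i"
        "(\<Sum>j<vs2 vN. (real (as2 aEP (vs2 vN * S + j)) - real (as2 aEN (vs2 vN * S + j))) * 2 powi e j) = of_int x"
        "vs2 vnr = vs2 vN * S"
        using oldv oldw newv neww fr2(3) unfolding v2 by (auto simp: le_less)
      note comp = wp_compare_all[OF p2 this(4,1,2,3)]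
      show "wp compare_all (wp (Write aD (Plus (Var vnr) (Var vN)) (Num 0)) (wp place_node
        (wp (vN ::= Plus (Var vN) (Num 1)) ?Q))) vs2 as2"
      proof (rule wp_conseq[OF comp], unfold v2)
        fix vs3 as3 assume u3: "unchanged compare_all vs2 as2 vs3 as3"
          and A3: "vs3 vp = card {j. j < N \<and> x \<le> e j} \<and>
            (\<forall>j<N. as3 aD (N * S + j) = nat (min (int G) (x - e j)) \<and> as3 aD (j * S + N) = nat (min (int G) (e j - x))) \<and>
            (\<forall>i<N. \<forall>j<N. as3 aD (i * S + j) = as2 aD (i * S + j))"
        have fr3: "\<And>v. v \<notin> mod_vars compare_all \<Longrightarrow> vs3 v = vs2 v" "\<And>k. k \<notin> {aD, aCP, aCN} \<Longrightarrow> as3 k = as2 k"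
          using u3 by (auto simp: unchanged_def new_power_mod)
        have v3: "vs3 vN = N" "vs3 vnr = N * S" using fr3 v2 fr2 by (simp_all add: new_power_mod)
        have "card {j. j < N \<and> x \<le> e j} \<le> card {..<N}" by (intro card_mono) auto
        then have pN: "vs3 vp \<le> vs3 vN" "vs3 vN < S" using A3 v3 NS by simp_all
        let ?D = "(as3 aD)(N * S + N := 0)" and ?as = "as3(aD := (as3 aD)(N * S + N := 0))"
        have "wp place_node (wp (vN ::= Plus (Var vN) (Num 1)) ?Q) vs3 ?as"
        proof (rule wp_conseq[OF wp_place_node[OF pN]], unfold v3)
          fix vs4 as4 assume u4: "unchanged place_node vs3 ?as vs4 as4"
            and A4: "as4 aORD = (\<lambda>i. if i = vs3 vp then N else if vs3 vp < i \<and> i \<le> N then ?as aORD (i - 1) else ?as aORD i)"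
          have fr4: "\<And>v. v \<noteq> vj \<Longrightarrow> vs4 v = vs3 v" "\<And>k. k \<noteq> aORD \<Longrightarrow> as4 k = ?as k"
            using u4 by (auto simp: unchanged_def new_power_mod)
          have ord: "as4 aORD = (\<lambda>i. if i = vs3 vp then N else if vs3 vp < i \<and> i \<le> N then as aORD (i - 1) else as aORD i)"
          proof -
            have "?as aORD = as aORD" using fr3(2) fr2(2) by simp
            then show ?thesis unfolding A4 by (simp only:)
          qed
          have bij: "bij_betw (as aORD) {..<N} {..<N}" using pD(7) by (simp add: N_def)
          have srt: "i \<le> j \<Longrightarrow> j < N \<Longrightarrow> e (as aORD j) \<le> e (as aORD i)" for i j using pD(9) by (simp add: N_def)
          have vp: "vs3 vp = card {j. j < N \<and> x \<le> e j}" using A3 by blast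
          note ins = insert_sorted[OF bij srt vp ord]
          let ?vs = "vs4(vN := Suc N)"
          have D: "as4 aD (i * S + j) = nat (min (int G) (e' i - e' j))" if "i < Suc N" "j < Suc N" for i j
          proof -
            have "i * S + j = N * S + N \<longleftrightarrow> i = N \<and> j = N"
              using row_index_eq[of j S N i N] that NS by simp
            moreover have "i < N \<Longrightarrow> j < N \<Longrightarrow> as3 aD (i * S + j) = nat (min (int G) (e i - e j))"
              using A3 fr2(2) pD(10)[of i j] by (simp add: N_def)
            ultimately show ?thesis using that A3 fr4(2) by (auto simp: e'_def less_Suc_eq)
          qed
          have pw: "powers e' ?vs as4"
            unfolding powers_def
          proof (intro conjI)
            show "?vs vS = S" "?vs vG = G" "?vs vB = B" using pD(1-3) fr4 fr3 fr2 by (simp_all add: new_power_mod)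
            show "?vs vN < S" "0 < ?vs vN" using NS by simp_all
            show "e' 0 = 0" using pD(4,6) by (simp add: e'_def N_def)
            show "bij_betw (as4 aORD) {..<?vs vN} {..<?vs vN}" using ins(1) by simp
            show "\<forall>i j. i \<le> j \<longrightarrow> j < ?vs vN \<longrightarrow> e' (as4 aORD j) \<le> e' (as4 aORD i)"
              using ins(2) by (simp add: e'_def)
            show "\<forall>i<?vs vN. \<forall>j<?vs vN. as4 aD (i * S + j) = nat (min (int G) (e' i - e' j))" using D by simp
            show "\<forall>i<S. as4 aROW i = i * S" "\<forall>i\<le>2 * M. as4 aH i = i div 2"
              using pD(12,13) fr4(2) fr3(2) fr2(2) by simp_all
          qed
          have E4: "as4 aEP = as2 aEP" "as4 aEN = as2 aEN" using fr4(2) fr3(2) by simp_all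
          \<comment> \<open>Row \<open>N\<close> was written in its leading \<open>N\<close> columns
            only; column \<open>N\<close> and all later rows are still zero.\<close>
          have zero: "as2 aEP (i * S + j) = 0 \<and> as2 aEN (i * S + j) = 0"
            if "i < S" "j < S" "N < i \<or> N \<le> j" for i j
          proof -
            have "i * S + j < N * S \<or> N * S + N \<le> i * S + j"
            proof (cases "i < N")
              case True
              then show ?thesis using row_index_less that(2) by blast
            next
              case False
              show ?thesis
              proof (cases "i = N")
                case True
                then show ?thesis using that by simp
              next
                case F: False
                then have "Suc N * S \<le> i * S" using False by (intro mult_le_mono1) simp
                then show ?thesis using NS by simp
              qed
            qed
            moreover have "N \<le> i \<or> N \<le> j" using that(3) by auto
            ultimately show ?thesis using ex0[OF that(1,2)] old by simp
          qed
          have exp: "exponents e' ?vs as4"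
            unfolding exponents_def E4
          proof (intro conjI allI impI)
            fix i assume "i < ?vs vN"
            then have i: "i < N \<or> i = N" "i < S" using NS by auto
            have z: "as2 aEP (i * S + N) = 0 \<and> as2 aEN (i * S + N) = 0" using zero i NS by simp
            have "(\<Sum>j<Suc N. (real (as2 aEP (i * S + j)) - real (as2 aEN (i * S + j))) * 2 powi e' j) =
                (\<Sum>j<N. (real (as2 aEP (i * S + j)) - real (as2 aEN (i * S + j))) * 2 powi e j)"
              using z by (simp add: e'_def)
            then show "(\<Sum>j<?vs vN. (real (as2 aEP (i * S + j)) - real (as2 aEN (i * S + j))) * 2 powi e' j) = e' i"
              using i oldv newv by (auto simp: e'_def)
            show "(\<Sum>j<?vs vN. as2 aEP (i * S + j) + as2 aEN (i * S + j)) \<le> n * i"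
              using z i oldw neww by auto
          next
            fix i j assume "i < S" "j < S" "?vs vN \<le> i \<or> ?vs vN \<le> j"
            then show "as2 aEP (i * S + j) = 0" "as2 aEN (i * S + j) = 0" using zero[of i j] by auto
          qed
          show "wp (vN ::= Plus (Var vN) (Num 1)) ?Q vs4 as4"
          proof -
            have "Suc N \<le> V" using NS(2) small_le_V(8) by linarith
            then show ?thesis using pw exp V(2) fr4(1) v3 by (simp add: e'_def x_def)
          qed
        qed
        moreover have "N * S + N \<le> V" using row_le_V NS by simp
        ultimately show "wp (Write aD (Plus (Var vnr) (Var vN)) (Num 0)) (wp place_node
          (wp (vN ::= Plus (Var vN) (Num 1)) ?Q)) vs3 as3"
          by (simp add: v3)
      qed
    qed
  qed
qed

end

section \<open>The reduction as a program\<close>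

definition push :: "nat \<Rightarrow> com" where
  "push b = vL ::= Plus (Var vL) (Num 1) ;; Write aLR (Var vL) (Var vR) ;; Write aLK (Var vL) (Var vK) ;;
    Write aLE (Var vL) (Num b)"

definition append_power :: "aexp \<Rightarrow> com" where
  "append_power s = new_power ;; Write aRI (Var vR) (Minus (Var vN) (Num 1)) ;; Write aRS (Var vR) s ;;
    vR ::= Plus (Var vR) (Num 1)"

text \<open>The letter adds a signed \<open>2^-k\<close>: power number 0 has exponent 0, and the
  segment is the top list for \<open>k\<close>. The codes 1 and 2 become the signs 1 and 0.\<close>

definition read_a :: com where
  "read_a = vbase ::= Num 0 ;; vfrom ::= Arr aLK (Var vL) ;; vto ::= Var vK ;;
    append_power (Minus (Num 2) (Var vc))"

text \<open>The new entry refers to power number 0, which is 1; the codes 3 and 4 become the signs 1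
  and 0.\<close>

definition read_t :: com where
  "read_t = Write aKI (Var vK) (Num 0) ;; Write aKS (Var vK) (Minus (Num 4) (Var vc)) ;;
    vK ::= Plus (Var vK) (Num 1)"

definition test_t :: com where
  "test_t = vfrom ::= Arr aLK (Var vL) ;; vto ::= Var vK ;; eval_list aKI aKS"

definition test_a :: com where
  "test_a = vfrom ::= Arr aLR (Var vL) ;; vto ::= Var vR ;; eval_list aRI aRS"

text \<open>Vanishes exactly for an integral sum whose two cut-offs are both 0, that is for the sum
  0.\<close>

definition nonzero :: aexp where
  "nonzero = Plus (Var vF) (Plus (Var vOX) (Var vOY))"

text \<open>In a pinch the list for \<open>k\<close> has value 0 but need not be empty; resetting
  \<open>vK\<close> discards it. The list for \<open>r\<close> is then appended to the list for
  \<open>k\<close> of the level below, which ends at that place.\<close>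

definition pop_a :: com where
  "pop_a = vK ::= Arr aLK (Var vL) ;; vfrom ::= Arr aLR (Var vL) ;;
    For 1 vqq (Minus (Var vR) (Var vfrom)) (
      Write aKI (Var vK) (Arr aRI (Plus (Var vfrom) (Var vqq))) ;;
      Write aKS (Var vK) (Arr aRS (Plus (Var vfrom) (Var vqq))) ;;
      vK ::= Plus (Var vK) (Num 1)) ;;
    vR ::= Var vfrom ;; vL ::= Minus (Var vL) (Num 1)"

text \<open>Multiplying \<open>k\<close> by \<open>2^-k'\<close> lowers each exponent by
  \<open>k'\<close>, so every entry of its list becomes a new power with the old one as base. The
  segment from \<open>vfrom\<close> to \<open>vto\<close> is the list for \<open>k'\<close>; the
  list for \<open>r\<close>, of value 0, is discarded.\<close>

definition pop_t :: com where
  "pop_t = vR ::= Arr aLR (Var vL) ;; vto ::= Arr aLK (Var vL) ;; vfrom ::= Arr aLK (Minus (Var vL) (Num 1)) ;;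
    For 1 vqq (Minus (Var vK) (Var vto)) (
      vbase ::= Arr aKI (Plus (Var vto) (Var vqq)) ;;
      append_power (Arr aKS (Plus (Var vto) (Var vqq)))) ;;
    vK ::= Var vto ;; vL ::= Minus (Var vL) (Num 1)"

definition read_b :: com where
  "read_b = vok ::= Num 0 ;;
    Cond (Var vL) (Cond (Arr aLE (Var vL)) Nop
      (test_t ;; Cond nonzero Nop (test_a ;; Cond (Var vF) Nop (vok ::= Num 1)))) Nop ;;
    Cond (Var vok) pop_a (push 1)"

definition read_b_inv :: com where
  "read_b_inv = vok ::= Num 0 ;;
    Cond (Var vL) (Cond (Arr aLE (Var vL)) (test_a ;; Cond nonzero Nop (vok ::= Num 1)) Nop) Nop ;;
    Cond (Var vok) pop_t (push 0)"

text \<open>Truncated subtraction makes the conditions tests for a code below 3, 5 and 6.\<close>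

definition read_letter :: com where
  "read_letter = vc ::= Inp (Var vi) ;;
    Cond (Minus (Num 3) (Var vc)) read_a (Cond (Minus (Num 5) (Var vc)) read_t
      (Cond (Minus (Num 6) (Var vc)) read_b read_b_inv))"

definition answer :: com where
  "answer = vok ::= Num 0 ;;
    Cond (Var vL) Nop (test_t ;; Cond nonzero Nop (test_a ;; Cond nonzero Nop (vok ::= Num 1))) ;;
    vn ::= Var vok"

text \<open>Products are formed by repeated addition: \<open>n\<close> copies of
  \<open>S - 1\<close>, doubled, give \<open>M\<close>. As \<open>M\<close> is about
  \<open>2 * n^3\<close>, which exceeds \<open>\<beta>^3\<close> for large \<open>n\<close>, the
  loop for the halving table is declared with degree 4.\<close>

definition initialise :: com where
  "initialise =
    vS ::= Num 2 ;; Rep 1 (Var vn) (vS ::= Plus (Var vS) (Var vn)) ;;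
    vG ::= Plus (Var vn) (Num 12) ;;
    vx ::= Num 0 ;; Rep 1 (Var vn) (vx ::= Plus (Var vx) (Minus (Var vS) (Num 1))) ;;
    vx ::= Plus (Var vx) (Var vx) ;; vB ::= Plus (Plus (Var vx) (Var vx)) (Var vG) ;;
    For 4 vj (Plus (Var vx) (Num 1)) (
      Write aH (Plus (Var vj) (Var vj)) (Var vj) ;;
      Write aH (Plus (Plus (Var vj) (Var vj)) (Num 1)) (Var vj)) ;;
    vy ::= Num 0 ;;
    For 2 vj (Var vS) (Write aROW (Var vj) (Var vy) ;; vy ::= Plus (Var vy) (Var vS)) ;;
    vN ::= Num 1"

definition word_problem_program :: com where
  "word_problem_program = initialise ;; For 1 vi (Var vn) read_letter ;; answer"

text \<open>The maximum is attained in \<open>pop_t\<close>: one degree for the letters, one for the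
  entries moved and five for \<open>new_power\<close>.\<close>

lemma word_problem_program_degree: "loop_degree word_problem_program = 7"
  by (simp add: word_problem_program_def initialise_def read_letter_def answer_def read_a_def read_t_def
      read_b_def read_b_inv_def pop_a_def pop_t_def push_def test_a_def test_t_def append_power_def
      new_power_degree)

abbreviation "number_arrs \<equiv> {aEP, aEN, aD, aCP, aCN, aORD}"

lemma program_mod:
  "mod_vars test_t = {vfrom, vto, vq, vsg} \<union> mod_vars eval_coeffs" "mod_arrs test_t = {aCP, aCN}"
  "mod_vars test_a = {vfrom, vto, vq, vsg} \<union> mod_vars eval_coeffs" "mod_arrs test_a = {aCP, aCN}"
  "mod_vars (append_power s) = insert vR (mod_vars new_power)"
  "mod_arrs (append_power s) = {aRI, aRS} \<union> mod_arrs new_power"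
  by (rule equalityI; simp add: test_t_def test_a_def append_power_def new_power_mod)+

lemma read_letter_mod: "vi \<notin> mod_vars read_letter" "vn \<notin> mod_vars read_letter"
  by (simp_all add: read_letter_def read_a_def read_t_def read_b_def read_b_inv_def pop_a_def pop_t_def
      push_def program_mod new_power_mod)

section \<open>The invariant of the stack of lists\<close>

lemma list_value_cong:
  assumes "\<And>q. a \<le> q \<Longrightarrow> q < b \<Longrightarrow> I' q = I q \<and> s' q = s q \<and> e' (I q) = e (I q)"
  shows "list_value e' I' s' a b = list_value e I s a b"
  unfolding list_value_def term_value_def by (rule sum.cong) (use assms in auto)

lemma list_value_step: "a \<le> b \<Longrightarrow> list_value e I s a (Suc b) = list_value e I s a b + term_value e I s b"
  by (simp add: list_value_def)

context solver
begin

text \<open>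
  The two numbers of the top pair are the segments of the lists \<open>aRI, aRS\<close> and \<open>aKI, aKS\<close> from the
  entries of \<open>aLR\<close> and \<open>aLK\<close> for the top level on; the lower levels own the earlier segments. The
  second number is real here, because it need not be an integer while \<open>pop_a\<close> runs.
\<close>

fun config :: "(nat \<Rightarrow> int) \<Rightarrow> arrs \<Rightarrow> nat \<Rightarrow> nat \<Rightarrow> nat \<Rightarrow> real \<Rightarrow> real \<Rightarrow> (bool \<times> real \<times> int) list \<Rightarrow> bool" where
  "config e as L R K r k [] \<longleftrightarrow> L = 0 \<and> as aLR 0 = 0 \<and> as aLK 0 = 0 \<and>
    r = list_value e (as aRI) (as aRS) 0 R \<and> k = list_value e (as aKI) (as aKS) 0 K"
| "config e as L R K r k ((b, r', k') # l) \<longleftrightarrow> 0 < L \<and> as aLE L = (if b then 1 else 0) \<and>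
    as aLR L \<le> R \<and> as aLK L \<le> K \<and> r = list_value e (as aRI) (as aRS) (as aLR L) R \<and>
    k = list_value e (as aKI) (as aKS) (as aLK L) K \<and>
    config e as (L - 1) (as aLR L) (as aLK L) r' (of_int k') l"

lemma configD:
  assumes "config e as L R K r k l"
  shows "as aLR L \<le> R" "as aLK L \<le> K" "r = list_value e (as aRI) (as aRS) (as aLR L) R"
    "k = list_value e (as aKI) (as aKS) (as aLK L) K" "L = 0 \<longleftrightarrow> l = []"
  using assms by (cases l; auto)+

lemma config_cong:
  assumes "config e as L R K r k l"
    and "\<And>q. q < R \<Longrightarrow> as' aRI q = as aRI q \<and> as' aRS q = as aRS q \<and> e' (as aRI q) = e (as aRI q)"
    and "\<And>q. q < K \<Longrightarrow> as' aKI q = as aKI q \<and> as' aKS q = as aKS q \<and> e' (as aKI q) = e (as aKI q)"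
    and "\<And>i. i \<le> L \<Longrightarrow> as' aLR i = as aLR i \<and> as' aLK i = as aLK i \<and> as' aLE i = as aLE i"
  shows "config e' as' L R K r k l"
  using assms
proof (induction l arbitrary: L R K r k)
  case Nil
  have "list_value e' (as' aRI) (as' aRS) 0 R = list_value e (as aRI) (as aRS) 0 R"
    "list_value e' (as' aKI) (as' aKS) 0 K = list_value e (as aKI) (as aKS) 0 K"
    using Nil.prems by (auto intro!: list_value_cong)
  with Nil.prems show ?case by simp
next
  case (Cons p l)
  obtain b r' k' where p: "p = (b, r', k')" by (cases p) auto
  have "list_value e' (as' aRI) (as' aRS) (as aLR L) R = list_value e (as aRI) (as aRS) (as aLR L) R"
    "list_value e' (as' aKI) (as' aKS) (as aLK L) K = list_value e (as aKI) (as aKS) (as aLK L) K"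
    using Cons.prems by (auto intro!: list_value_cong)
  moreover have "config e' as' (L - 1) (as aLR L) (as aLK L) r' (of_int k') l"
    by (rule Cons.IH) (use Cons.prems p in auto)
  ultimately show ?case using Cons.prems by (simp add: p)
qed

lemma config_append_R:
  assumes "config e as L R K r k l"
  shows "config e as L (Suc R) K (r + term_value e (as aRI) (as aRS) R) k l"
  using assms by (cases l) (auto simp: list_value_step)

lemma config_append_K:
  assumes "config e as L R K r k l"
  shows "config e as L R (Suc K) r (k + term_value e (as aKI) (as aKS) K) l"
  using assms by (cases l) (auto simp: list_value_step)

definition state :: "(nat \<Rightarrow> int) \<Rightarrow> real \<Rightarrow> real \<Rightarrow> (bool \<times> real \<times> int) list \<Rightarrow> vars \<Rightarrow> arrs \<Rightarrow> bool" where
  "state e r k l vs as \<longleftrightarrow> powers e vs as \<and> exponents e vs as \<and>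
    (\<forall>q<vs vR. as aRI q < vs vN \<and> as aRS q \<le> 1) \<and> (\<forall>q<vs vK. as aKI q < vs vN \<and> as aKS q \<le> 1) \<and>
    config e as (vs vL) (vs vR) (vs vK) r k l"

lemma state_cong:
  assumes s: "state e r k l vs as"
    and v: "\<And>v. v \<in> {vS, vG, vB, vN, vL, vR, vK} \<Longrightarrow> vs' v = vs v"
    and a: "\<And>k. k \<notin> {aCP, aCN} \<Longrightarrow> as' k = as k"
  shows "state e r k l vs' as'"
proof -
  have "powers e vs' as'" using s unfolding state_def by (elim conjE powers_cong) (use v a in auto)
  moreover have "exponents e vs' as'" using s v a unfolding state_def exponents_def by simp
  moreover have "config e as' (vs' vL) (vs' vR) (vs' vK) r k l"
  proof (rule config_cong)
    show "config e as (vs' vL) (vs' vR) (vs' vK) r k l" using s v by (simp add: state_def)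
  qed (use a in auto)
  ultimately show ?thesis using s v a by (simp add: state_def)
qed

text \<open>A letter lengthens the lists by at most one entry in total, since pops only move or drop
  entries, and it inserts at most \<open>n\<close> powers; hence the budgets after \<open>m\<close>
  letters. The exponents \<open>e\<close> are hidden because insertions extend them.\<close>

definition tracks :: "nat \<Rightarrow> config \<Rightarrow> vars \<Rightarrow> arrs \<Rightarrow> bool" where
  "tracks m s vs as \<longleftrightarrow> vs vN \<le> 1 + m * n \<and> vs vR + vs vK \<le> m \<and> vs vL \<le> m \<and>
    (\<exists>e. state e (fst s) (of_int (fst (snd s))) (snd (snd s)) vs as)"

lemma tracks_cong:
  assumes "tracks m s vs as" "\<And>v. v \<in> {vS, vG, vB, vN, vL, vR, vK} \<Longrightarrow> vs' v = vs v"
    "\<And>k. k \<notin> {aCP, aCN} \<Longrightarrow> as' k = as k"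
  shows "tracks m s vs' as'"
proof -
  from assms(1) obtain e where "state e (fst s) (of_int (fst (snd s))) (snd (snd s)) vs as"
    unfolding tracks_def by blast
  from state_cong[OF this assms(2,3)] assms(1,2) show ?thesis unfolding tracks_def by auto
qed

lemma exponents_cong:
  assumes "exponents e vs as" "vs' vN = vs vN" "as' aEP = as aEP" "as' aEN = as aEN"
  shows "exponents e vs' as'"
  using assms unfolding exponents_def by simp

lemma wp_eval_list_nonzero:
  assumes "powers e vs as" "vs vfrom \<le> vs vto" "vs vto \<le> n"
    "kI < 16" "kS < 16" "kI \<notin> {aCP, aCN}" "kS \<notin> {aCP, aCN}"
    "\<And>q. vs vfrom \<le> q \<Longrightarrow> q < vs vto \<Longrightarrow> as kI q < vs vN \<and> as kS q \<le> 1"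
    and v: "list_value e (as kI) (as kS) (vs vfrom) (vs vto) = v"
  shows "wp (eval_list kI kS) (\<lambda>vs' as'. safe nonzero vs' as' \<and> (vs' vF = 0 \<longleftrightarrow> v \<in> \<int>) \<and>
    (aval nonzero vs' as' = 0 \<longleftrightarrow> v = 0)) vs as"
proof (rule wp_mono[OF wp_eval_list[OF assms(1-8)]], assumption, unfold v)
  fix vs' :: vars and as' :: arrs
  assume A: "vs' vF \<le> 1 \<and> vs' vOX \<le> G \<and> vs' vOY \<le> G \<and> (vs' vF = 0 \<longleftrightarrow> v \<in> \<int>) \<and>
    (v \<in> \<int> \<longrightarrow> vs' vOX = nat (min (int G) \<lfloor>v\<rfloor>) \<and> vs' vOY = nat (min (int G) (- \<lfloor>v\<rfloor>)))"
  have "safe nonzero vs' as'"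
  proof -
    have "1 + 2 * B \<le> V" using bounds_V(1) V(2) by linarith
    then have "vs' vF + (vs' vOX + vs' vOY) \<le> V" using A small_le_V(4) by linarith
    then show ?thesis by (simp add: nonzero_def)
  qed
  moreover have "aval nonzero vs' as' = 0 \<longleftrightarrow> v = 0"
  proof (cases "v \<in> \<int>")
    case True
    then obtain z :: int where z: "v = of_int z" by (auto elim: Ints_cases)
    \<comment> \<open>A positive \<open>G\<close> keeps a nonzero integer nonzero in one of the two
      cut-offs.\<close>
    have "0 < int G" by (simp add: G_def)
    then show ?thesis using A True unfolding nonzero_def z by auto
  next
    case False
    then show ?thesis using A by (auto simp: nonzero_def)
  qed
  ultimately show "safe nonzero vs' as' \<and> (vs' vF = 0 \<longleftrightarrow> v \<in> \<int>) \<and> (aval nonzero vs' as' = 0 \<longleftrightarrow> v = 0)"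
    using A by blast
qed

lemma wp_test_t:
  assumes s: "state e r k l vs as" and K: "vs vK \<le> n"
  shows "wp test_t (\<lambda>vs' as'. safe nonzero vs' as' \<and> (vs' vF = 0 \<longleftrightarrow> k \<in> \<int>) \<and>
    (aval nonzero vs' as' = 0 \<longleftrightarrow> k = 0)) vs as"
proof -
  have c: "config e as (vs vL) (vs vR) (vs vK) r k l" using s by (simp add: state_def)
  note c = configD[OF c]
  let ?vs = "vs(vfrom := as aLK (vs vL), vto := vs vK)"
  have st: "state e r k l ?vs as" using s by (rule state_cong) auto
  have "wp (eval_list aKI aKS) (\<lambda>vs' as'. safe nonzero vs' as' \<and> (vs' vF = 0 \<longleftrightarrow> k \<in> \<int>) \<and>
    (aval nonzero vs' as' = 0 \<longleftrightarrow> k = 0)) ?vs as"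
    by (rule wp_eval_list_nonzero[of e]) (use st c K in \<open>auto simp: state_def\<close>)
  then show ?thesis by (simp add: test_t_def)
qed

lemma wp_test_a:
  assumes s: "state e r k l vs as" and R: "vs vR \<le> n"
  shows "wp test_a (\<lambda>vs' as'. safe nonzero vs' as' \<and> (vs' vF = 0 \<longleftrightarrow> r \<in> \<int>) \<and>
    (aval nonzero vs' as' = 0 \<longleftrightarrow> r = 0)) vs as"
proof -
  have c: "config e as (vs vL) (vs vR) (vs vK) r k l" using s by (simp add: state_def)
  note c = configD[OF c]
  let ?vs = "vs(vfrom := as aLR (vs vL), vto := vs vR)"
  have st: "state e r k l ?vs as" using s by (rule state_cong) auto
  have "wp (eval_list aRI aRS) (\<lambda>vs' as'. safe nonzero vs' as' \<and> (vs' vF = 0 \<longleftrightarrow> r \<in> \<int>) \<and>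
    (aval nonzero vs' as' = 0 \<longleftrightarrow> r = 0)) ?vs as"
    by (rule wp_eval_list_nonzero[of e]) (use st c R in \<open>auto simp: state_def\<close>)
  then show ?thesis by (simp add: test_a_def)
qed

text \<open>The sign is read after the insertion and after the write to \<open>aRI\<close>; the
  premise \<open>s\<close> says that its value survives both.\<close>

lemma wp_append_power:
  assumes p: "powers e vs as" "exponents e vs as" and b: "vs vbase < vs vN" and N: "vs vN \<le> n * n"
    and f: "vs vfrom \<le> vs vto" "vs vto \<le> n"
    and ids: "\<And>q. vs vfrom \<le> q \<Longrightarrow> q < vs vto \<Longrightarrow> as aKI q < vs vN \<and> as aKS q \<le> 1"
    and k: "list_value e (as aKI) (as aKS) (vs vfrom) (vs vto) = of_int k"
    and R: "vs vR < n"
    and s: "\<And>vs' as'. (\<And>v. v \<notin> mod_vars new_power \<Longrightarrow> vs' v = vs v) \<Longrightarrow>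
      (\<And>k. k \<notin> insert aRI number_arrs \<Longrightarrow> as' k = as k) \<Longrightarrow> safe s vs' as' \<and> aval s vs' as' = \<sigma>"
  defines "N \<equiv> vs vN"
  shows "wp (append_power s) (\<lambda>vs' as'. vs' vN = Suc N \<and> vs' vR = Suc (vs vR) \<and>
    powers (e(N := e (vs vbase) - k)) vs' as' \<and> exponents (e(N := e (vs vbase) - k)) vs' as' \<and>
    as' aRI = (as aRI)(vs vR := N) \<and> as' aRS = (as aRS)(vs vR := \<sigma>)) vs as"
  unfolding append_power_def wp.simps(4)
proof (rule wp_conseq[OF wp_new_power[OF p b N f ids k]], assumption, assumption, fold N_def)
  fix vs1 as1 assume u: "unchanged new_power vs as vs1 as1"
    and A: "vs1 vN = Suc N \<and> powers (e(N := e (vs vbase) - k)) vs1 as1 \<and> exponents (e(N := e (vs vbase) - k)) vs1 as1"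
  have fr: "\<And>v. v \<notin> mod_vars new_power \<Longrightarrow> vs1 v = vs v" "\<And>k. k \<notin> number_arrs \<Longrightarrow> as1 k = as k"
    using u by (auto simp: unchanged_def new_power_mod)
  have R1: "vs1 vR = vs vR" using fr(1) by (simp add: new_power_mod)
  have RA: "as1 aRI = as aRI" "as1 aRS = as aRS" using fr(2) by simp_all
  let ?as = "as1(aRI := (as aRI)(vs vR := N))"
  have s1: "safe s vs1 ?as \<and> aval s vs1 ?as = \<sigma>"
    by (rule s) (use fr in auto)
  let ?vs2 = "vs1(vR := Suc (vs vR))" and ?as2 = "?as(aRS := (as aRS)(vs vR := \<sigma>))"
  have p2: "powers (e(N := e (vs vbase) - k)) ?vs2 ?as2"
    by (rule powers_cong[where vs = vs1 and as = as1]) (use A in auto)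
  have e2: "exponents (e(N := e (vs vbase) - k)) ?vs2 ?as2"
    by (rule exponents_cong[where vs = vs1 and as = as1]) (use A in auto)
  have RV: "Suc (vs vR) \<le> V" using R small_le_V(9) by linarith
  show "wp (Write aRI (Var vR) (Minus (Var vN) (Num 1))) (wp (Write aRS (Var vR) s) (wp (vR ::= Plus (Var vR) (Num 1))
    (\<lambda>vs' as'. vs' vN = Suc N \<and> vs' vR = Suc (vs vR) \<and>
    powers (e(N := e (vs vbase) - k)) vs' as' \<and> exponents (e(N := e (vs vbase) - k)) vs' as' \<and>
    as' aRI = (as aRI)(vs vR := N) \<and> as' aRS = (as aRS)(vs vR := \<sigma>)))) vs1 as1"
    using A s1 p2 e2 RV V(2) by (simp add: R1 RA)
qed

section \<open>Reading one letter\<close>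

lemma wp_read_t:
  assumes T: "tracks m (r, k, l) vs as" and m: "m < n" and c: "vs vc = (if b then 3 else 4)"
  shows "wp read_t (tracks (Suc m) (britton_step (t3, b) (r, k, l))) vs as"
proof -
  obtain e where st: "state e r (of_int k) l vs as" and b: "vs vN \<le> 1 + m * n" "vs vR + vs vK \<le> m" "vs vL \<le> m"
    using T by (auto simp: tracks_def)
  let ?K = "vs vK"
  let ?as = "as(aKI := (as aKI)(?K := 0), aKS := (as aKS)(?K := 4 - vs vc))" and ?vs = "vs(vK := Suc ?K)"
  note pw = powersD[of e vs as]
  have p0: "powers e vs as" "exponents e vs as" using st by (auto simp: state_def)
  have "config e ?as (vs vL) (vs vR) ?K r (of_int k) l"
    by (rule config_cong[where as = as and e = e]) (use st in \<open>auto simp: state_def\<close>)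
  from config_append_K[OF this]
  have "config e ?as (vs vL) (vs vR) (Suc ?K) r (of_int k + term_value e (?as aKI) (?as aKS) ?K) l" .
  moreover have "of_int k + term_value e (?as aKI) (?as aKS) ?K = of_int (k + (if b then 1 else -1))"
    using c powersD(6)[OF p0(1)] by (simp add: term_value_def)
  moreover have "powers e ?vs ?as" by (rule powers_cong[OF p0(1)]) auto
  moreover have "exponents e ?vs ?as" by (rule exponents_cong[OF p0(2)]) auto
  ultimately have "state e r (of_int (k + (if b then 1 else -1))) l ?vs ?as"
    using st c powersD(4)[OF p0(1)] unfolding state_def by (auto simp: less_Suc_eq)
  then have "tracks (Suc m) (r, k + (if b then 1 else -1), l) ?vs ?as"
    using b unfolding tracks_def by auto
  moreover have "Suc ?K \<le> V" "4 \<le> V" using b m small_le_V(9) bounds_V(1) by (auto simp: B_def G_def)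
  ultimately show ?thesis by (simp add: read_t_def)
qed

text \<open>Room for one more power: up to \<open>1 + m * n\<close> stem from the start and
  \<open>m\<close> letters, and \<open>q\<close> from the letter being read.\<close>

lemma count_bound: "m < n \<Longrightarrow> q < m \<Longrightarrow> 1 + m * n + q \<le> n * n" "m < n \<Longrightarrow> 1 + m * n \<le> n * n"
proof -
  assume "m < n"
  then have "m * n + n \<le> n * n" using mult_le_mono1[of "Suc m" n n] by simp
  then show "q < m \<Longrightarrow> 1 + m * n + q \<le> n * n" "1 + m * n \<le> n * n"
    using \<open>m < n\<close> by linarith+
qed

lemma wp_read_a:
  assumes T: "tracks m (r, k, l) vs as" and m: "m < n" and c: "vs vc = (if b then 1 else 2)"
  shows "wp read_a (tracks (Suc m) (britton_step (a3, b) (r, k, l))) vs as"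
proof -
  obtain e where st: "state e r (of_int k) l vs as" and b: "vs vN \<le> 1 + m * n" "vs vR + vs vK \<le> m" "vs vL \<le> m"
    using T by (auto simp: tracks_def)
  let ?vs = "vs(vbase := 0, vfrom := as aLK (vs vL), vto := vs vK)"
  define N where "N = vs vN"
  define \<sigma> :: nat where "\<sigma> = (if b then 1 else 0)"
  have c0: "config e as (vs vL) (vs vR) (vs vK) r (of_int k) l" using st by (simp add: state_def)
  have p0: "powers e vs as" "exponents e vs as" using st by (auto simp: state_def)
  have "powers e ?vs as" "exponents e ?vs as"
    by (rule powers_cong[OF p0(1)], auto) (rule exponents_cong[OF p0(2)], auto)
  moreover have "?vs vbase < ?vs vN" "?vs vN \<le> n * n" "?vs vfrom \<le> ?vs vto" "?vs vto \<le> n" "?vs vR < n"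
    "\<And>q. ?vs vfrom \<le> q \<Longrightarrow> q < ?vs vto \<Longrightarrow> as aKI q < ?vs vN \<and> as aKS q \<le> 1"
    "list_value e (as aKI) (as aKS) (?vs vfrom) (?vs vto) = of_int k"
    using powersD(4)[OF p0(1)] b m count_bound(2)[OF m] configD(2,4)[OF c0] st by (auto simp: state_def)
  moreover have "safe (Minus (Num 2) (Var vc)) vs' as' \<and> aval (Minus (Num 2) (Var vc)) vs' as' = \<sigma>"
    if "\<And>v. v \<notin> mod_vars new_power \<Longrightarrow> vs' v = ?vs v" for vs' as'
    using that c bounds_V(1) by (auto simp: \<sigma>_def new_power_mod B_def G_def)
  ultimately have "wp (append_power (Minus (Num 2) (Var vc))) (\<lambda>vs' as'. vs' vN = Suc (?vs vN) \<and> vs' vR = Suc (?vs vR) \<and>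
    powers (e(?vs vN := e (?vs vbase) - k)) vs' as' \<and> exponents (e(?vs vN := e (?vs vbase) - k)) vs' as' \<and>
    as' aRI = (as aRI)(?vs vR := ?vs vN) \<and> as' aRS = (as aRS)(?vs vR := \<sigma>)) ?vs as"
    by (intro wp_append_power) blast+
  then have "wp (append_power (Minus (Num 2) (Var vc))) (tracks (Suc m) (britton_step (a3, b) (r, k, l))) ?vs as"
  proof (rule wp_conseq)
    fix vs1 as1 assume u: "unchanged (append_power (Minus (Num 2) (Var vc))) ?vs as vs1 as1"
      and "vs1 vN = Suc (?vs vN) \<and> vs1 vR = Suc (?vs vR) \<and>
      powers (e(?vs vN := e (?vs vbase) - k)) vs1 as1 \<and> exponents (e(?vs vN := e (?vs vbase) - k)) vs1 as1 \<and>
      as1 aRI = (as aRI)(?vs vR := ?vs vN) \<and> as1 aRS = (as aRS)(?vs vR := \<sigma>)"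
    then have A: "vs1 vN = Suc N" "vs1 vR = Suc (vs vR)" "powers (e(N := - k)) vs1 as1" "exponents (e(N := - k)) vs1 as1"
      "as1 aRI = (as aRI)(vs vR := N)" "as1 aRS = (as aRS)(vs vR := \<sigma>)"
      using powersD(6)[OF p0(1)] by (simp_all add: N_def)
    have fr: "vs1 vL = vs vL" "vs1 vK = vs vK" "\<And>k. k \<notin> insert aRI (insert aRS number_arrs) \<Longrightarrow> as1 k = as k"
      using u by (auto simp: unchanged_def program_mod new_power_mod)
    have fr': "as1 aKI = as aKI" "as1 aKS = as aKS" "as1 aLR = as aLR" "as1 aLK = as aLK" "as1 aLE = as aLE"
      using fr(3) by simp_all
    have ids: "\<And>q. q < vs vR \<Longrightarrow> as aRI q < N" "\<And>q. q < vs vK \<Longrightarrow> as aKI q < N" using st by (auto simp: state_def N_def)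
    \<comment> \<open>The number \<open>N\<close> is new, so no list entry refers to it and the old
      values persist.\<close>
    have "config (e(N := - k)) as1 (vs vL) (vs vR) (vs vK) r (of_int k) l"
    proof (rule config_cong[OF c0])
      show "\<And>q. q < vs vR \<Longrightarrow> as1 aRI q = as aRI q \<and> as1 aRS q = as aRS q \<and> (e(N := - k)) (as aRI q) = e (as aRI q)"
        using A ids by fastforce
      show "\<And>q. q < vs vK \<Longrightarrow> as1 aKI q = as aKI q \<and> as1 aKS q = as aKS q \<and> (e(N := - k)) (as aKI q) = e (as aKI q)"
        using fr' ids by fastforce
    qed (use fr' in auto)
    from config_append_R[OF this]
    have "config (e(N := - k)) as1 (vs1 vL) (vs1 vR) (vs1 vK) (r + (if b then 1 else -1) * 2 powi (- k)) (of_int k) l"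
      using A fr by (simp add: term_value_def \<sigma>_def split: if_splits)
    then have "state (e(N := - k)) (r + (if b then 1 else -1) * 2 powi (- k)) (of_int k) l vs1 as1"
      using A fr fr' st unfolding state_def by (auto simp: less_Suc_eq N_def \<sigma>_def)
    then show "tracks (Suc m) (britton_step (a3, b) (r, k, l)) vs1 as1"
      using A b m fr unfolding tracks_def by (auto simp: N_def)
  qed
  moreover have "vs vL \<le> V" using b m small_le_V(9) by linarith
  ultimately show ?thesis by (simp add: read_a_def)
qed

lemma wp_push:
  assumes T: "tracks m (r, k, l) vs as" and m: "m < n"
  shows "wp (push (if b then 1 else 0)) (tracks (Suc m) (0, 0, (b, r, k) # l)) vs as"
proof -
  obtain e where st: "state e r (of_int k) l vs as" and b: "vs vN \<le> 1 + m * n" "vs vR + vs vK \<le> m" "vs vL \<le> m"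
    using T by (auto simp: tracks_def)
  let ?L = "Suc (vs vL)"
  let ?as = "as(aLR := (as aLR)(?L := vs vR), aLK := (as aLK)(?L := vs vK), aLE := (as aLE)(?L := if b then 1 else 0))"
  let ?vs = "vs(vL := ?L)"
  have p0: "powers e vs as" "exponents e vs as" using st by (auto simp: state_def)
  have "config e ?as (vs vL) (vs vR) (vs vK) r (of_int k) l"
    by (rule config_cong[where as = as and e = e]) (use st in \<open>auto simp: state_def\<close>)
  then have "config e ?as (?vs vL) (vs vR) (vs vK) 0 (of_int 0) ((b, r, k) # l)"
    by (simp add: list_value_def)
  moreover have "powers e ?vs ?as" by (rule powers_cong[OF p0(1)]) auto
  moreover have "exponents e ?vs ?as" by (rule exponents_cong[OF p0(2)]) auto
  ultimately have "state e 0 (of_int 0) ((b, r, k) # l) ?vs ?as"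
    using st unfolding state_def by simp
  then have "tracks (Suc m) (0, 0, (b, r, k) # l) ?vs ?as" using b unfolding tracks_def by auto
  moreover have "Suc (vs vL) \<le> V" using b m small_le_V(9) by linarith
  ultimately show ?thesis using V(2) by (simp add: push_def)
qed

lemma tracks_Suc: "tracks m s vs as \<Longrightarrow> tracks (Suc m) s vs as"
  unfolding tracks_def by auto

lemma wp_pop_a:
  assumes T: "tracks m (r, k, (b, r', k') # l) vs as" and m: "m < n" and r: "r \<in> \<int>"
  shows "wp pop_a (tracks m (r', k' + \<lfloor>r\<rfloor>, l)) vs as"
proof -
  obtain e where st: "state e r (of_int k) ((b, r', k') # l) vs as"
    and bd: "vs vN \<le> 1 + m * n" "vs vR + vs vK \<le> m" "vs vL \<le> m"
    using T by (auto simp: tracks_def)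
  define L R K N where "L = vs vL" and "R = vs vR" and "K = vs vK" and "N = vs vN"
  define a d where "a = as aLR L" and "d = as aLK L"
  have p0: "powers e vs as" "exponents e vs as"
    and c: "0 < L" "a \<le> R" "d \<le> K" "r = list_value e (as aRI) (as aRS) a R"
      "config e as (L - 1) a d r' (of_int k') l"
    and ids: "\<And>q. q < R \<Longrightarrow> as aRI q < N \<and> as aRS q \<le> 1" "\<And>q. q < K \<Longrightarrow> as aKI q < N \<and> as aKS q \<le> 1"
    using st by (auto simp: state_def a_def d_def L_def R_def K_def N_def)
  let ?vs = "vs(vK := d, vfrom := a)"
  \<comment> \<open>Only the levels below the top are described: their last list for
    \<open>k\<close> has received the leading \<open>q\<close> entries of the list for
    \<open>r\<close>.\<close>
  define J where "J q vs' as' \<longleftrightarrow> (\<forall>v. v \<notin> {vK, vqq} \<longrightarrow> vs' v = ?vs v) \<and> vs' vK = d + q \<and>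
    (\<forall>k. k \<notin> {aKI, aKS} \<longrightarrow> as' k = as k) \<and> (\<forall>i<d + q. as' aKI i < N \<and> as' aKS i \<le> 1) \<and>
    config e as' (L - 1) a (d + q) r' (of_int k' + list_value e (as aRI) (as aRS) a (a + q)) l"
    for q and vs' :: vars and as' :: arrs
  have Rn: "R < n" "K < n" using bd m by (auto simp: R_def K_def)
  have "wp (For 1 vqq (Minus (Var vR) (Var vfrom)) (
      Write aKI (Var vK) (Arr aRI (Plus (Var vfrom) (Var vqq))) ;;
      Write aKS (Var vK) (Arr aRS (Plus (Var vfrom) (Var vqq))) ;;
      vK ::= Plus (Var vK) (Num 1))) (wp (vR ::= Var vfrom ;; vL ::= Minus (Var vL) (Num 1))
      (tracks m (r', k' + \<lfloor>r\<rfloor>, l))) ?vs as"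
  proof (rule wp_For[where c = "R - a" and I = J])
    show "R - a \<le> \<beta> ^ 1" using Rn loop_bounds(3)[of "R - a"] by simp
    show "R - a \<le> V" using Rn small_le_V(9) by linarith
    show "J 0 (?vs(vqq := 0)) as" using c ids by (auto simp: J_def list_value_def)
  next
    fix q vs' as' assume q: "q < R - a" "vs' vqq = q" and J: "J q vs' as'"
    let ?I = "as aRI (a + q)" and ?s = "as aRS (a + q)"
    let ?as = "as'(aKI := (as' aKI)(d + q := ?I), aKS := (as' aKS)(d + q := ?s))"
    have "config e ?as (L - 1) a (d + q) r' (of_int k' + list_value e (as aRI) (as aRS) a (a + q)) l"
      by (rule config_cong[where as = as' and e = e]) (use J in \<open>auto simp: J_def\<close>)
    from config_append_K[OF this]
    have cf: "config e ?as (L - 1) a (d + Suc q) r' (of_int k' + list_value e (as aRI) (as aRS) a (a + Suc q)) l"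
      unfolding list_value_Suc by (simp add: term_value_def add.assoc)
    have "J (Suc q) (vs'(vK := d + Suc q, vqq := Suc q)) ?as"
      unfolding J_def
    proof (intro conjI)
      show "\<forall>i<d + Suc q. ?as aKI i < N \<and> ?as aKS i \<le> 1" using J q ids(1)[of "a + q"] by (auto simp: J_def less_Suc_eq)
    qed (use J cf in \<open>auto simp: J_def\<close>)
    moreover have "d + Suc q \<le> V" "a + q \<le> V" using q c bd m small_le_V(9) unfolding R_def K_def by linarith+
    moreover have "as' aRI = as aRI" "as' aRS = as aRS" "vs' vfrom = a" "vs' vK = d + q" using J by (simp_all add: J_def)
    ultimately show "wp (Write aKI (Var vK) (Arr aRI (Plus (Var vfrom) (Var vqq))) ;;
      Write aKS (Var vK) (Arr aRS (Plus (Var vfrom) (Var vqq))) ;; vK ::= Plus (Var vK) (Num 1))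
      (\<lambda>vs'' as''. vs'' vqq = q \<and> J (Suc q) (vs''(vqq := Suc q)) as'') vs' as'"
      using q V(2) by simp
  next
    fix vs' as' assume J: "J (R - a) vs' as'"
    let ?v = "vs'(vR := a, vL := L - 1)"
    have as': "as' k = as k" if "k \<notin> {aKI, aKS}" for k using J that by (simp add: J_def)
    have vs': "vs' vN = N" "vs' vL = L" "vs' vfrom = a" "vs' vK = d + (R - a)" "vs' vS = vs vS" "vs' vG = vs vG" "vs' vB = vs vB"
      using J by (simp_all add: J_def N_def L_def)
    have ks: "of_int k' + list_value e (as aRI) (as aRS) a (a + (R - a)) = of_int (k' + \<lfloor>r\<rfloor>)"
      using c r by (simp add: le_add_diff_inverse)
    have "powers e ?v as'" by (rule powers_cong[OF p0(1)]) (use as' vs' in \<open>auto simp: N_def\<close>)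
    moreover have "exponents e ?v as'" by (rule exponents_cong[OF p0(2)]) (use as' vs' in \<open>auto simp: N_def\<close>)
    moreover have "config e as' (L - 1) a (d + (R - a)) r' (of_int (k' + \<lfloor>r\<rfloor>)) l"
      using J unfolding J_def ks by blast
    moreover have "\<forall>q<a. as' aRI q < N \<and> as' aRS q \<le> 1" using ids(1) c as' by simp
    moreover have "\<forall>i<d + (R - a). as' aKI i < N \<and> as' aKS i \<le> 1" using J by (simp add: J_def)
    ultimately have "state e r' (of_int (k' + \<lfloor>r\<rfloor>)) l ?v as'"
      unfolding state_def by (simp add: vs')
    then have "tracks m (r', k' + \<lfloor>r\<rfloor>, l) ?v as'"
      using bd c unfolding tracks_def by (auto simp: vs' N_def R_def K_def L_def)
    then show "wp (vR ::= Var vfrom ;; vL ::= Minus (Var vL) (Num 1)) (tracks m (r', k' + \<lfloor>r\<rfloor>, l)) vs' as'"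
      using V(2) by (simp add: vs')
  qed (auto simp: R_def)
  then show ?thesis by (simp add: pop_a_def a_def d_def L_def)
qed

lemma wp_pop_t:
  assumes T: "tracks m (r, k, (b, r', k') # l) vs as" and m: "m < n"
  shows "wp pop_t (tracks (Suc m) (r' + 2 powi (- k') * of_int k, k', l)) vs as"
proof -
  obtain e where st: "state e r (of_int k) ((b, r', k') # l) vs as"
    and bd: "vs vN \<le> 1 + m * n" "vs vR + vs vK \<le> m" "vs vL \<le> m"
    using T by (auto simp: tracks_def)
  define L R K N where "L = vs vL" and "R = vs vR" and "K = vs vK" and "N = vs vN"
  define a d where "a = as aLR L" and "d = as aLK L"
  have p0: "powers e vs as" "exponents e vs as"
    and c: "0 < L" "a \<le> R" "d \<le> K" "of_int k = list_value e (as aKI) (as aKS) d K"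
      "config e as (L - 1) a d r' (of_int k') l"
    and ids: "\<And>q. q < R \<Longrightarrow> as aRI q < N \<and> as aRS q \<le> 1" "\<And>q. q < K \<Longrightarrow> as aKI q < N \<and> as aKS q \<le> 1"
    using st by (auto simp: state_def a_def d_def L_def R_def K_def N_def)
  let ?f = "as aLK (L - 1)"
  let ?vs = "vs(vR := a, vto := d, vfrom := ?f)"
  let ?val = "\<lambda>q. r' + 2 powi (- k') * list_value e (as aKI) (as aKS) d (d + q)"
  \<comment> \<open>Every insertion changes the exponents, so \<open>e'\<close> is existential and
    agrees with \<open>e\<close> on the original \<open>N\<close> powers, to which the entries still
    to be moved refer.\<close>
  define J where "J q vs' as' \<longleftrightarrow> (\<forall>v. v \<notin> {vR, vqq, vbase} \<union> mod_vars new_power \<longrightarrow> vs' v = ?vs v) \<and>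
    vs' vR = a + q \<and> vs' vN = N + q \<and>
    (\<forall>k. k \<notin> {aRI, aRS} \<union> number_arrs \<longrightarrow> as' k = as k) \<and> (\<forall>i<a + q. as' aRI i < N + q \<and> as' aRS i \<le> 1) \<and>
    (\<exists>e'. powers e' vs' as' \<and> exponents e' vs' as' \<and> (\<forall>i<N. e' i = e i) \<and>
      config e' as' (L - 1) (a + q) d (?val q) (of_int k') l)"
    for q and vs' :: vars and as' :: arrs
  have Rn: "R + K < n" using bd m by (auto simp: R_def K_def)
  have "wp (For 1 vqq (Minus (Var vK) (Var vto)) (
      vbase ::= Arr aKI (Plus (Var vto) (Var vqq)) ;; append_power (Arr aKS (Plus (Var vto) (Var vqq)))))
      (wp (vK ::= Var vto ;; vL ::= Minus (Var vL) (Num 1))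
      (tracks (Suc m) (r' + 2 powi (- k') * of_int k, k', l))) ?vs as"
  proof (rule wp_For[where c = "K - d" and I = J])
    show "K - d \<le> \<beta> ^ 1" using Rn loop_bounds(3)[of "K - d"] by simp
    show "K - d \<le> V" using Rn small_le_V(9) by linarith
    have "powers e (?vs(vqq := 0)) as" "exponents e (?vs(vqq := 0)) as"
      by (rule powers_cong[OF p0(1)], auto) (rule exponents_cong[OF p0(2)], auto)
    then show "J 0 (?vs(vqq := 0)) as" using c ids unfolding J_def
      by (auto simp: list_value_def N_def intro!: exI[of _ e])
  next
    fix q vs1 as1 assume q: "q < K - d" "vs1 vqq = q" and J: "J q vs1 as1"
    then obtain e' where e': "powers e' vs1 as1" "exponents e' vs1 as1" "\<And>i. i < N \<Longrightarrow> e' i = e i"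
      "config e' as1 (L - 1) (a + q) d (?val q) (of_int k') l" by (auto simp: J_def)
    have fr: "\<And>v. v \<notin> {vR, vqq, vbase} \<union> mod_vars new_power \<Longrightarrow> vs1 v = ?vs v"
      "\<And>k. k \<notin> {aRI, aRS} \<union> number_arrs \<Longrightarrow> as1 k = as k" using J by (auto simp: J_def)
    have v1: "vs1 vR = a + q" "vs1 vN = N + q" "vs1 vto = d" "vs1 vfrom = ?f"
      using J fr(1) by (simp_all add: J_def new_power_mod)
    have a1: "as1 aKI = as aKI" "as1 aKS = as aKS" "as1 aLR = as aLR" "as1 aLK = as aLK" "as1 aLE = as aLE"
      using fr(2) by simp_all
    let ?i = "as aKI (d + q)" and ?s = "as aKS (d + q)"
    let ?vs1 = "vs1(vbase := ?i)"
    have iq: "?i < N" "?s \<le> 1" using ids(2)[of "d + q"] q by auto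
    note cD = configD[OF e'(4), unfolded a1]
    have "powers e' ?vs1 as1" "exponents e' ?vs1 as1"
      by (rule powers_cong[OF e'(1)], auto) (rule exponents_cong[OF e'(2)], auto)
    moreover have "?vs1 vN \<le> n * n"
    proof -
      have "q < m" using q bd by (simp add: K_def)
      with count_bound(1)[OF m this] bd show ?thesis by (simp add: v1 N_def)
    qed
    moreover have "?vs1 vbase < ?vs1 vN" "?vs1 vfrom \<le> ?vs1 vto" "?vs1 vto \<le> n" "?vs1 vR < n"
      "\<And>q. ?vs1 vfrom \<le> q \<Longrightarrow> q < ?vs1 vto \<Longrightarrow> as1 aKI q < ?vs1 vN \<and> as1 aKS q \<le> 1"
      "list_value e' (as1 aKI) (as1 aKS) (?vs1 vfrom) (?vs1 vto) = of_int k'"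
      using iq cD Rn c q ids(2) by (auto simp: v1 a1 trans_less_add1)
    moreover have "safe (Arr aKS (Plus (Var vto) (Var vqq))) vs' as' \<and> aval (Arr aKS (Plus (Var vto) (Var vqq))) vs' as' = ?s"
      if "\<And>v. v \<notin> mod_vars new_power \<Longrightarrow> vs' v = ?vs1 v" "\<And>k. k \<notin> insert aRI number_arrs \<Longrightarrow> as' k = as1 k" for vs' as'
    proof -
      have "d + q \<le> V" using q Rn small_le_V(9) by linarith
      then show ?thesis using that v1 q(2) a1(2) by (simp add: new_power_mod)
    qed
    ultimately have "wp (append_power (Arr aKS (Plus (Var vto) (Var vqq)))) (\<lambda>vs' as'. vs' vN = Suc (?vs1 vN) \<and> vs' vR = Suc (?vs1 vR) \<and>
      powers (e'(?vs1 vN := e' (?vs1 vbase) - k')) vs' as' \<and> exponents (e'(?vs1 vN := e' (?vs1 vbase) - k')) vs' as' \<and>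
      as' aRI = (as1 aRI)(?vs1 vR := ?vs1 vN) \<and> as' aRS = (as1 aRS)(?vs1 vR := ?s)) ?vs1 as1"
      by (intro wp_append_power) blast+
    then have "wp (append_power (Arr aKS (Plus (Var vto) (Var vqq))))
      (\<lambda>vs'' as''. vs'' vqq = q \<and> J (Suc q) (vs''(vqq := Suc q)) as'') ?vs1 as1"
    proof (rule wp_conseq)
      fix vs2 as2 assume u: "unchanged (append_power (Arr aKS (Plus (Var vto) (Var vqq)))) ?vs1 as1 vs2 as2"
        and "vs2 vN = Suc (?vs1 vN) \<and> vs2 vR = Suc (?vs1 vR) \<and>
        powers (e'(?vs1 vN := e' (?vs1 vbase) - k')) vs2 as2 \<and> exponents (e'(?vs1 vN := e' (?vs1 vbase) - k')) vs2 as2 \<and>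
        as2 aRI = (as1 aRI)(?vs1 vR := ?vs1 vN) \<and> as2 aRS = (as1 aRS)(?vs1 vR := ?s)"
      then have A: "vs2 vN = N + Suc q" "vs2 vR = a + Suc q" "powers (e'(N + q := e ?i - k')) vs2 as2"
        "exponents (e'(N + q := e ?i - k')) vs2 as2"
        "as2 aRI = (as1 aRI)(a + q := N + q)" "as2 aRS = (as1 aRS)(a + q := ?s)"
        using e'(3)[OF iq(1)] by (simp_all add: v1)
      let ?e = "e'(N + q := e ?i - k')"
      have fr2: "\<And>v. v \<notin> {vR, vbase} \<union> mod_vars new_power \<Longrightarrow> vs2 v = vs1 v"
        "\<And>k. k \<notin> {aRI, aRS} \<union> number_arrs \<Longrightarrow> as2 k = as1 k"
        using u by (auto simp: unchanged_def program_mod new_power_mod)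
      have a2: "as2 aKI = as aKI" "as2 aKS = as aKS" "as2 aLR = as aLR" "as2 aLK = as aLK" "as2 aLE = as aLE"
        using fr2(2) a1 by simp_all
      have Rids: "as1 aRI i < N + q" if "i < a + q" for i using J that by (simp add: J_def)
      have "config ?e as2 (L - 1) (a + q) d (?val q) (of_int k') l"
      proof (rule config_cong[OF e'(4)])
        show "\<And>i. i < a + q \<Longrightarrow> as2 aRI i = as1 aRI i \<and> as2 aRS i = as1 aRS i \<and> ?e (as1 aRI i) = e' (as1 aRI i)"
          using A Rids by fastforce
        show "\<And>i. i < d \<Longrightarrow> as2 aKI i = as1 aKI i \<and> as2 aKS i = as1 aKS i \<and> ?e (as1 aKI i) = e' (as1 aKI i)"
        proof -
          fix i assume "i < d"
          then have "as aKI i < N" using ids(2)[of i] c(3) by simp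
          then show "as2 aKI i = as1 aKI i \<and> as2 aKS i = as1 aKS i \<and> ?e (as1 aKI i) = e' (as1 aKI i)"
            by (simp add: a1 a2)
        qed
      qed (use a1 a2 in auto)
      from config_append_R[OF this]
      have "config ?e as2 (L - 1) (a + Suc q) d (?val q + term_value ?e (as2 aRI) (as2 aRS) (a + q)) (of_int k') l" by simp
      \<comment> \<open>This is \<open>2^(e i - k') = 2^-k' * 2^(e i)\<close>.\<close>
      moreover have "?val q + term_value ?e (as2 aRI) (as2 aRS) (a + q) = ?val (Suc q)"
        unfolding list_value_Suc
        by (simp add: A term_value_def algebra_simps power_int_diff power_int_minus divide_inverse)
      ultimately have cf: "config ?e as2 (L - 1) (a + Suc q) d (?val (Suc q)) (of_int k') l" by simp
      have "powers ?e (vs2(vqq := Suc q)) as2" "exponents ?e (vs2(vqq := Suc q)) as2"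
        by (rule powers_cong[OF A(3)], auto) (rule exponents_cong[OF A(4)], auto)
      moreover have "\<forall>i<N. ?e i = e i" using e'(3) by simp
      ultimately have "\<exists>e'. powers e' (vs2(vqq := Suc q)) as2 \<and> exponents e' (vs2(vqq := Suc q)) as2 \<and> (\<forall>i<N. e' i = e i) \<and>
        config e' as2 (L - 1) (a + Suc q) d (?val (Suc q)) (of_int k') l" using cf by blast
      moreover have "\<forall>i<a + Suc q. as2 aRI i < N + Suc q \<and> as2 aRS i \<le> 1"
        using J iq A by (auto simp: J_def less_Suc_eq)
      ultimately have "J (Suc q) (vs2(vqq := Suc q)) as2"
        using A fr fr2 unfolding J_def by (auto simp: new_power_mod)
      moreover have "vs2 vqq = q" using fr2(1) q(2) by (simp add: new_power_mod)
      ultimately show "vs2 vqq = q \<and> J (Suc q) (vs2(vqq := Suc q)) as2" by blast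
    qed
    moreover have "d + q \<le> V" using q Rn small_le_V(9) by linarith
    ultimately show "wp (vbase ::= Arr aKI (Plus (Var vto) (Var vqq)) ;; append_power (Arr aKS (Plus (Var vto) (Var vqq))))
      (\<lambda>vs'' as''. vs'' vqq = q \<and> J (Suc q) (vs''(vqq := Suc q)) as'') vs1 as1"
      using q(2) by (simp add: v1 a1)
  next
    fix vs' as' assume J: "J (K - d) vs' as'"
    then obtain e' where e': "powers e' vs' as'" "exponents e' vs' as'"
      "config e' as' (L - 1) (a + (K - d)) d (?val (K - d)) (of_int k') l" by (auto simp: J_def)
    let ?v = "vs'(vK := d, vL := L - 1)"
    have as': "as' aKI = as aKI" "as' aKS = as aKS" using J by (simp_all add: J_def)
    have vs': "vs' vN = N + (K - d)" "vs' vL = L" "vs' vto = d" "vs' vR = a + (K - d)"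
      using J by (simp_all add: J_def L_def new_power_mod)
    have val: "?val (K - d) = r' + 2 powi (- k') * of_int k" using c by simp
    have "powers e' ?v as'" by (rule powers_cong[OF e'(1)]) auto
    moreover have "exponents e' ?v as'" by (rule exponents_cong[OF e'(2)]) auto
    moreover have "\<forall>i<a + (K - d). as' aRI i < N + (K - d) \<and> as' aRS i \<le> 1" using J by (simp add: J_def)
    moreover have "\<forall>i<d. as' aKI i < N + (K - d) \<and> as' aKS i \<le> 1"
    proof (intro allI impI)
      fix i assume "i < d"
      then have "as aKI i < N \<and> as aKS i \<le> 1" using ids(2)[of i] c(3) by simp
      then show "as' aKI i < N + (K - d) \<and> as' aKS i \<le> 1" unfolding as' by linarith
    qed
    ultimately have "state e' (r' + 2 powi (- k') * of_int k) (of_int k') l ?v as'"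
      using e'(3) unfolding state_def val by (simp add: vs')
    moreover have "N + (K - d) \<le> 1 + Suc m * n" using bd Rn by (simp add: N_def)
    ultimately have "tracks (Suc m) (r' + 2 powi (- k') * of_int k, k', l) ?v as'"
      using bd c unfolding tracks_def by (auto simp: vs' R_def K_def L_def)
    then show "wp (vK ::= Var vto ;; vL ::= Minus (Var vL) (Num 1))
      (tracks (Suc m) (r' + 2 powi (- k') * of_int k, k', l)) vs' as'"
      using V(2) by (simp add: vs')
  qed (auto simp: K_def)
  then show ?thesis using V(2) by (simp add: pop_t_def a_def d_def L_def)
qed

lemma wp_read_b:
  assumes T: "tracks m (r, k, l) vs as" and m: "m < n"
  shows "wp read_b (tracks (Suc m) (britton_step (b3, True) (r, k, l))) vs as"
proof -
  let ?P = "tracks (Suc m) (britton_step (b3, True) (r, k, l))"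
  define pop where "pop \<longleftrightarrow> l \<noteq> [] \<and> \<not> fst (hd l) \<and> k = 0 \<and> r \<in> \<int>"
  \<comment> \<open>The tests write to scratch space alone, so the final branching is treated once,
    for all states that track the same configuration.\<close>
  have final: "wp (Cond (Var vok) pop_a (push 1)) ?P vs' as'"
    if T': "tracks m (r, k, l) vs' as'" and ok: "vs' vok = (if pop then 1 else 0)" for vs' as'
  proof (cases pop)
    case True
    then obtain r' k' l' where l: "l = (False, r', k') # l'" by (cases l) (auto simp: pop_def)
    have "wp pop_a (tracks m (r', k' + \<lfloor>r\<rfloor>, l')) vs' as'"
      using wp_pop_a[OF T'[unfolded l] m] True by (simp add: pop_def)
    then have "wp pop_a ?P vs' as'"
      by (rule wp_mono) (use True l tracks_Suc in \<open>simp add: pop_def\<close>)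
    then show ?thesis using ok True by simp
  next
    case False
    then have "britton_step (b3, True) (r, k, l) = (0, 0, (True, r, k) # l)"
      by (cases l) (auto simp: pop_def)
    then show ?thesis using wp_push[OF T' m, of True] ok False by simp
  qed
  obtain e where st: "state e r (of_int k) l vs as" and bd: "vs vR + vs vK \<le> m"
    using T by (auto simp: tracks_def)
  have c: "config e as (vs vL) (vs vR) (vs vK) r (of_int k) l" using st by (simp add: state_def)
  let ?vs = "vs(vok := 0)"
  have T0: "tracks m (r, k, l) ?vs as" by (rule tracks_cong[OF T]) auto
  show ?thesis
  proof (cases "l \<noteq> [] \<and> \<not> fst (hd l)")
    case False
    then have "wp (Cond (Var vok) pop_a (push 1)) ?P ?vs as" by (intro final T0) (auto simp: pop_def)
    moreover have "vs vL = 0 \<or> as aLE (vs vL) = 1" using False c by (cases l) auto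
    ultimately show ?thesis by (auto simp: read_b_def)
  next
    case True
    then have L: "vs vL \<noteq> 0" "as aLE (vs vL) = 0" using c by (cases l; auto)+
    have s0: "state e r (of_int k) l ?vs as" by (rule state_cong[OF st]) auto
    have "?vs vK \<le> n" using bd m by simp
    with s0 have "wp test_t (wp (Cond nonzero Nop (test_a ;; Cond (Var vF) Nop (vok ::= Num 1)))
      (wp (Cond (Var vok) pop_a (push 1)) ?P)) ?vs as"
    proof (rule wp_conseq[OF wp_test_t])
      fix vs1 as1 assume u1: "unchanged test_t ?vs as vs1 as1"
        and A1: "safe nonzero vs1 as1 \<and> (vs1 vF = 0 \<longleftrightarrow> (of_int k :: real) \<in> \<int>) \<and> (aval nonzero vs1 as1 = 0 \<longleftrightarrow> of_int k = (0 :: real))"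
      have fr1v: "\<And>v. v \<in> {vS, vG, vB, vN, vL, vR, vK, vok} \<Longrightarrow> vs1 v = ?vs v"
        using u1 by (elim insertE emptyE) (simp_all add: unchanged_def program_mod)
      have fr1a: "\<And>k. k \<notin> {aCP, aCN} \<Longrightarrow> as1 k = as k"
        using u1 by (simp add: unchanged_def program_mod)
      note fr1 = fr1v fr1a
      have T1: "tracks m (r, k, l) vs1 as1" by (rule tracks_cong[OF T0]) (use fr1 in auto)
      have s1: "state e r (of_int k) l vs1 as1" by (rule state_cong[OF s0]) (use fr1 in auto)
      have ok1: "vs1 vok = 0" using fr1(1) by simp
      show "wp (Cond nonzero Nop (test_a ;; Cond (Var vF) Nop (vok ::= Num 1))) (wp (Cond (Var vok) pop_a (push 1)) ?P) vs1 as1"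
      proof (cases "k = 0")
        case False
        then have "wp (Cond (Var vok) pop_a (push 1)) ?P vs1 as1"
          by (intro final T1) (simp add: pop_def ok1)
        with False A1 show ?thesis by simp
      next
        case k0: True
        have "vs1 vR \<le> n" using fr1(1) bd m by simp
        with s1 have "wp test_a (wp (Cond (Var vF) Nop (vok ::= Num 1)) (wp (Cond (Var vok) pop_a (push 1)) ?P)) vs1 as1"
        proof (rule wp_conseq[OF wp_test_a])
          fix vs2 as2 assume u2: "unchanged test_a vs1 as1 vs2 as2"
            and A2: "safe nonzero vs2 as2 \<and> (vs2 vF = 0 \<longleftrightarrow> r \<in> \<int>) \<and> (aval nonzero vs2 as2 = 0 \<longleftrightarrow> r = 0)"
          have fr2v: "\<And>v. v \<in> {vS, vG, vB, vN, vL, vR, vK, vok} \<Longrightarrow> vs2 v = vs1 v"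
            using u2 by (elim insertE emptyE) (simp_all add: unchanged_def program_mod)
          have fr2a: "\<And>k. k \<notin> {aCP, aCN} \<Longrightarrow> as2 k = as1 k"
            using u2 by (simp add: unchanged_def program_mod)
          note fr2 = fr2v fr2a
          have T2: "tracks m (r, k, l) vs2 as2" by (rule tracks_cong[OF T1]) (use fr2 in auto)
          have T3: "tracks m (r, k, l) (vs2(vok := 1)) as2" by (rule tracks_cong[OF T2]) auto
          show "wp (Cond (Var vF) Nop (vok ::= Num 1)) (wp (Cond (Var vok) pop_a (push 1)) ?P) vs2 as2"
          proof (cases "r \<in> \<int>")
            case r: True
            have "wp (Cond (Var vok) pop_a (push 1)) ?P (vs2(vok := 1)) as2"
              by (intro final T3) (use r k0 True in \<open>simp add: pop_def\<close>)
            then show ?thesis using A2 r V(2) by simp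
          next
            case False
            have "wp (Cond (Var vok) pop_a (push 1)) ?P vs2 as2"
              by (intro final T2) (use False fr2(1) ok1 in \<open>simp add: pop_def\<close>)
            then show ?thesis using A2 False by simp
          qed
        qed
        then show ?thesis using A1 k0 by simp
      qed
    qed
    then show ?thesis using L by (simp add: read_b_def)
  qed
qed

lemma wp_read_b_inv:
  assumes T: "tracks m (r, k, l) vs as" and m: "m < n"
  shows "wp read_b_inv (tracks (Suc m) (britton_step (b3, False) (r, k, l))) vs as"
proof -
  let ?P = "tracks (Suc m) (britton_step (b3, False) (r, k, l))"
  define pop where "pop \<longleftrightarrow> l \<noteq> [] \<and> fst (hd l) \<and> r = 0"
  have final: "wp (Cond (Var vok) pop_t (push 0)) ?P vs' as'"
    if T': "tracks m (r, k, l) vs' as'" and ok: "vs' vok = (if pop then 1 else 0)" for vs' as'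
  proof (cases pop)
    case True
    then obtain r' k' l' where l: "l = (True, r', k') # l'" by (cases l) (auto simp: pop_def)
    have "wp pop_t ?P vs' as'"
      using wp_pop_t[OF T'[unfolded l] m] True by (simp add: pop_def l)
    then show ?thesis using ok True by simp
  next
    case False
    then have "britton_step (b3, False) (r, k, l) = (0, 0, (False, r, k) # l)"
      by (cases l) (auto simp: pop_def)
    then show ?thesis using wp_push[OF T' m, of False] ok False by simp
  qed
  obtain e where st: "state e r (of_int k) l vs as" and bd: "vs vR + vs vK \<le> m"
    using T by (auto simp: tracks_def)
  have c: "config e as (vs vL) (vs vR) (vs vK) r (of_int k) l" using st by (simp add: state_def)
  let ?vs = "vs(vok := 0)"
  have T0: "tracks m (r, k, l) ?vs as" by (rule tracks_cong[OF T]) auto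
  show ?thesis
  proof (cases "l \<noteq> [] \<and> fst (hd l)")
    case False
    then have "wp (Cond (Var vok) pop_t (push 0)) ?P ?vs as" by (intro final T0) (auto simp: pop_def)
    moreover have "vs vL = 0 \<or> as aLE (vs vL) = 0" using False c by (cases l) auto
    ultimately show ?thesis by (auto simp: read_b_inv_def)
  next
    case True
    then have L: "vs vL \<noteq> 0" "as aLE (vs vL) = 1" using c by (cases l; auto)+
    have "state e r (of_int k) l ?vs as" by (rule state_cong[OF st]) auto
    moreover have "?vs vR \<le> n" using bd m by simp
    ultimately have "wp test_a (wp (Cond nonzero Nop (vok ::= Num 1)) (wp (Cond (Var vok) pop_t (push 0)) ?P)) ?vs as"
    proof (rule wp_conseq[OF wp_test_a])
      fix vs2 as2 assume u2: "unchanged test_a ?vs as vs2 as2"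
        and A2: "safe nonzero vs2 as2 \<and> (vs2 vF = 0 \<longleftrightarrow> r \<in> \<int>) \<and> (aval nonzero vs2 as2 = 0 \<longleftrightarrow> r = 0)"
      have fr2v: "\<And>v. v \<in> {vS, vG, vB, vN, vL, vR, vK, vok} \<Longrightarrow> vs2 v = ?vs v"
        using u2 by (elim insertE emptyE) (simp_all add: unchanged_def program_mod)
      have fr2a: "\<And>k. k \<notin> {aCP, aCN} \<Longrightarrow> as2 k = as k"
        using u2 by (simp add: unchanged_def program_mod)
      note fr2 = fr2v fr2a
      have T2: "tracks m (r, k, l) vs2 as2" by (rule tracks_cong[OF T0]) (use fr2 in auto)
      have T3: "tracks m (r, k, l) (vs2(vok := 1)) as2" by (rule tracks_cong[OF T2]) auto
      show "wp (Cond nonzero Nop (vok ::= Num 1)) (wp (Cond (Var vok) pop_t (push 0)) ?P) vs2 as2"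
      proof (cases "r = 0")
        case r: True
        have "wp (Cond (Var vok) pop_t (push 0)) ?P (vs2(vok := 1)) as2"
          by (intro final T3) (use r True in \<open>simp add: pop_def\<close>)
        then show ?thesis using A2 r V(2) by simp
      next
        case False
        have "wp (Cond (Var vok) pop_t (push 0)) ?P vs2 as2"
          by (intro final T2) (use False fr2(1) in \<open>simp add: pop_def\<close>)
        then show ?thesis using A2 False by simp
      qed
    qed
    then show ?thesis using L by (simp add: read_b_inv_def)
  qed
qed

lemma wp_read_letter:
  assumes T: "tracks i s vs as" and i: "i < n" "vs vi = i" and x: "inp i = letter_code x"
  shows "wp read_letter (tracks (Suc i) (britton_step x s)) vs as"
proof -
  obtain r k l where s: "s = (r, k, l)" by (cases s) auto
  let ?vs = "vs(vc := inp i)"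
  have T': "tracks i (r, k, l) ?vs as" by (rule tracks_cong[OF T[unfolded s]]) auto
  have V6: "6 \<le> V" using bounds_V(1) by (simp add: B_def G_def)
  consider b where "x = (a3, b)" | b where "x = (t3, b)" | "x = (b3, True)" | "x = (b3, False)"
    by (cases x rule: letter_code.cases; cases "snd x") auto
  then show ?thesis
  proof cases
    case (1 b)
    then have "wp read_a (tracks (Suc i) (britton_step x s)) ?vs as"
      using wp_read_a[OF T' i(1), of b] x by (simp add: s)
    then show ?thesis using V6 i x 1 by (simp add: read_letter_def split: if_splits)
  next
    case (2 b)
    then have "wp read_t (tracks (Suc i) (britton_step x s)) ?vs as"
      using wp_read_t[OF T' i(1), of b] x by (simp add: s)
    then show ?thesis using V6 i x 2 by (simp add: read_letter_def split: if_splits)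
  next
    case 3
    then have "wp read_b (tracks (Suc i) (britton_step x s)) ?vs as"
      using wp_read_b[OF T' i(1)] x by (simp only: s)
    then show ?thesis using V6 i x 3 by (simp add: read_letter_def)
  next
    case 4
    then have "wp read_b_inv (tracks (Suc i) (britton_step x s)) ?vs as"
      using wp_read_b_inv[OF T' i(1)] x by (simp only: s)
    then show ?thesis using V6 i x 4 by (simp add: read_letter_def)
  qed
qed

section \<open>Answer, initialisation and the main loop\<close>

lemma wp_answer:
  assumes T: "tracks n (r, k, l) vs as"
  shows "wp answer (\<lambda>vs' as'. vs' 0 = (if (r, k, l) = (0, 0, []) then 1 else 0)) vs as"
proof -
  let ?P = "\<lambda>vs' as'. vs' 0 = (if (r, k, l) = (0, 0, []) then 1 else (0 :: nat))"
  obtain e where st: "state e r (of_int k) l vs as" and bd: "vs vR + vs vK \<le> n"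
    using T by (auto simp: tracks_def)
  have c: "config e as (vs vL) (vs vR) (vs vK) r (of_int k) l" using st by (simp add: state_def)
  let ?vs = "vs(vok := 0)"
  have s0: "state e r (of_int k) l ?vs as" by (rule state_cong[OF st]) auto
  show ?thesis
  proof (cases "l = []")
    case False
    then have "vs vL \<noteq> 0" using configD(5)[OF c] by simp
    then show ?thesis using False by (simp add: answer_def)
  next
    case l: True
    have "?vs vK \<le> n" using bd by simp
    with s0 have "wp test_t (wp (Cond nonzero Nop (test_a ;; Cond nonzero Nop (vok ::= Num 1))) (wp (vn ::= Var vok) ?P)) ?vs as"
    proof (rule wp_conseq[OF wp_test_t])
      fix vs1 as1 assume u1: "unchanged test_t ?vs as vs1 as1"
        and A1: "safe nonzero vs1 as1 \<and> (vs1 vF = 0 \<longleftrightarrow> (of_int k :: real) \<in> \<int>) \<and> (aval nonzero vs1 as1 = 0 \<longleftrightarrow> of_int k = (0 :: real))"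
      have fr1v: "\<And>v. v \<in> {vS, vG, vB, vN, vL, vR, vK, vok} \<Longrightarrow> vs1 v = ?vs v"
        using u1 by (elim insertE emptyE) (simp_all add: unchanged_def program_mod)
      have fr1a: "\<And>k. k \<notin> {aCP, aCN} \<Longrightarrow> as1 k = as k"
        using u1 by (simp add: unchanged_def program_mod)
      note fr1 = fr1v fr1a
      have s1: "state e r (of_int k) l vs1 as1" by (rule state_cong[OF s0]) (use fr1 in auto)
      have ok1: "vs1 vok = 0" using fr1(1) by simp
      show "wp (Cond nonzero Nop (test_a ;; Cond nonzero Nop (vok ::= Num 1))) (wp (vn ::= Var vok) ?P) vs1 as1"
      proof (cases "k = 0")
        case False
        with A1 ok1 show ?thesis by simp
      next
        case k0: True
        have "vs1 vR \<le> n" using fr1(1) bd by simp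
        with s1 have "wp test_a (wp (Cond nonzero Nop (vok ::= Num 1)) (wp (vn ::= Var vok) ?P)) vs1 as1"
        proof (rule wp_conseq[OF wp_test_a])
          fix vs2 as2 assume u2: "unchanged test_a vs1 as1 vs2 as2"
            and A2: "safe nonzero vs2 as2 \<and> (vs2 vF = 0 \<longleftrightarrow> r \<in> \<int>) \<and> (aval nonzero vs2 as2 = 0 \<longleftrightarrow> r = 0)"
          have "vs2 vok = vs1 vok" using u2 by (simp add: unchanged_def program_mod)
          then show "wp (Cond nonzero Nop (vok ::= Num 1)) (wp (vn ::= Var vok) ?P) vs2 as2"
            using A2 ok1 k0 l V(2) by simp
        qed
        then show ?thesis using A1 k0 by simp
      qed
    qed
    moreover have "vs vL = 0" using configD(5)[OF c] l by simp
    ultimately show ?thesis by (simp add: answer_def)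
  qed
qed

text \<open>The blank memory already describes the single power 1, with order, differences and
  coefficients all zero, so constants and tables are what has to be computed. The blocks
  \<open>C1\<close>, \<open>C2\<close>, \<open>C3\<close> are verified backwards.\<close>

lemma wp_initialise:
  "wp initialise (\<lambda>vs as. vs vn = n \<and> tracks 0 (0, 0, []) vs as) ((\<lambda>_. 0)(0 := n)) (\<lambda>_ _. 0)"
proof -
  let ?Z = "\<lambda>vs :: vars. vs vn = n \<and> (\<forall>v\<in>{vL, vR, vK}. vs v = 0)"
  let ?goal = "\<lambda>vs as. vs vn = n \<and> tracks 0 (0, 0, []) vs as"
  define z :: arrs where "z = (\<lambda>_ _. 0)"
  have V12: "12 \<le> V" using bounds_V(1) by (simp add: B_def G_def)
  have nV: "n + 12 \<le> V" "n * n + 2 \<le> V" using small_le_V(6,8) by (simp_all add: G_def S_def)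
  have n1: "n \<le> \<beta> ^ 1" using loop_bounds(3) by simp
  have MV: "M + M \<le> V" "B \<le> V" "M + M + G = B" using small_le_V(7,1) by (simp_all add: B_def mult_2)
  define C1 where "C1 = vG ::= Plus (Var vn) (Num 12) ;;
    vx ::= Num 0 ;; Rep 1 (Var vn) (vx ::= Plus (Var vx) (Minus (Var vS) (Num 1)))"
  define C2 where "C2 = vx ::= Plus (Var vx) (Var vx) ;; vB ::= Plus (Plus (Var vx) (Var vx)) (Var vG) ;;
    For 4 vj (Plus (Var vx) (Num 1)) (
      Write aH (Plus (Var vj) (Var vj)) (Var vj) ;;
      Write aH (Plus (Plus (Var vj) (Var vj)) (Num 1)) (Var vj))"
  define C3 where "C3 = vy ::= Num 0 ;;
    For 2 vj (Var vS) (Write aROW (Var vj) (Var vy) ;; vy ::= Plus (Var vy) (Var vS)) ;; vN ::= Num 1"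
  have 3: "wp C3 ?goal vs as" if "?Z vs" "vs vS = S" "vs vG = G" "vs vB = B" "\<forall>k. k \<noteq> aH \<longrightarrow> as k = z k"
    "\<forall>i\<le>2 * M. as aH i = i div 2" for vs as
  proof -
    define J where "J c vs' as' \<longleftrightarrow> (\<forall>v. v \<notin> {vy, vj} \<longrightarrow> vs' v = vs v) \<and> vs' vy = c * S \<and>
      (\<forall>k. k \<noteq> aROW \<longrightarrow> as' k = as k) \<and> (\<forall>i<c. as' aROW i = i * S)" for c and vs' :: vars and as' :: arrs
    have "wp (For 2 vj (Var vS) (Write aROW (Var vj) (Var vy) ;; vy ::= Plus (Var vy) (Var vS))) (wp (vN ::= Num 1) ?goal) (vs(vy := 0)) as"
    proof (rule wp_For[where c = S and I = J])
      have "S \<le> \<beta> * \<beta>" by (simp add: \<beta> S_def algebra_simps)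
      then show "S \<le> \<beta> ^ 2" by (simp add: power2_eq_square)
      show "S \<le> V" by simp
      show "J 0 (vs(vy := 0, vj := 0)) as" by (simp add: J_def)
    next
      fix c vs' as' assume c: "c < S" "vs' vj = c" and J: "J c vs' as'"
      have "Suc c * S \<le> S * S" using c by (intro mult_le_mono1) simp
      then have "c * S + S \<le> V" using bounds_V(2) by simp
      then show "wp (Write aROW (Var vj) (Var vy) ;; vy ::= Plus (Var vy) (Var vS))
        (\<lambda>vs'' as''. vs'' vj = c \<and> J (Suc c) (vs''(vj := Suc c)) as'') vs' as'"
        using J c that by (auto simp: J_def less_Suc_eq)
    next
      fix vs' as' assume J: "J S vs' as'"
      let ?vs = "vs'(vN := 1)"
      have A: "\<And>k. k \<notin> {aH, aROW} \<Longrightarrow> as' k = z k" "as' aH = as aH" using J that(5) by (auto simp: J_def)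
      have v: "?vs vS = S" "?vs vG = G" "?vs vB = B" "?vs vL = 0" "?vs vR = 0" "?vs vK = 0" "?vs vn = n"
        using J that by (auto simp: J_def)
      have "powers (\<lambda>_. 0) ?vs as'" unfolding powers_def
      proof (intro conjI)
        show "bij_betw (as' aORD) {..<?vs vN} {..<?vs vN}"
          using A(1) by (simp add: z_def bij_betw_def lessThan_Suc)
        show "?vs vN < S" by (simp add: S_def)
        show "\<forall>i<?vs vN. \<forall>j<?vs vN. as' aD (i * S + j) = nat (min (int G) (0 - 0))" using A(1) by (simp add: z_def)
        show "\<forall>i<S. as' aROW i = i * S" using J by (simp add: J_def)
        show "\<forall>i\<le>2 * M. as' aH i = i div 2" using A(2) that(6) by simp
      qed (use v in auto)
      moreover have "exponents (\<lambda>_. 0) ?vs as'" using A unfolding exponents_def by (simp add: z_def)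
      moreover have "config (\<lambda>_. 0) as' 0 0 0 0 0 []" using A by (simp add: z_def list_value_def)
      ultimately have "state (\<lambda>_. 0) 0 (of_int 0) [] ?vs as'" using v unfolding state_def by simp
      then have "tracks 0 (0, 0, []) ?vs as'" using v unfolding tracks_def by auto
      then show "wp (vN ::= Num 1) ?goal vs' as'" using v V(2) by simp
    qed (use that in auto)
    then show ?thesis by (simp add: C3_def)
  qed
  have 2: "wp C2 (wp C3 ?goal) vs z" if "?Z vs" "vs vS = S" "vs vG = G" "vs vx = n * (n * n + 1)" for vs
  proof -
    let ?vs = "vs(vx := M, vB := B)"
    have M: "n * (n * n + 1) + n * (n * n + 1) = M" by (simp add: M_def)
    define J where "J c vs' as' \<longleftrightarrow> (\<forall>v. v \<noteq> vj \<longrightarrow> vs' v = ?vs v) \<and>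
      (\<forall>k. k \<noteq> aH \<longrightarrow> as' k = z k) \<and> (\<forall>i<2 * c. as' aH i = i div 2)" for c and vs' :: vars and as' :: arrs
    have "wp (For 4 vj (Plus (Var vx) (Num 1)) (
      Write aH (Plus (Var vj) (Var vj)) (Var vj) ;;
      Write aH (Plus (Plus (Var vj) (Var vj)) (Num 1)) (Var vj))) (wp C3 ?goal) ?vs z"
    proof (rule wp_For[where c = "M + 1" and I = J])
      have "n * n * n \<le> \<beta> * \<beta> * \<beta>" "n \<le> \<beta>" "16 \<le> \<beta>" by (auto simp: \<beta> intro!: mult_le_mono)
      moreover have "16 * (\<beta> * \<beta> * \<beta>) \<le> \<beta> * (\<beta> * \<beta> * \<beta>)" "\<beta> * 1 \<le> \<beta> * (\<beta> * \<beta>)"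
        using \<open>16 \<le> \<beta>\<close> by (auto intro!: mult_le_mono)
      moreover have "M = 2 * (n * n * n) + 2 * n" by (simp add: M_def algebra_simps)
      ultimately have "M + 1 \<le> \<beta> * (\<beta> * \<beta> * \<beta>)" by linarith
      then show "M + 1 \<le> \<beta> ^ 4" by (simp add: eval_nat_numeral algebra_simps)
      show "M + 1 \<le> V" using bounds_V(1) by (simp add: B_def G_def)
      show "J 0 (?vs(vj := 0)) z" by (simp add: J_def)
    next
      fix c vs' as' assume c: "c < M + 1" "vs' vj = c" and J: "J c vs' as'"
      have "c + c + 1 \<le> V" using c bounds_V(1) by (simp add: B_def G_def)
      moreover have "J (Suc c) (vs'(vj := Suc c)) (as'(aH := (as' aH)(c + c := c, c + c + 1 := c)))"
        unfolding J_def
      proof (intro conjI allI impI)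
        fix i :: nat assume "i < 2 * Suc c"
        then have "i < 2 * c \<or> i = c + c \<or> i = c + c + 1" by presburger
        then show "(as'(aH := (as' aH)(c + c := c, c + c + 1 := c))) aH i = i div 2"
          using J by (auto simp: J_def)
      qed (use J in \<open>auto simp: J_def\<close>)
      ultimately show "wp (Write aH (Plus (Var vj) (Var vj)) (Var vj) ;;
        Write aH (Plus (Plus (Var vj) (Var vj)) (Num 1)) (Var vj))
        (\<lambda>vs'' as''. vs'' vj = c \<and> J (Suc c) (vs''(vj := Suc c)) as'') vs' as'"
        using c(2) V(2) by simp
    next
      fix vs' as' assume J: "J (M + 1) vs' as'"
      then show "wp C3 ?goal vs' as'" by (intro 3) (use that in \<open>auto simp: J_def\<close>)
    qed (use bounds_V(1) in \<open>auto simp: B_def G_def\<close>)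
    moreover have "vs vx + vs vx = M" "M + M + vs vG = B" "M \<le> V" using M that MV(3) by simp_all
    ultimately show ?thesis using MV(1,2) V(2) unfolding C2_def by (simp del: small_le_V)
  qed
  have 1: "wp C1 (wp C2 (wp C3 ?goal)) vs z" if "?Z vs" "vs vS = S" for vs
  proof -
    let ?vs = "vs(vG := G, vx := 0)"
    have "wp (Rep 1 (Var vn) (vx ::= Plus (Var vx) (Minus (Var vS) (Num 1)))) (wp C2 (wp C3 ?goal)) ?vs z"
    proof (rule wp_Rep[where I = "\<lambda>i vs' as'. as' = z \<and> (\<forall>v. v \<noteq> vx \<longrightarrow> vs' v = ?vs v) \<and> vs' vx = i * (n * n + 1)"])
      show "aval (Var vn) ?vs z \<le> \<beta> ^ 1" using that n1 by simp
    next
      fix i vs' as' assume "i < aval (Var vn) ?vs z" and I: "as' = z \<and> (\<forall>v. v \<noteq> vx \<longrightarrow> vs' v = ?vs v) \<and> vs' vx = i * (n * n + 1)"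
      then have i: "i < n" using that by simp
      then have "Suc i * (n * n + 1) \<le> n * (n * n + 1)" by (intro mult_le_mono1) simp
      also have "\<dots> \<le> V" using small_le_V(5) by (simp add: M_def)
      finally show "wp (vx ::= Plus (Var vx) (Minus (Var vS) (Num 1)))
        (\<lambda>vs' as'. as' = z \<and> (\<forall>v. v \<noteq> vx \<longrightarrow> vs' v = ?vs v) \<and> vs' vx = Suc i * (n * n + 1)) vs' as'"
        using I that V(2) by (simp add: S_def)
    next
      fix vs' as' assume "as' = z \<and> (\<forall>v. v \<noteq> vx \<longrightarrow> vs' v = ?vs v) \<and> vs' vx = aval (Var vn) ?vs z * (n * n + 1)"
      then show "wp C2 (wp C3 ?goal) vs' as'" using that by (simp only:) (intro 2; simp)
    qed auto
    then show ?thesis using that nV V12 by (simp add: C1_def G_def)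
  qed
  let ?v0 = "((\<lambda>_. 0)(vn := n, vS := 2)) :: vars"
  have "wp (Rep 1 (Var vn) (vS ::= Plus (Var vS) (Var vn))) (wp C1 (wp C2 (wp C3 ?goal))) ?v0 z"
  proof (rule wp_Rep[where I = "\<lambda>i vs' as'. as' = z \<and> (\<forall>v. v \<noteq> vS \<longrightarrow> vs' v = ?v0 v) \<and> vs' vS = 2 + i * n"])
    show "aval (Var vn) ?v0 z \<le> \<beta> ^ 1" using n1 by simp
  next
    fix i vs' as' assume "i < aval (Var vn) ?v0 z" and I: "as' = z \<and> (\<forall>v. v \<noteq> vS \<longrightarrow> vs' v = ?v0 v) \<and> vs' vS = 2 + i * n"
    then have "Suc i * n \<le> n * n" by (intro mult_le_mono1) simp
    then show "wp (vS ::= Plus (Var vS) (Var vn)) (\<lambda>vs' as'. as' = z \<and> (\<forall>v. v \<noteq> vS \<longrightarrow> vs' v = ?v0 v) \<and> vs' vS = 2 + Suc i * n) vs' as'"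
      using I nV by simp
  next
    fix vs' as' assume "as' = z \<and> (\<forall>v. v \<noteq> vS \<longrightarrow> vs' v = ?v0 v) \<and> vs' vS = 2 + aval (Var vn) ?v0 z * n"
    then show "wp C1 (wp C2 (wp C3 ?goal)) vs' as'" by (simp only:) (intro 1; simp add: S_def)
  qed auto
  then show ?thesis using V12 by (simp add: initialise_def C1_def C2_def C3_def z_def)
qed

lemma wp_word_problem_program:
  assumes w: "length w = n" "\<And>i. i < n \<Longrightarrow> inp i = letter_code (w ! i)"
  shows "wp word_problem_program (\<lambda>vs as. vs 0 = (if w \<in> word_problem_G12 then 1 else 0)) ((\<lambda>_. 0)(0 := n)) (\<lambda>_ _. 0)"
  unfolding word_problem_program_def wp.simps(4)
proof (rule wp_mono[OF wp_initialise])
  fix vs as assume 0: "vs vn = n \<and> tracks 0 (0, 0, []) vs as"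
  define s where "s i = fold britton_step (take i w) (0, 0, [])" for i
  let ?I = "\<lambda>i vs' as'. vs' vn = n \<and> tracks i (s i) vs' as'"
  show "wp (For 1 vi (Var vn) read_letter) (wp answer (\<lambda>vs as. vs 0 = (if w \<in> word_problem_G12 then 1 else 0))) vs as"
  proof (rule wp_For[where c = n and I = ?I])
    show "n \<le> \<beta> ^ 1" using loop_bounds(3) by simp
    have "tracks 0 (0, 0, []) (vs(vi := 0)) as" by (rule tracks_cong[of _ _ vs as]) (use 0 in auto)
    then show "?I 0 (vs(vi := 0)) as" using 0 by (simp add: s_def)
  next
    fix i vs' as' assume i: "i < n" "vs' vi = i" and I: "?I i vs' as'"
    have "wp read_letter (tracks (Suc i) (britton_step (w ! i) (s i))) vs' as'"
      using I i w by (intro wp_read_letter) auto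
    moreover have "britton_step (w ! i) (s i) = s (Suc i)"
      using i w by (simp add: s_def take_Suc_conv_app_nth)
    ultimately have W: "wp read_letter (tracks (Suc i) (s (Suc i))) vs' as'" by (simp only:)
    show "wp read_letter (\<lambda>vs'' as''. vs'' vi = i \<and> ?I (Suc i) (vs''(vi := Suc i)) as'') vs' as'"
    proof (rule wp_conseq[OF W])
      fix vs2 as2 assume T: "tracks (Suc i) (s (Suc i)) vs2 as2"
        and u: "unchanged read_letter vs' as' vs2 as2"
      have "vs2 vi = vs' vi" "vs2 vn = vs' vn" using u read_letter_mod by (auto simp: unchanged_def)
      moreover have "tracks (Suc i) (s (Suc i)) (vs2(vi := Suc i)) as2"
        by (rule tracks_cong[OF T]) auto
      ultimately show "vs2 vi = i \<and> ?I (Suc i) (vs2(vi := Suc i)) as2" using I i by simp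
    qed
  next
    fix vs' as' assume "?I n vs' as'"
    moreover obtain r k l where rkl: "s n = (r, k, l)" by (metis prod.exhaust)
    ultimately have "wp answer (\<lambda>vs' as'. vs' 0 = (if (r, k, l) = (0, 0, []) then 1 else 0)) vs' as'"
      by (intro wp_answer) simp
    moreover have "w \<in> word_problem_G12 \<longleftrightarrow> (r, k, l) = (0, 0, [])"
      unfolding word_problem_iff_britton using rkl w(1) by (simp add: s_def)
    ultimately show "wp answer (\<lambda>vs as. vs 0 = (if w \<in> word_problem_G12 then 1 else 0)) vs' as'" by simp
  qed (use 0 in auto)
qed

end

lemma letter_code_le: "letter_code x \<le> 6"
  by (cases x rule: letter_code.cases) auto

theorem word_problem_decidable: "decidable_in_time letter_code word_problem_G12 (\<lambda>n. real n ^ 7)"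
proof -
  have "decidable_in_time letter_code word_problem_G12 (\<lambda>n. real n ^ loop_degree word_problem_program)"
  \<comment> \<open>These values give the bounds of \<open>solver\<close>,
    \<open>\<beta> = n + 16\<close> and \<open>V = \<beta> ^ 6\<close>.\<close>
  proof (rule decidable_in_time_by_wp[where K = 16 and m = 5])
    show "letter_code x \<le> 16" for x using letter_code_le[of x] by simp
    fix w :: "gen_atb word"
    let ?n = "length w" and ?inp = "\<lambda>i. if i < length w then letter_code (w ! i) else 0"
    have "?n + 16 \<le> (?n + 16) ^ Suc 5" by (intro self_le_power) auto
    moreover have "?inp i \<le> 16" for i using letter_code_le[of "w ! i"] by simp
    ultimately interpret solver ?n "(?n + 16) ^ Suc 5" "?n + 16" ?inp
    proof unfold_locales
      show "?inp i \<le> (?n + 16) ^ Suc 5" for i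
        using \<open>?inp i \<le> 16\<close> \<open>?n + 16 \<le> (?n + 16) ^ Suc 5\<close> by linarith
    qed (use \<open>?n + 16 \<le> (?n + 16) ^ Suc 5\<close> in \<open>linarith | simp\<close>)+
    show "wp word_problem_program (\<lambda>vs as. vs 0 = (if w \<in> word_problem_G12 then 1 else 0))
      ((\<lambda>_. 0)(0 := length w)) (\<lambda>_ _. 0)"
      by (rule wp_word_problem_program) auto
  qed simp
  then show ?thesis by (simp add: word_problem_program_degree)
qed

theorem theorem5p5:
  shows "(\<exists>h \<in> iso G12 G12_atb.
            h (generator rel_ab a2) = generator rel_atb a3 \<and>
            h (generator rel_ab b2) = generator rel_atb b3 \<and>
            h (letter_G12 t3) = generator rel_atb t3)
       \<and> decidable_in_time letter_code word_problem_G12 (\<lambda>n. real n ^ 7)"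
  using iso_map_iso iso_map_letters word_problem_decidable by blast

end
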